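(* (1) Let $a\in\mathbb{C}$, $w\in\mathbb{D}\setminus\{0\}$, let $n,m\ge 1$ be integers, and let $\phi(z)=az^n(z-w)^m+(\bar z-w^{-1})^m$. Then $T_\phi$ is invertible if and only if $|a|<|w|^{-m}$. (2) Let $a,b,c\in\mathbb{C}$ and $\phi(z)=\bar z+a+bz+cz^2$. Then the spectrum of $T_\phi$ is a subset of $\overline{\phi(\mathbb{D})}$.
   Context: $\mathbb{D}=\{z\in\mathbb{C}:|z|<1\}$ is the open unit disc. $A^2(\mathbb{D})$ is the Bergman space of holomorphic functions on $\mathbb{D}$ that are square integrable with respect to normalized Lebesgue area measure. For $\phi\in L^\infty(\mathbb{D})$ the Toeplitz operator $T_\phi:A^2(\mathbb{D})\to A^2(\mathbb{D})$ is $T_\phi(f)=P(\phi f)$, where $P:L^2(\mathbb{D})\to A^2(\mathbb{D})$ is the orthogonal projection. $\overline{\phi(\mathbb{D})}$ is the closure of the image $\phi(\mathbb{D})$ in $\mathbb{C}$. *)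

theory Defs
  imports "HOL-Complex_Analysis.Complex_Analysis"
begin

definition disc_measure :: "complex measure" where
  "disc_measure = uniform_measure lborel (ball 0 1)"

definition L2_disc :: "(complex \<Rightarrow> complex) set" where
  "L2_disc = {f \<in> borel_measurable disc_measure. integrable disc_measure (\<lambda>z. (norm (f z))\<^sup>2)}"

definition L2_inner :: "(complex \<Rightarrow> complex) \<Rightarrow> (complex \<Rightarrow> complex) \<Rightarrow> complex" where
  "L2_inner f g = (LINT z|disc_measure. f z * cnj (g z))"

definition L2_disc_norm :: "(complex \<Rightarrow> complex) \<Rightarrow> real" where
  "L2_disc_norm f = sqrt (LINT z|disc_measure. (norm (f z))\<^sup>2)"

text \<open>
  HOL functions are total, so a function on the disc is represented by its extension
  by 0 to the whole plane. Thus each element of the Bergman space has exactly one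
  representative and equality of elements is equality of functions.
\<close>

definition bergman_space :: "(complex \<Rightarrow> complex) set" where
  "bergman_space =
     {f \<in> L2_disc. f holomorphic_on ball 0 1 \<and> (\<forall>z. z \<notin> ball 0 1 \<longrightarrow> f z = 0)}"

text \<open>
  The orthogonal projection, meaningful for \<open>g \<in> L2_disc\<close>: the unique element of the
  Bergman space that differs from \<open>g\<close> by a function orthogonal to the Bergman space.
\<close>

definition bergman_proj :: "(complex \<Rightarrow> complex) \<Rightarrow> (complex \<Rightarrow> complex)" where
  "bergman_proj g =
     (THE f. f \<in> bergman_space \<and> (\<forall>h\<in>bergman_space. L2_inner (\<lambda>z. g z - f z) h = 0))"

definition toeplitz ::
    "(complex \<Rightarrow> complex) \<Rightarrow> (complex \<Rightarrow> complex) \<Rightarrow> (complex \<Rightarrow> complex)" where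
  "toeplitz \<phi> f = bergman_proj (\<lambda>z. \<phi> z * f z)"

definition bounded_bergman_op :: "((complex \<Rightarrow> complex) \<Rightarrow> (complex \<Rightarrow> complex)) \<Rightarrow> bool" where
  "bounded_bergman_op T \<longleftrightarrow>
     (\<forall>f\<in>bergman_space. T f \<in> bergman_space) \<and>
     (\<forall>f\<in>bergman_space. \<forall>g\<in>bergman_space. T (\<lambda>z. f z + g z) = (\<lambda>z. T f z + T g z)) \<and>
     (\<forall>c. \<forall>f\<in>bergman_space. T (\<lambda>z. c * f z) = (\<lambda>z. c * T f z)) \<and>
     (\<exists>K. \<forall>f\<in>bergman_space. L2_disc_norm (T f) \<le> K * L2_disc_norm f)"

text \<open>
  Invertibility and spectrum in the algebra of bounded operators on the Bergman space;
  values of an operator outside \<open>bergman_space\<close> are irrelevant.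
\<close>

definition invertible_bergman_op :: "((complex \<Rightarrow> complex) \<Rightarrow> (complex \<Rightarrow> complex)) \<Rightarrow> bool" where
  "invertible_bergman_op T \<longleftrightarrow>
     bounded_bergman_op T \<and>
     (\<exists>S. bounded_bergman_op S \<and> (\<forall>f\<in>bergman_space. S (T f) = f \<and> T (S f) = f))"

definition bergman_spectrum :: "((complex \<Rightarrow> complex) \<Rightarrow> (complex \<Rightarrow> complex)) \<Rightarrow> complex set" where
  "bergman_spectrum T = {\<mu>. \<not> invertible_bergman_op (\<lambda>f z. T f z - \<mu> * f z)}"

end

theory Submission
  imports Defs "Jordan_Normal_Form.Determinant"
begin

text \<open>
  Write \<open>T\<^sub>\<phi>\<close> for the Toeplitz operator with the symbol \<open>\<phi>\<close>. Two rules hold for analytic \<open>g\<close> and \<open>h\<close>: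
  \<open>T\<^sub>\<psi> T\<^sub>h\<close> has the symbol \<open>\<psi> h\<close> (\<open>toeplitz_mult_right\<close>), and the operator with the symbol \<open>cnj g\<close> composed with
  \<open>T\<^sub>\<psi>\<close> has the symbol \<open>cnj g \<psi>\<close> (\<open>toeplitz_coanalytic_left\<close>). If \<open>g\<close> and \<open>h\<close> have no zeros in the closed disc,
  the operators with the symbols \<open>h\<close> and \<open>cnj g\<close> are invertible. So a symbol \<open>cnj g h\<close> of this kind gives an
  invertible operator, and so does \<open>cnj g (1 + \<theta>)\<close> if \<open>|\<theta>|\<close> is bounded by a constant below 1.

  In the harder cases the symbol has such a form only on the circle, where \<open>cnj z = 1 / z\<close>. But if two
  continuous symbols agree
  on the circle, their operators differ by an operator whose symbol vanishes there, and this one is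
  approximated in norm by operators of finite rank (\<open>vanishing_symbol_tail\<close>). The Fredholm alternative
  \<open>invertible_op_plus_vanishing_toeplitz\<close> follows: an invertible operator plus such an operator is invertible as
  soon as it is injective.

  In the first part, \<open>|a| < |w|\<^sup>-\<^sup>m\<close> makes the symbol \<open>cnj q (1 + \<theta>)\<close> with \<open>q(z) = (z - 1 / cnj w)\<^sup>m\<close> and
  \<open>|\<theta>| \<le> |a| |w|\<^sup>m < 1\<close> (\<open>invertible_toeplitz_dominated\<close>). If \<open>|a| > |w|\<^sup>-\<^sup>m\<close>, the symbol agrees on the circle with
  the product of a conjugate analytic function without zeros and of \<open>z\<^sup>n (z - w)\<^sup>m\<close>, whose operator is injective
  but not onto; the Fredholm alternative excludes that the given operator is invertible
  (\<open>not_invertible_toeplitz_winding\<close>). Equality is reduced to this case because the invertible operators form an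
  open set.

  In the second part, let \<open>\<mu>\<close> be outside the closure of the image of the disc. Absorbing \<open>\<mu>\<close> into \<open>a\<close>, one may take
  \<open>\<mu> = 0\<close>, so that \<open>\<phi>(z) = cnj z + a + b z + c z\<^sup>2\<close> has no zero in the closed disc and hence winding number 0 on the
  circle. There \<open>z \<phi>\<close> is the cubic polynomial \<open>1 + a z + b z\<^sup>2 + c z\<^sup>3 = (1 - \<zeta> z) (1 - \<alpha> z) (1 - \<beta> z)\<close>, so exactly one
  of its zeros, say \<open>1 / \<zeta>\<close>, is inside. On the circle \<open>\<phi>\<close> is then \<open>(cnj z - \<zeta>) (1 - \<alpha> z) (1 - \<beta> z)\<close>, the symbol of
  an invertible operator, and injectivity of \<open>T\<^sub>\<phi>\<close> remains. The primitive \<open>F\<close> with \<open>F(0) = 0\<close> of an element of the kernel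
  satisfies \<open>F = z (1 - \<zeta> z) (1 - \<alpha> z) (1 - \<beta> z) F'\<close>. At \<open>1 / \<zeta>\<close> a nonzero solution would have a zero of some order \<open>n\<close>
  with \<open>n (1 - \<alpha> / \<zeta>) (1 - \<beta> / \<zeta>) = -1\<close>, which is impossible for two factors with positive real part. This is
  the point where the degree of the symbol matters.

  The analytic background is the description of the Bergman space by Taylor coefficients: the monomials are
  orthogonal with squared norms \<open>1 / (n + 1)\<close>, and the coefficient sequences are those with
  \<open>(\<Sum>n. |c\<^sub>n|\<^sup>2 / (n + 1)) < \<infinity>\<close>. Existence of the Bergman projection and completeness are read off from it.
\<close>

section \<open>Moments of the normalized area measure\<close>

lemma nn_integral_lborel_translate:
  fixes f :: "'a::euclidean_space \<Rightarrow> ennreal"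
  assumes [measurable]: "f \<in> borel_measurable borel"
  shows "(\<integral>\<^sup>+z. f (z + c) \<partial>lborel) = (\<integral>\<^sup>+z. f z \<partial>lborel)"
proof -
  have "(\<integral>\<^sup>+z. f z \<partial>lborel) = (\<integral>\<^sup>+z. f z \<partial>(distr lborel borel ((+) c)))"
    by (simp add: lborel_distr_plus)
  also have "\<dots> = (\<integral>\<^sup>+z. f (z + c) \<partial>lborel)"
    by (subst nn_integral_distr) (auto simp: add.commute)
  finally show ?thesis by simp
qed

text \<open>
  Lebesgue measure and its rotated copy are both translation invariant, hence proportional:
  integrate \<open>1\<^sub>A(x) f(u y + x)\<close> over \<open>x\<close> and \<open>y\<close> in either order, where \<open>A\<close> is the unit disc. The factor
  is 1 because \<open>A\<close> is invariant under rotation.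
\<close>

lemma nn_integral_lborel_rotate:
  fixes f :: "complex \<Rightarrow> ennreal"
  assumes [measurable]: "f \<in> borel_measurable borel" and u: "norm u = 1"
  shows "(\<integral>\<^sup>+z. f (u * z) \<partial>lborel) = (\<integral>\<^sup>+z. f z \<partial>lborel)"
proof -
  define A where "A = (ball 0 1 :: complex set)"
  have [measurable]: "A \<in> sets borel" by (simp add: A_def)
  \<comment> \<open>a reference volume that is neither 0 nor infinite, so that it can be cancelled at the end\<close>
  define V where "V = emeasure lborel A"
  have V0: "V \<noteq> 0" "V \<noteq> \<infinity>"
    by (auto simp: V_def A_def emeasure_ball unit_ball_vol_2)
  have u0: "u \<noteq> 0" using u by auto
  have "V * (\<integral>\<^sup>+y. f (u * y) \<partial>lborel) = (\<integral>\<^sup>+x. indicator A x * (\<integral>\<^sup>+y. f (u * y) \<partial>lborel) \<partial>lborel)"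
    unfolding V_def by (subst nn_integral_multc) (auto intro!: borel_measurable_indicator)
  also have "\<dots> = (\<integral>\<^sup>+x. (\<integral>\<^sup>+y. indicator A x * f (u * y + x) \<partial>lborel) \<partial>lborel)"
  proof (rule nn_integral_cong)
    fix x
    have "(\<integral>\<^sup>+y. f (u * y + x) \<partial>lborel) = (\<integral>\<^sup>+y. f (u * (y + x / u)) \<partial>lborel)"
      using u0 by (simp add: algebra_simps)
    also have "\<dots> = (\<integral>\<^sup>+y. f (u * y) \<partial>lborel)"
      by (rule nn_integral_lborel_translate) measurable
    finally show "indicator A x * (\<integral>\<^sup>+y. f (u * y) \<partial>lborel) =
      (\<integral>\<^sup>+y. indicator A x * f (u * y + x) \<partial>lborel)"
      by (subst nn_integral_cmult) auto
  qed
  also have "\<dots> = (\<integral>\<^sup>+y. (\<integral>\<^sup>+x. indicator A x * f (u * y + x) \<partial>lborel) \<partial>lborel)"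
    by (rule lborel_pair.Fubini') measurable
  also have "\<dots> = (\<integral>\<^sup>+y. (\<integral>\<^sup>+x. indicator A (x - u * y) * f x \<partial>lborel) \<partial>lborel)"
  proof (rule nn_integral_cong)
    fix y
    have "(\<integral>\<^sup>+x. indicator A (x + u * y - u * y) * f (x + u * y) \<partial>lborel) =
      (\<integral>\<^sup>+x. indicator A (x - u * y) * f x \<partial>lborel)"
      by (rule nn_integral_lborel_translate[where f = "\<lambda>x. indicator A (x - u * y) * f x"]) measurable
    then show "(\<integral>\<^sup>+x. indicator A x * f (u * y + x) \<partial>lborel) =
      (\<integral>\<^sup>+x. indicator A (x - u * y) * f x \<partial>lborel)"
      by (simp add: add.commute)
  qed
  also have "\<dots> = (\<integral>\<^sup>+x. (\<integral>\<^sup>+y. indicator A (x - u * y) * f x \<partial>lborel) \<partial>lborel)"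
    by (rule lborel_pair.Fubini') measurable
  also have "\<dots> = (\<integral>\<^sup>+x. V * f x \<partial>lborel)"
  proof (rule nn_integral_cong)
    fix x
    have "norm (x - u * y) = norm (y - x / u)" for y
    proof -
      have "x - u * y = - (u * (y - x / u))" using u0 by (simp add: algebra_simps)
      then show ?thesis using u by (simp only: norm_minus_cancel norm_mult mult_1)
    qed
    then have "(\<integral>\<^sup>+y. indicator A (x - u * y) \<partial>lborel) = (\<integral>\<^sup>+y. indicator A (y + - (x / u)) \<partial>lborel)"
      by (intro nn_integral_cong) (auto simp: A_def indicator_def)
    also have "\<dots> = (\<integral>\<^sup>+y. indicator A y \<partial>lborel)"
      by (rule nn_integral_lborel_translate) measurable
    finally have "(\<integral>\<^sup>+y. indicator A (x - u * y) \<partial>lborel) = V"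
      by (simp add: V_def)
    then show "(\<integral>\<^sup>+y. indicator A (x - u * y) * f x \<partial>lborel) = V * f x"
      by (subst nn_integral_multc) auto
  qed
  also have "\<dots> = V * (\<integral>\<^sup>+x. f x \<partial>lborel)"
    by (rule nn_integral_cmult) auto
  finally show ?thesis
    using V0 by (simp add: ennreal_mult_cancel_left)
qed

lemma sets_disc_measure [simp, measurable_cong]: "sets disc_measure = sets borel"
  by (simp add: disc_measure_def)

lemma space_disc_measure [simp]: "space disc_measure = UNIV"
  by (simp add: disc_measure_def)

lemma emeasure_unit_disc: "emeasure lborel (ball 0 1 :: complex set) = ennreal pi"
  by (simp add: emeasure_ball unit_ball_vol_2)

interpretation disc: finite_measure disc_measure
  by (rule finite_measureI)
    (simp add: disc_measure_def emeasure_unit_disc ennreal_divide_self)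

lemma nn_integral_disc:
  assumes [measurable]: "f \<in> borel_measurable borel"
  shows "(\<integral>\<^sup>+z. f z \<partial>disc_measure) = (\<integral>\<^sup>+z. f z * indicator (ball 0 1) z \<partial>lborel) / ennreal pi"
  unfolding disc_measure_def
  by (subst nn_integral_uniform_measure) (auto simp: emeasure_unit_disc)

lemma disc_measure_rotate:
  assumes u: "norm u = 1"
  shows "distr disc_measure borel (\<lambda>z. u * z) = disc_measure"
proof (rule measure_eqI)
  fix B assume "B \<in> sets (distr disc_measure borel (\<lambda>z. u * z))"
  then have B [measurable]: "B \<in> sets borel" by simp
  have "emeasure (distr disc_measure borel (\<lambda>z. u * z)) B = (\<integral>\<^sup>+z. indicator B (u * z) \<partial>disc_measure)"
    by (subst nn_integral_indicator [symmetric], simp, subst nn_integral_distr) auto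
  also have "\<dots> = (\<integral>\<^sup>+z. indicator B (u * z) * indicator (ball 0 1) (u * z) \<partial>lborel) / ennreal pi"
    by (subst nn_integral_disc) (auto simp: indicator_def norm_mult u)
  also have "\<dots> = (\<integral>\<^sup>+z. indicator B z * indicator (ball 0 1) z \<partial>lborel) / ennreal pi"
  proof -
    have "(\<lambda>z. indicator B z * indicator (ball 0 1) z :: ennreal) \<in> borel_measurable borel"
      by (intro borel_measurable_times_ennreal borel_measurable_indicator) (simp_all add: B)
    from nn_integral_lborel_rotate[OF this u] show ?thesis by simp
  qed
  also have "\<dots> = emeasure disc_measure B"
    by (subst nn_integral_indicator [symmetric], simp, subst nn_integral_disc) auto
  finally show "emeasure (distr disc_measure borel (\<lambda>z. u * z)) B = emeasure disc_measure B" .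
qed simp

lemma AE_disc: "AE z in disc_measure. z \<in> ball 0 1"
  unfolding disc_measure_def by (rule AE_uniform_measureI) auto

lemma integral_disc_rotate:
  fixes f :: "complex \<Rightarrow> complex"
  assumes "f \<in> borel_measurable borel" "norm u = 1"
  shows "(LINT z|disc_measure. f (u * z)) = (LINT z|disc_measure. f z)"
  by (subst disc_measure_rotate[OF assms(2), symmetric], subst integral_distr) (use assms in auto)

text \<open>
  A disc of radius \<open>r\<close> has normalized area \<open>r\<^sup>2\<close>. Radial integrals thus become integrals over
  the unit interval, which takes the place of polar coordinates.
\<close>

lemma disc_square_uniform:
  "distr disc_measure borel (\<lambda>z. (norm z)\<^sup>2) = uniform_measure lborel {0..1::real}"
proof (rule measure_eqI_lessThan)
  interpret D: finite_measure "distr disc_measure borel (\<lambda>z. (norm z)\<^sup>2)"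
    by (rule disc.finite_measure_distr) auto
  show "emeasure (distr disc_measure borel (\<lambda>z. (norm z)\<^sup>2)) {x<..} < \<infinity>" for x
    unfolding infinity_ennreal_def less_top[symmetric] by (rule D.emeasure_finite)
  fix x :: real
  have pi: "ennreal a / ennreal pi = ennreal (a / pi)" if "a \<ge> 0" for a
    using that by (simp add: divide_ennreal)
  have "emeasure (distr disc_measure borel (\<lambda>z. (norm z)\<^sup>2)) {x<..}
      = emeasure lborel (ball 0 1 \<inter> {z::complex. x < (norm z)\<^sup>2}) / ennreal pi"
    by (simp add: emeasure_distr disc_measure_def emeasure_unit_disc vimage_def)
  also have "\<dots> = emeasure lborel ({0..1} \<inter> {x<..}) / emeasure lborel {0..1::real}"
  proof -
    have *: "t < s\<^sup>2 \<longleftrightarrow> sqrt t < s" if "t \<ge> 0" "s \<ge> 0" for s t :: real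
      using that by (metis real_sqrt_abs real_sqrt_less_iff abs_of_nonneg)
    consider "x < 0" | "0 \<le> x" "x < 1" | "1 \<le> x" by linarith
    then show ?thesis
    proof cases
      case 1
      have "x < (norm z)\<^sup>2" for z :: complex
        using 1 zero_le_power2[of "norm z"] by linarith
      moreover have "{0..1} \<inter> {x<..} = {0..1}" using 1 by auto
      ultimately show ?thesis
        by (simp add: emeasure_unit_disc ennreal_divide_self)
    next
      case 2
      have "ball 0 1 \<inter> {z::complex. x < (norm z)\<^sup>2} = ball 0 1 - cball 0 (sqrt x)"
        using 2 by (auto simp: *)
      moreover have "emeasure lborel (ball 0 1 - cball 0 (sqrt x) :: complex set)
          = emeasure lborel (ball 0 1 :: complex set) - emeasure lborel (cball 0 (sqrt x) :: complex set)"
      proof (rule emeasure_Diff)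
        have "sqrt x < 1" using 2 by simp
        then show "cball 0 (sqrt x) \<subseteq> (ball 0 1 :: complex set)"
          by (auto simp del: real_sqrt_lt_1_iff)
      qed (use 2 in \<open>auto simp: emeasure_cball\<close>)
      moreover have "emeasure lborel (cball 0 (sqrt x) :: complex set) = ennreal (pi * x)"
        using 2 by (subst emeasure_cball) (auto simp: unit_ball_vol_2)
      moreover have "{0..1} \<inter> {x<..} = {x<..1}"
        using 2 by auto
      moreover have "(pi - pi * x) / pi = 1 - x" by (simp add: field_simps)
      ultimately show ?thesis
        using 2 divide_ennreal[of "1 - x" 1] by (simp add: emeasure_unit_disc ennreal_minus pi mult_left_le divide_ennreal)
    next
      case 3
      have "\<not> x < (norm z)\<^sup>2" if "norm z < 1" for z :: complex
      proof -
        have "(norm z)\<^sup>2 \<le> 1" using that by (intro power_le_one) simp_all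
        then show ?thesis using 3 by linarith
      qed
      then have "ball 0 1 \<inter> {z::complex. x < (norm z)\<^sup>2} = {}" by auto
      moreover have "{0..1} \<inter> {x<..} = {}" using 3 by auto
      ultimately show ?thesis by simp
    qed
  qed
  finally show "emeasure (distr disc_measure borel (\<lambda>z. (norm z)\<^sup>2)) {x<..} =
      emeasure (uniform_measure lborel {0..1}) {x<..}"
    by simp
qed auto

lemma integrable_disc_bounded:
  fixes f :: "complex \<Rightarrow> 'a::{banach, second_countable_topology}"
  assumes "f \<in> borel_measurable borel" "\<And>z. norm z < 1 \<Longrightarrow> norm (f z) \<le> B"
  shows "integrable disc_measure f"
proof (rule disc.integrable_const_bound)
  show "AE z in disc_measure. norm (f z) \<le> B"
    using AE_disc by eventually_elim (simp add: assms)
  show "f \<in> borel_measurable disc_measure"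
    using assms(1) by (simp add: measurable_def)
qed

lemma disc_moment: "(LINT z|disc_measure. (norm z)^(2*n)) = 1 / (real n + 1)"
proof -
  have "(LINT z|disc_measure. (norm z)^(2*n)) = (LINT t|distr disc_measure borel (\<lambda>z. (norm z)\<^sup>2). t^n)"
    by (subst integral_distr) (auto simp: power_mult)
  also have "\<dots> = (LINT t|lborel. indicator {0..1} t * t^n)"
  proof -
    have "uniform_measure lborel {0..1::real} = density lborel (\<lambda>x. ennreal (indicator {0..1} x))"
      unfolding uniform_measure_def by (intro density_cong) (auto simp: indicator_def)
    then show ?thesis
      unfolding disc_square_uniform by (simp add: integral_density)
  qed
  also have "\<dots> = 1 / (real n + 1)"
  proof -
    have "((\<lambda>t. t^(n+1) / (n+1)) has_real_derivative t^n) (at t within {0..1})" for t :: real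
    proof -
      have "((\<lambda>t. t^(Suc n) / real (Suc n)) has_real_derivative (real (Suc n) * t^n) / real (Suc n)) (at t within {0..1})"
        by (rule DERIV_cdivide) (use DERIV_pow[of "Suc n" t "{0..1}"] in simp)
      then show ?thesis by (simp del: of_nat_Suc power_Suc add: Suc_eq_plus1[symmetric])
    qed
    then have "((\<lambda>t::real. t^n) has_integral (1^(n+1)/(n+1) - 0^(n+1)/(n+1))) {0..1}"
      by (intro fundamental_theorem_of_calculus)
        (auto simp: has_real_derivative_iff_has_vector_derivative[symmetric])
    moreover have "set_integrable lborel {0..1} (\<lambda>t::real. t^n)"
      by (intro borel_integrable_atLeastAtMost') (auto intro!: continuous_intros)
    ultimately show ?thesis
      using set_borel_integral_eq_integral(2)[of "{0..1}" "\<lambda>t::real. t^n"]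
      by (simp add: set_lebesgue_integral_def integral_unique add.commute)
  qed
  finally show ?thesis .
qed

text \<open>
  A rotation by the angle \<open>t\<close> multiplies the integrand by \<open>exp (i (n - m) t)\<close>; for
  \<open>t = \<pi> / (n - m)\<close> the factor is \<open>-1\<close>, so the integral equals its negative.
\<close>

lemma disc_monomials_orthogonal:
  "(LINT z|disc_measure. z^n * cnj (z^m)) = (if n = m then 1 / (n + 1) else 0)"
proof (cases "n = m")
  case True
  have "(LINT z|disc_measure. z^n * cnj (z^n)) = (LINT z|disc_measure. complex_of_real ((norm z)^(2*n)))"
    by (intro Bochner_Integration.integral_cong)
      (auto simp: complex_norm_square[symmetric] norm_power power_mult[symmetric] mult.commute
        simp flip: complex_cnj_power)
  also have "\<dots> = complex_of_real (1 / (real n+1))"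
    unfolding integral_complex_of_real disc_moment by simp
  finally show ?thesis using True by simp
next
  case False
  define u where "u = cis (pi / (real n - real m))"
  let ?f = "\<lambda>z::complex. z^n * cnj (z^m)"
  have u: "norm u = 1" by (simp add: u_def)
  have "(LINT z|disc_measure. ?f z) = (LINT z|disc_measure. ?f (u * z))"
    by (rule integral_disc_rotate[symmetric, OF borel_measurable_continuous_onI u])
      (intro continuous_intros)
  also have "\<dots> = (LINT z|disc_measure. (u^n * cnj (u^m)) * ?f z)"
    by (intro Bochner_Integration.integral_cong) (auto simp: power_mult_distrib)
  also have "\<dots> = (u^n * cnj (u^m)) * (LINT z|disc_measure. ?f z)"
    by (rule integral_mult_right_zero)
  finally have *: "(LINT z|disc_measure. ?f z) = (u^n * cnj (u^m)) * (LINT z|disc_measure. ?f z)" .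
  have "u^n * cnj (u^m) = cis (real n * (pi / (real n - real m)) - real m * (pi / (real n - real m)))"
    by (simp add: u_def Complex.DeMoivre cis_cnj cis_mult)
  moreover have "real n * (pi / (real n - real m)) - real m * (pi / (real n - real m)) = pi"
    unfolding left_diff_distrib[symmetric] using False by simp
  ultimately have "u^n * cnj (u^m) = -1" by simp
  with * show ?thesis using False by simp
qed

section \<open>Square integrable functions on the disc\<close>

lemma L2_discD:
  assumes "f \<in> L2_disc"
  shows "f \<in> borel_measurable borel" "integrable disc_measure (\<lambda>z. (norm (f z))\<^sup>2)"
  using assms by (simp_all add: L2_disc_def measurable_def)

lemma L2_discI:
  assumes "f \<in> borel_measurable borel" "integrable disc_measure (\<lambda>z. (norm (f z))\<^sup>2)"
  shows "f \<in> L2_disc"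
  using assms by (simp add: L2_disc_def measurable_def)

lemma L2_norm_nonneg [simp]: "0 \<le> L2_disc_norm f"
  by (simp add: L2_disc_norm_def)

lemma L2_norm_square: "(L2_disc_norm f)\<^sup>2 = (LINT z|disc_measure. (norm (f z))\<^sup>2)"
  by (simp add: L2_disc_norm_def)

lemma borel_measurable_disc [simp]:
  "f \<in> borel_measurable disc_measure \<longleftrightarrow> f \<in> borel_measurable borel"
  by (simp add: measurable_def)

lemma L2_add:
  assumes f: "f \<in> L2_disc" and g: "g \<in> L2_disc"
  shows "(\<lambda>z. f z + g z) \<in> L2_disc"
proof (rule L2_discI)
  show m: "(\<lambda>z. f z + g z) \<in> borel_measurable borel"
    using L2_discD[OF f] L2_discD[OF g] by (intro borel_measurable_add)
  show "integrable disc_measure (\<lambda>z. (norm (f z + g z))\<^sup>2)"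
  proof (rule Bochner_Integration.integrable_bound)
    show "integrable disc_measure (\<lambda>z. 2 * (norm (f z))\<^sup>2 + 2 * (norm (g z))\<^sup>2)"
      using L2_discD[OF f] L2_discD[OF g] by auto
    show "(\<lambda>z. (norm (f z + g z))\<^sup>2) \<in> borel_measurable disc_measure"
      using m by (simp del: space_disc_measure)
    have "(norm (f z + g z))\<^sup>2 \<le> 2 * (norm (f z))\<^sup>2 + 2 * (norm (g z))\<^sup>2" for z
    proof -
      have "(norm (f z + g z))\<^sup>2 \<le> (norm (f z) + norm (g z))\<^sup>2"
        by (intro power_mono norm_triangle_ineq) simp
      also have "\<dots> \<le> 2 * (norm (f z))\<^sup>2 + 2 * (norm (g z))\<^sup>2"
        using sum_squares_bound[of "norm (f z)" "norm (g z)"] by (simp add: power2_sum)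
      finally show ?thesis .
    qed
    then show "AE z in disc_measure. norm ((norm (f z + g z))\<^sup>2)
        \<le> norm (2 * (norm (f z))\<^sup>2 + 2 * (norm (g z))\<^sup>2)"
      by simp
  qed
qed

lemma L2_mult_bounded:
  assumes f: "f \<in> L2_disc" and p: "p \<in> borel_measurable borel"
    and B: "\<And>z. norm z < 1 \<Longrightarrow> norm (p z) \<le> B"
  shows "(\<lambda>z. p z * f z) \<in> L2_disc"
    and "L2_disc_norm (\<lambda>z. p z * f z) \<le> B * L2_disc_norm f"
proof -
  have B0: "0 \<le> B" using B[of 0] by (auto intro: order_trans[OF norm_ge_zero])
  have m: "(\<lambda>z. p z * f z) \<in> borel_measurable borel"
    using L2_discD[OF f] p by (intro borel_measurable_times)
  have AE: "AE z in disc_measure. (norm (p z * f z))\<^sup>2 \<le> B\<^sup>2 * (norm (f z))\<^sup>2"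
    using AE_disc
  proof eventually_elim
    case (elim z)
    then have "norm (p z) \<le> B" using B by simp
    then show ?case
      using B0 unfolding norm_mult power_mult_distrib by (intro mult_right_mono power_mono) auto
  qed
  have i: "integrable disc_measure (\<lambda>z. B\<^sup>2 * (norm (f z))\<^sup>2)"
    using L2_discD[OF f] by auto
  have i2: "integrable disc_measure (\<lambda>z. (norm (p z * f z))\<^sup>2)"
    by (rule Bochner_Integration.integrable_bound[OF i]) (use AE m in auto)
  then show "(\<lambda>z. p z * f z) \<in> L2_disc" using m by (rule L2_discI[rotated])
  have "(L2_disc_norm (\<lambda>z. p z * f z))\<^sup>2 \<le> (B * L2_disc_norm f)\<^sup>2"
    unfolding L2_norm_square power_mult_distrib
    using integral_mono_AE[OF i2 i AE] by simp
  then show "L2_disc_norm (\<lambda>z. p z * f z) \<le> B * L2_disc_norm f"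
    by (rule power2_le_imp_le) (simp add: B0)
qed

lemma L2_cmult:
  assumes "f \<in> L2_disc"
  shows "(\<lambda>z. c * f z) \<in> L2_disc"
  using L2_mult_bounded(1)[OF assms, of "\<lambda>_. c" "norm c"] by simp

lemma L2_norm_cmult: "L2_disc_norm (\<lambda>z. c * f z) = norm c * L2_disc_norm f"
  by (simp add: L2_disc_norm_def norm_mult power_mult_distrib real_sqrt_mult)

lemma L2_diff:
  assumes "f \<in> L2_disc" "g \<in> L2_disc"
  shows "(\<lambda>z. f z - g z) \<in> L2_disc"
  using L2_add[OF assms(1) L2_cmult[OF assms(2), of "-1"]] by simp

lemma L2_zero: "(\<lambda>z. 0) \<in> L2_disc"
  by (rule L2_discI) auto

lemma L2_sum:
  assumes "\<And>i. i \<in> I \<Longrightarrow> f i \<in> L2_disc"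
  shows "(\<lambda>z. \<Sum>i\<in>I. f i z) \<in> L2_disc"
  using assms by (induction I rule: infinite_finite_induct) (auto simp: L2_zero intro: L2_add)

text \<open>
  The pointwise inequality \<open>2 |f| |g| \<le> s |f|\<^sup>2 + |g|\<^sup>2 / s\<close>, for every weight \<open>s\<close>: optimizing \<open>s\<close>
  yields the Cauchy-Schwarz inequality.
\<close>

lemma L2_inner_amgm:
  assumes f: "f \<in> L2_disc" and g: "g \<in> L2_disc" and s: "s > 0"
  shows "integrable disc_measure (\<lambda>z. f z * cnj (g z))"
    and "2 * norm (L2_inner f g) \<le> s * (L2_disc_norm f)\<^sup>2 + (L2_disc_norm g)\<^sup>2 / s"
proof -
  let ?b = "\<lambda>z. s * (norm (f z))\<^sup>2 + (norm (g z))\<^sup>2 / s"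
  have i: "integrable disc_measure ?b"
    using L2_discD[OF f] L2_discD[OF g] by auto
  have b: "2 * norm (f z * cnj (g z)) \<le> ?b z" for z
  proof -
    have "0 \<le> (s * norm (f z) - norm (g z))\<^sup>2 / s" using s by simp
    also have "\<dots> = ?b z - 2 * norm (f z * cnj (g z))"
      using s by (simp add: norm_mult power2_eq_square field_simps)
    finally show ?thesis by simp
  qed
  have m: "(\<lambda>z. f z * cnj (g z)) \<in> borel_measurable borel"
  proof (rule borel_measurable_times)
    have "(cnj :: complex \<Rightarrow> complex) \<in> borel_measurable borel"
      by (intro borel_measurable_continuous_onI continuous_intros)
    from measurable_compose[OF L2_discD(1)[OF g] this]
    show "(\<lambda>z. cnj (g z)) \<in> borel_measurable borel" .
  qed (rule L2_discD(1)[OF f])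
  show i2: "integrable disc_measure (\<lambda>z. f z * cnj (g z))"
  proof (rule Bochner_Integration.integrable_bound[OF i])
    have "norm (f z * cnj (g z)) \<le> norm (?b z)" for z
      using b[of z] norm_ge_zero[of "f z * cnj (g z)"] unfolding real_norm_def by linarith
    then show "AE z in disc_measure. norm (f z * cnj (g z)) \<le> norm (?b z)" by simp
  qed (use m in simp)
  have "2 * norm (L2_inner f g) \<le> 2 * (LINT z|disc_measure. norm (f z * cnj (g z)))"
    unfolding L2_inner_def by (intro mult_left_mono integral_norm_bound) simp
  also have "\<dots> = (LINT z|disc_measure. 2 * norm (f z * cnj (g z)))" by simp
  also have "\<dots> \<le> (LINT z|disc_measure. ?b z)"
    using i i2 b by (intro integral_mono) auto
  also have "\<dots> = s * (L2_disc_norm f)\<^sup>2 + (L2_disc_norm g)\<^sup>2 / s"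
    unfolding L2_norm_square using L2_discD[OF f] L2_discD[OF g] by simp
  finally show "2 * norm (L2_inner f g) \<le> s * (L2_disc_norm f)\<^sup>2 + (L2_disc_norm g)\<^sup>2 / s" .
qed

lemma L2_integrable:
  "f \<in> L2_disc \<Longrightarrow> g \<in> L2_disc \<Longrightarrow> integrable disc_measure (\<lambda>z. f z * cnj (g z))"
  by (rule L2_inner_amgm(1)[where s=1]) auto

text \<open>
  The optimal weight is the quotient of the norms. Adding \<open>e\<close> to both of them keeps the weight
  positive and finite, and \<open>e\<close> then tends to 0.
\<close>

lemma L2_Cauchy_Schwarz:
  assumes f: "f \<in> L2_disc" and g: "g \<in> L2_disc"
  shows "norm (L2_inner f g) \<le> L2_disc_norm f * L2_disc_norm g"
proof -
  define F where "F = L2_disc_norm f"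
  define G where "G = L2_disc_norm g"
  have FG: "F \<ge> 0" "G \<ge> 0" by (auto simp: F_def G_def)
  have le: "norm (L2_inner f g) \<le> (F + e) * (G + e)" if e: "e > 0" for e
  proof -
    define s where "s = (G + e) / (F + e)"
    have pos: "F + e > 0" "G + e > 0" using FG e by auto
    have s: "s > 0" using pos by (simp add: s_def)
    have "2 * norm (L2_inner f g) \<le> s * F\<^sup>2 + G\<^sup>2 / s"
      unfolding F_def G_def by (rule L2_inner_amgm(2)[OF f g s])
    also have "\<dots> \<le> s * (F + e)\<^sup>2 + (G + e)\<^sup>2 / s"
      using FG e s by (intro add_mono mult_left_mono divide_right_mono power_mono) auto
    also have "\<dots> = 2 * ((F + e) * (G + e))"
    proof -
      have "s * (F + e)\<^sup>2 = (F + e) * (G + e)" "(G + e)\<^sup>2 / s = (F + e) * (G + e)"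
        using pos by (auto simp: s_def power2_eq_square)
      then show ?thesis by simp
    qed
    finally show ?thesis by simp
  qed
  have "((\<lambda>e. (F + e) * (G + e)) \<longlongrightarrow> (F + 0) * (G + 0)) (at_right 0)"
    by (intro tendsto_intros)
  moreover have "eventually (\<lambda>e. norm (L2_inner f g) \<le> (F + e) * (G + e)) (at_right 0)"
    using le by (auto simp: eventually_at_right_field intro: exI[of _ 1])
  ultimately have "norm (L2_inner f g) \<le> (F + 0) * (G + 0)"
    by (rule tendsto_lowerbound) simp
  then show ?thesis by (simp add: F_def G_def)
qed

lemma L2_inner_add_left:
  assumes "f \<in> L2_disc" "g \<in> L2_disc" "h \<in> L2_disc"
  shows "L2_inner (\<lambda>z. f z + g z) h = L2_inner f h + L2_inner g h"
  unfolding L2_inner_def distrib_right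
  by (intro Bochner_Integration.integral_add L2_integrable assms)

lemma L2_inner_diff_left:
  assumes "f \<in> L2_disc" "g \<in> L2_disc" "h \<in> L2_disc"
  shows "L2_inner (\<lambda>z. f z - g z) h = L2_inner f h - L2_inner g h"
  unfolding L2_inner_def left_diff_distrib
  by (intro Bochner_Integration.integral_diff L2_integrable assms)

lemma L2_inner_cmult_left: "L2_inner (\<lambda>z. c * f z) h = c * L2_inner f h"
  unfolding L2_inner_def mult.assoc by (rule integral_mult_right_zero)

lemma L2_inner_commute: "L2_inner g f = cnj (L2_inner f g)"
  unfolding L2_inner_def
  by (subst Bochner_Integration.integral_cnj [symmetric]) (simp add: mult.commute)

lemma L2_inner_diff_right:
  assumes "f \<in> L2_disc" "g \<in> L2_disc" "h \<in> L2_disc"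
  shows "L2_inner h (\<lambda>z. f z - g z) = L2_inner h f - L2_inner h g"
  by (subst (1 2 3) L2_inner_commute) (simp add: L2_inner_diff_left assms)

lemma L2_inner_sum_right:
  assumes "\<And>i. i \<in> I \<Longrightarrow> f i \<in> L2_disc" "h \<in> L2_disc"
  shows "L2_inner h (\<lambda>z. \<Sum>i\<in>I. c i * f i z) = (\<Sum>i\<in>I. cnj (c i) * L2_inner h (f i))"
proof -
  have "L2_inner h (\<lambda>z. \<Sum>i\<in>I. c i * f i z) = (LINT z|disc_measure. (\<Sum>i\<in>I. cnj (c i) * (h z * cnj (f i z))))"
    unfolding L2_inner_def by (intro Bochner_Integration.integral_cong) (auto simp: sum_distrib_left mult_ac)
  also have "\<dots> = (\<Sum>i\<in>I. (LINT z|disc_measure. cnj (c i) * (h z * cnj (f i z))))"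
    using assms L2_integrable by (intro Bochner_Integration.integral_sum) auto
  also have "\<dots> = (\<Sum>i\<in>I. cnj (c i) * L2_inner h (f i))"
    unfolding L2_inner_def by (intro sum.cong refl integral_mult_right_zero)
  finally show ?thesis .
qed

lemma L2_inner_self: "L2_inner f f = of_real ((L2_disc_norm f)\<^sup>2)"
  unfolding L2_norm_square L2_inner_def integral_complex_of_real[symmetric]
  by (simp only: complex_norm_square)

lemma L2_norm_diff_square:
  assumes "f \<in> L2_disc" "g \<in> L2_disc"
  shows "(L2_disc_norm (\<lambda>z. f z - g z))\<^sup>2 = (L2_disc_norm f)\<^sup>2 - 2 * Re (L2_inner f g) + (L2_disc_norm g)\<^sup>2"
proof -
  have "complex_of_real ((L2_disc_norm (\<lambda>z. f z - g z))\<^sup>2) =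
      of_real ((L2_disc_norm f)\<^sup>2) - (L2_inner f g + cnj (L2_inner f g)) + of_real ((L2_disc_norm g)\<^sup>2)"
    unfolding L2_inner_self[symmetric]
    using assms by (simp add: L2_inner_diff_left L2_inner_diff_right L2_diff L2_inner_commute[of g f])
  also have "\<dots> = of_real ((L2_disc_norm f)\<^sup>2 - 2 * Re (L2_inner f g) + (L2_disc_norm g)\<^sup>2)"
    by (simp add: complex_add_cnj)
  finally show ?thesis by (simp only: of_real_eq_iff)
qed

lemma L2_norm_triangle:
  assumes f: "f \<in> L2_disc" and g: "g \<in> L2_disc"
  shows "L2_disc_norm (\<lambda>z. f z + g z) \<le> L2_disc_norm f + L2_disc_norm g"
proof (rule power2_le_imp_le)
  have m: "(\<lambda>z. (- 1) * g z) \<in> L2_disc" by (rule L2_cmult[OF g])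
  have "L2_disc_norm (\<lambda>z. (-1) * g z) = L2_disc_norm g"
    by (subst L2_norm_cmult) simp
  moreover have "- Re (L2_inner f (\<lambda>z. (-1) * g z)) \<le> L2_disc_norm f * L2_disc_norm g"
    using L2_Cauchy_Schwarz[OF f m] abs_Re_le_cmod[of "L2_inner f (\<lambda>z. (-1) * g z)"] calculation by simp
  ultimately show "(L2_disc_norm (\<lambda>z. f z + g z))\<^sup>2 \<le> (L2_disc_norm f + L2_disc_norm g)\<^sup>2"
    using L2_norm_diff_square[OF f m] by (simp add: power2_sum)
qed simp

lemma L2_norm_triangle_diff:
  assumes f: "f \<in> L2_disc" and g: "g \<in> L2_disc"
  shows "L2_disc_norm (\<lambda>z. f z - g z) \<le> L2_disc_norm f + L2_disc_norm g"
  using L2_norm_triangle[OF f L2_cmult[OF g, of "-1"]] L2_norm_cmult[of "-1" g] by simp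

lemma L2_norm_minus_commute: "L2_disc_norm (\<lambda>z. f z - g z) = L2_disc_norm (\<lambda>z. g z - f z)"
  by (simp add: L2_disc_norm_def norm_minus_commute)

text \<open>
  Fatou's lemma keeps pointwise limits of norm-bounded sequences in the space, with the same bound.
  It is applied to the partial sums of power series.
\<close>

lemma L2_fatou:
  assumes u: "\<And>k. u k \<in> L2_disc" and lim: "\<And>z. (\<lambda>k. u k z) \<longlonglongrightarrow> f z"
    and le: "eventually (\<lambda>k. (L2_disc_norm (u k))\<^sup>2 \<le> K) sequentially"
  shows "f \<in> L2_disc" "(L2_disc_norm f)\<^sup>2 \<le> K"
proof -
  have K: "K \<ge> 0"
    using eventually_happens[OF le] by (auto intro: order_trans[OF zero_le_power2])
  have m: "f \<in> borel_measurable borel"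
    by (rule borel_measurable_LIMSEQ_metric[OF L2_discD(1)[OF u] lim])
  have nn: "(\<integral>\<^sup>+z. ennreal ((norm (u k z))\<^sup>2) \<partial>disc_measure) = ennreal ((L2_disc_norm (u k))\<^sup>2)" for k
    unfolding L2_norm_square by (rule nn_integral_eq_integral[OF L2_discD(2)[OF u]]) auto
  have "(\<integral>\<^sup>+z. ennreal ((norm (f z))\<^sup>2) \<partial>disc_measure)
      = (\<integral>\<^sup>+z. liminf (\<lambda>k. ennreal ((norm (u k z))\<^sup>2)) \<partial>disc_measure)"
  proof (rule nn_integral_cong)
    fix z
    have "(\<lambda>k. ennreal ((norm (u k z))\<^sup>2)) \<longlonglongrightarrow> ennreal ((norm (f z))\<^sup>2)"
      by (intro tendsto_intros lim)
    then show "ennreal ((norm (f z))\<^sup>2) = liminf (\<lambda>k. ennreal ((norm (u k z))\<^sup>2))"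
      by (metis lim_imp_Liminf sequentially_bot)
  qed
  also have "\<dots> \<le> liminf (\<lambda>k. \<integral>\<^sup>+z. ennreal ((norm (u k z))\<^sup>2) \<partial>disc_measure)"
    using L2_discD(1)[OF u] by (intro nn_integral_liminf) simp
  also have "\<dots> \<le> liminf (\<lambda>k. ennreal K)"
    unfolding nn by (intro Liminf_mono eventually_mono[OF le] ennreal_leI)
  also have "\<dots> = ennreal K" by (simp add: Liminf_const)
  finally have le: "(\<integral>\<^sup>+z. ennreal ((norm (f z))\<^sup>2) \<partial>disc_measure) \<le> ennreal K" .
  have i: "integrable disc_measure (\<lambda>z. (norm (f z))\<^sup>2)"
  proof (rule integrableI_bounded)
    show "(\<lambda>z. (norm (f z))\<^sup>2) \<in> borel_measurable disc_measure" using m by simp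
    show "(\<integral>\<^sup>+z. ennreal (norm ((norm (f z))\<^sup>2)) \<partial>disc_measure) < \<infinity>"
      using le by (simp add: le_less_trans)
  qed
  with m show "f \<in> L2_disc" by (rule L2_discI)
  have "ennreal ((L2_disc_norm f)\<^sup>2) \<le> ennreal K"
    using le unfolding L2_norm_square by (subst (asm) nn_integral_eq_integral[OF i]) auto
  then show "(L2_disc_norm f)\<^sup>2 \<le> K" using K by (simp add: ennreal_le_iff)
qed

section \<open>Taylor coefficients in the Bergman space\<close>

text \<open>
  The monomials, cut off outside the disc so that they are the representatives that
  \<open>bergman_space\<close> asks for.
\<close>

definition disc_power :: "nat \<Rightarrow> complex \<Rightarrow> complex" where
  "disc_power n z = (if norm z < 1 then z ^ n else 0)"

text \<open>
  For \<open>f\<close> in the Bergman space this is the \<open>n\<close>-th Taylor coefficient; \<open>1 / (n + 1)\<close> is the squared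
  norm of the \<open>n\<close>-th monomial. The integral form extends the coefficients to all square integrable
  functions, where they are those of the Bergman projection.
\<close>

definition bcoeff :: "(complex \<Rightarrow> complex) \<Rightarrow> nat \<Rightarrow> complex" where
  "bcoeff f n = of_nat (n + 1) * L2_inner f (disc_power n)"

definition disc_series :: "(nat \<Rightarrow> complex) \<Rightarrow> complex \<Rightarrow> complex" where
  "disc_series b z = (if norm z < 1 then \<Sum>n. b n * z ^ n else 0)"

definition disc_poly :: "(nat \<Rightarrow> complex) \<Rightarrow> nat \<Rightarrow> complex \<Rightarrow> complex" where
  "disc_poly b M z = (\<Sum>n<M. b n * disc_power n z)"

lemma bergmanD:
  assumes "f \<in> bergman_space"
  shows "f \<in> L2_disc" "f holomorphic_on ball 0 1" "norm z \<ge> 1 \<Longrightarrow> f z = 0"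
  using assms by (auto simp: bergman_space_def)

lemma bergmanI:
  assumes "f \<in> L2_disc" "f holomorphic_on ball 0 1" "\<And>z. norm z \<ge> 1 \<Longrightarrow> f z = 0"
  shows "f \<in> bergman_space"
  using assms by (auto simp: bergman_space_def)

lemma bergman_add: "f \<in> bergman_space \<Longrightarrow> g \<in> bergman_space \<Longrightarrow> (\<lambda>z. f z + g z) \<in> bergman_space"
  by (rule bergmanI) (auto intro!: L2_add holomorphic_intros dest: bergmanD(1,2) simp: bergmanD(3))

lemma bergman_diff: "f \<in> bergman_space \<Longrightarrow> g \<in> bergman_space \<Longrightarrow> (\<lambda>z. f z - g z) \<in> bergman_space"
  by (rule bergmanI) (auto intro!: L2_diff holomorphic_intros dest: bergmanD(1,2) simp: bergmanD(3))

lemma bergman_cmult: "f \<in> bergman_space \<Longrightarrow> (\<lambda>z. c * f z) \<in> bergman_space"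
  by (rule bergmanI) (auto intro!: L2_cmult holomorphic_intros dest: bergmanD(1,2) simp: bergmanD(3))

lemma bergman_zero: "(\<lambda>z. 0) \<in> bergman_space"
  by (rule bergmanI) (auto intro!: L2_zero)

lemma bergman_sum:
  assumes "\<And>i. i \<in> I \<Longrightarrow> f i \<in> bergman_space"
  shows "(\<lambda>z. \<Sum>i\<in>I. f i z) \<in> bergman_space"
  using assms by (induction I rule: infinite_finite_induct) (auto simp: bergman_zero intro: bergman_add)

lemma borel_measurable_disc_ext:
  fixes h :: "complex \<Rightarrow> complex"
  assumes "continuous_on (ball 0 1) h"
  shows "(\<lambda>z. if norm z < 1 then h z else 0) \<in> borel_measurable borel"
proof -
  have "(\<lambda>z. indicator (ball 0 1) z *\<^sub>R h z) \<in> borel_measurable borel"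
    by (rule borel_measurable_continuous_on_indicator[OF _ assms]) simp
  also have "(\<lambda>z. indicator (ball 0 1) z *\<^sub>R h z) = (\<lambda>z. if norm z < 1 then h z else 0)"
    by (auto simp: indicator_def)
  finally show ?thesis .
qed

lemma bergman_mult:
  assumes f: "f \<in> bergman_space" and h: "h holomorphic_on ball 0 1"
    and B: "\<And>z. norm z < 1 \<Longrightarrow> norm (h z) \<le> B"
  shows "(\<lambda>z. h z * f z) \<in> bergman_space"
proof (rule bergmanI)
  have "(\<lambda>z. (if norm z < 1 then h z else 0) * f z) \<in> L2_disc"
    by (rule L2_mult_bounded(1)[where B=B])
      (use B bergmanD(1)[OF f] in \<open>auto intro!: borel_measurable_disc_ext holomorphic_on_imp_continuous_on h\<close>)
  also have "(\<lambda>z. (if norm z < 1 then h z else 0) * f z) = (\<lambda>z. h z * f z)"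
    using bergmanD(3)[OF f] by auto
  finally show "(\<lambda>z. h z * f z) \<in> L2_disc" .
qed (use bergmanD[OF f] h in \<open>auto intro!: holomorphic_intros\<close>)

lemma disc_power_bergman [simp]: "disc_power n \<in> bergman_space"
proof (rule bergmanI)
  have m: "disc_power n \<in> borel_measurable borel"
    unfolding disc_power_def [abs_def]
    by (rule borel_measurable_disc_ext) (intro continuous_intros)
  show "disc_power n \<in> L2_disc"
  proof (rule L2_discI[OF m], rule integrable_disc_bounded[where B=1])
    show "(\<lambda>z. (norm (disc_power n z))\<^sup>2) \<in> borel_measurable borel"
      using m by simp
    show "norm ((norm (disc_power n z))\<^sup>2) \<le> 1" if "norm z < 1" for z
      using that by (simp add: disc_power_def norm_power power_le_one)
  qed
  have "(\<lambda>z. z^n) holomorphic_on ball (0::complex) 1" by (intro holomorphic_intros)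
  then show "disc_power n holomorphic_on ball 0 1"
    by (rule holomorphic_transform) (simp add: disc_power_def)
qed (simp add: disc_power_def)

lemma disc_power_L2 [simp]: "disc_power n \<in> L2_disc"
  by (rule bergmanD(1)) simp

lemma inner_disc_power:
  "L2_inner (disc_power n) (disc_power m) = (if n = m then 1 / of_nat (n + 1) else 0)"
proof -
  have "L2_inner (disc_power n) (disc_power m) = (LINT z|disc_measure. z^n * cnj (z^m))"
    unfolding L2_inner_def
  proof (rule integral_cong_AE)
    show "AE z in disc_measure. disc_power n z * cnj (disc_power m z) = z ^ n * cnj (z ^ m)"
      using AE_disc by eventually_elim (simp add: disc_power_def)
    show "(\<lambda>z. disc_power n z * cnj (disc_power m z)) \<in> borel_measurable disc_measure"
      by (rule borel_measurable_integrable[OF L2_integrable]) simp_all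
    show "(\<lambda>z. z ^ n * cnj (z ^ m)) \<in> borel_measurable disc_measure"
      unfolding borel_measurable_disc by (intro borel_measurable_continuous_onI continuous_intros)
  qed
  also have "\<dots> = (if n = m then 1 / of_nat (n + 1) else 0)"
    unfolding disc_monomials_orthogonal by simp
  finally show ?thesis .
qed

lemma disc_poly_bergman: "disc_poly b M \<in> bergman_space"
  unfolding disc_poly_def [abs_def] by (intro bergman_sum bergman_cmult disc_power_bergman)

lemma inner_disc_power_sum:
  assumes "h \<in> L2_disc"
  shows "L2_inner h (\<lambda>z. \<Sum>n\<in>I. b n * disc_power n z) = (\<Sum>n\<in>I. cnj (b n) * bcoeff h n / of_nat (n + 1))"
  using assms by (subst L2_inner_sum_right) (auto simp: bcoeff_def intro!: sum.cong simp del: of_nat_Suc)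

lemma bcoeff_disc_power_sum:
  assumes "finite I"
  shows "bcoeff (\<lambda>z. \<Sum>i\<in>I. b i * disc_power i z) n = (if n \<in> I then b n else 0)"
proof -
  have "L2_inner (\<lambda>z. \<Sum>i\<in>I. b i * disc_power i z) (disc_power n)
      = cnj (\<Sum>i\<in>I. cnj (b i) * L2_inner (disc_power n) (disc_power i))"
    by (subst L2_inner_commute, subst L2_inner_sum_right) auto
  also have "\<dots> = (\<Sum>i\<in>I. if n = i then b i / of_nat (n + 1) else 0)"
    by (auto simp: inner_disc_power cnj_sum intro!: sum.cong)
  also have "\<dots> = (if n \<in> I then b n / of_nat (n + 1) else 0)"
    using assms by simp
  finally show ?thesis by (simp add: bcoeff_def del: of_nat_Suc)
qed

lemma norm_disc_power_sum:
  assumes "finite I"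
  shows "(L2_disc_norm (\<lambda>z. \<Sum>n\<in>I. b n * disc_power n z))\<^sup>2 = (\<Sum>n\<in>I. (norm (b n))\<^sup>2 / real (n + 1))"
proof -
  let ?s = "\<lambda>z. \<Sum>n\<in>I. b n * disc_power n z"
  have s: "?s \<in> L2_disc" by (intro L2_sum L2_cmult disc_power_L2)
  have "complex_of_real ((L2_disc_norm ?s)\<^sup>2) = (\<Sum>n\<in>I. cnj (b n) * bcoeff ?s n / of_nat (n + 1))"
    unfolding L2_inner_self[symmetric] by (rule inner_disc_power_sum[OF s])
  also have "\<dots> = (\<Sum>n\<in>I. complex_of_real ((norm (b n))\<^sup>2 / real (n + 1)))"
    using assms by (intro sum.cong refl)
      (simp add: bcoeff_disc_power_sum complex_norm_square[unfolded of_real_power, symmetric] mult.commute[of "cnj _"] del: of_nat_Suc)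
  also have "\<dots> = complex_of_real (\<Sum>n\<in>I. (norm (b n))\<^sup>2 / real (n + 1))" by simp
  finally show ?thesis by (simp only: of_real_eq_iff)
qed

text \<open>
  Pythagoras: the polynomial is the orthogonal projection of \<open>g\<close> onto the span of the first
  \<open>M\<close> monomials.
\<close>

lemma L2_best_approximation:
  assumes g: "g \<in> L2_disc"
  shows "(L2_disc_norm (\<lambda>z. g z - disc_poly (bcoeff g) M z))\<^sup>2 =
    (L2_disc_norm g)\<^sup>2 - (\<Sum>n<M. (norm (bcoeff g n))\<^sup>2 / real (n + 1))"
proof -
  have "L2_inner g (disc_poly (bcoeff g) M) = (\<Sum>n<M. cnj (bcoeff g n) * bcoeff g n / of_nat (n + 1))"
    unfolding disc_poly_def [abs_def] by (rule inner_disc_power_sum[OF g])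
  also have "\<dots> = complex_of_real (\<Sum>n<M. (norm (bcoeff g n))\<^sup>2 / real (n + 1))"
    by (simp add: complex_norm_square[unfolded of_real_power, symmetric] mult.commute[of "cnj _"] del: of_nat_Suc)
  finally show ?thesis
    using L2_norm_diff_square[OF g bergmanD(1)[OF disc_poly_bergman]]
      norm_disc_power_sum[of "{..<M}" "bcoeff g"]
    by (simp add: disc_poly_def [abs_def])
qed

lemma L2_Bessel:
  assumes "g \<in> L2_disc"
  shows "(\<Sum>n<M. (norm (bcoeff g n))\<^sup>2 / real (n + 1)) \<le> (L2_disc_norm g)\<^sup>2"
  using L2_best_approximation[OF assms, of M] zero_le_power2 by (metis diff_ge_0_iff_ge)

text \<open>
  Sequences with a bounded weighted sum of squares are exactly the coefficient sequences of the
  elements of the Bergman space: this is proved here in one direction, and in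
  \<open>bergman_coefficients\<close> in the other.
\<close>

context
  fixes b :: "nat \<Rightarrow> complex" and K :: real
  assumes bd: "\<And>M. (\<Sum>n<M. (norm (b n))\<^sup>2 / real (n + 1)) \<le> K"
begin

lemma weighted_summable: "summable (\<lambda>n. (norm (b n))\<^sup>2 / real (n + 1))"
  by (rule summableI_nonneg_bounded[OF _ bd]) simp

lemma disc_series_sums:
  assumes z: "norm z < 1"
  shows "(\<lambda>n. b n * z ^ n) sums disc_series b z"
proof -
  have K: "K \<ge> 0" using bd[of 0] by simp
  have "norm (b n) \<le> sqrt K * real (n + 1)" for n
  proof -
    have "(norm (b n))\<^sup>2 / real (n + 1) \<le> (\<Sum>n<Suc n. (norm (b n))\<^sup>2 / real (n + 1))"
      by (rule member_le_sum) auto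
    also have "\<dots> \<le> K" by (rule bd)
    finally have "(norm (b n))\<^sup>2 \<le> K * real (n + 1)" by (simp add: field_simps)
    also have "\<dots> \<le> K * (real (n + 1))\<^sup>2"
      using K by (intro mult_left_mono) (auto simp: power2_eq_square)
    also have "\<dots> = (sqrt K * real (n + 1))\<^sup>2" using K by (simp add: power_mult_distrib)
    finally show ?thesis by (rule power2_le_imp_le) (simp add: K)
  qed
  then have le: "norm (b n * z ^ n) \<le> sqrt K * (real (n + 1) * norm z ^ n)" for n
    unfolding norm_mult norm_power mult.assoc[symmetric] by (rule mult_right_mono) simp
  have "summable (\<lambda>n. real (n + 1) * norm z ^ n)"
  proof -
    have "summable (\<lambda>n. diffs (\<lambda>_. 1) n * norm z ^ n)"
      by (rule termdiff_converges[where K=1]) (use z in \<open>auto intro: summable_geometric\<close>)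
    then show ?thesis by (simp add: diffs_def)
  qed
  then have "summable (\<lambda>n. sqrt K * (real (n + 1) * norm z ^ n))" by (rule summable_mult)
  then have "summable (\<lambda>n. b n * z ^ n)"
    by (rule summable_comparison_test') (use le in auto)
  then show ?thesis using z by (simp add: disc_series_def summable_sums)
qed

text \<open>
  Fatou's lemma for the differences of the partial sums, whose norms are known exactly by
  orthogonality.
\<close>

lemma disc_series_tail:
  shows "(\<lambda>z. disc_series b z - disc_poly b M z) \<in> L2_disc"
    and "(L2_disc_norm (\<lambda>z. disc_series b z - disc_poly b M z))\<^sup>2
      \<le> K - (\<Sum>n<M. (norm (b n))\<^sup>2 / real (n + 1))"
proof -
  have lim: "(\<lambda>k. disc_poly b k z - disc_poly b M z) \<longlonglongrightarrow> disc_series b z - disc_poly b M z" for z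
  proof (cases "norm z < 1")
    case True
    then have "(\<lambda>k. disc_poly b k z) \<longlonglongrightarrow> disc_series b z"
      using disc_series_sums[OF True] by (simp add: sums_def disc_poly_def disc_power_def)
    then show ?thesis by (intro tendsto_intros)
  qed (simp add: disc_poly_def disc_power_def disc_series_def)
  have ev: "eventually (\<lambda>k. (L2_disc_norm (\<lambda>z. disc_poly b k z - disc_poly b M z))\<^sup>2
      \<le> K - (\<Sum>n<M. (norm (b n))\<^sup>2 / real (n + 1))) sequentially"
  proof (rule eventually_sequentiallyI)
    fix k assume "k \<ge> M"
    then have eq: "{..<k} = {..<M} \<union> {M..<k}" and disj: "{..<M} \<inter> {M..<k} = {}" by auto
    have "(\<lambda>z. disc_poly b k z - disc_poly b M z) = (\<lambda>z. \<Sum>n\<in>{M..<k}. b n * disc_power n z)"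
      unfolding disc_poly_def eq by (subst sum.union_disjoint) (use disj in auto)
    then have "(L2_disc_norm (\<lambda>z. disc_poly b k z - disc_poly b M z))\<^sup>2
        = (\<Sum>n\<in>{M..<k}. (norm (b n))\<^sup>2 / real (n + 1))"
      by (simp only: norm_disc_power_sum finite_atLeastLessThan)
    also have "\<dots> = (\<Sum>n<k. (norm (b n))\<^sup>2 / real (n + 1)) - (\<Sum>n<M. (norm (b n))\<^sup>2 / real (n + 1))"
      unfolding eq by (subst sum.union_disjoint) (use disj in auto)
    also have "\<dots> \<le> K - (\<Sum>n<M. (norm (b n))\<^sup>2 / real (n + 1))" using bd[of k] by simp
    finally show "(L2_disc_norm (\<lambda>z. disc_poly b k z - disc_poly b M z))\<^sup>2
      \<le> K - (\<Sum>n<M. (norm (b n))\<^sup>2 / real (n + 1))" .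
  qed
  have u: "(\<lambda>z. disc_poly b k z - disc_poly b M z) \<in> L2_disc" for k
    by (intro L2_diff bergmanD(1) disc_poly_bergman)
  show "(\<lambda>z. disc_series b z - disc_poly b M z) \<in> L2_disc"
    and "(L2_disc_norm (\<lambda>z. disc_series b z - disc_poly b M z))\<^sup>2
      \<le> K - (\<Sum>n<M. (norm (b n))\<^sup>2 / real (n + 1))"
    by (rule L2_fatou[OF u lim ev])+
qed

lemma disc_series_bergman: "disc_series b \<in> bergman_space"
proof (rule bergmanI)
  show "disc_series b \<in> L2_disc" using disc_series_tail(1)[of 0] by (simp add: disc_poly_def)
  show "disc_series b holomorphic_on ball 0 1"
    by (rule power_series_holomorphic[where a = b]) (use disc_series_sums in auto)
qed (simp add: disc_series_def)

lemma disc_series_norm_le: "(L2_disc_norm (disc_series b))\<^sup>2 \<le> K"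
  using disc_series_tail(2)[of 0] by (simp add: disc_poly_def)

end

text \<open>
  Taken with the full sum as the bound, the tail estimate tends to 0, and the inner products
  with a monomial converge by the Cauchy-Schwarz inequality.
\<close>

lemma bcoeff_disc_series:
  assumes bd: "\<And>M. (\<Sum>n<M. (norm (b n))\<^sup>2 / real (n + 1)) \<le> K"
  shows "bcoeff (disc_series b) n = b n"
proof -
  define S where "S = (\<Sum>n. (norm (b n))\<^sup>2 / real (n + 1))"
  have sm: "summable (\<lambda>n. (norm (b n))\<^sup>2 / real (n + 1))" by (rule weighted_summable[OF bd])
  have bS: "(\<Sum>n<M. (norm (b n))\<^sup>2 / real (n + 1)) \<le> S" for M
    unfolding S_def by (rule sum_le_suminf[OF sm]) auto
  define r where "r M = (\<lambda>z. disc_series b z - disc_poly b M z)" for M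
  have rL: "r M \<in> L2_disc" for M unfolding r_def by (rule disc_series_tail(1)[OF bS])
  have "(\<lambda>M. (\<Sum>n<M. (norm (b n))\<^sup>2 / real (n + 1))) \<longlonglongrightarrow> S"
    using summable_LIMSEQ[OF sm] by (simp add: S_def)
  then have l0: "(\<lambda>M. S - (\<Sum>n<M. (norm (b n))\<^sup>2 / real (n + 1))) \<longlonglongrightarrow> S - S"
    by (intro tendsto_intros)
  have "(\<lambda>M. (L2_disc_norm (r M))\<^sup>2) \<longlonglongrightarrow> 0"
  proof (rule tendsto_sandwich[OF _ _ tendsto_const])
    show "eventually (\<lambda>M. (L2_disc_norm (r M))\<^sup>2 \<le> S - (\<Sum>n<M. (norm (b n))\<^sup>2 / real (n + 1))) sequentially"
      unfolding r_def by (intro always_eventually allI disc_series_tail(2)[OF bS])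
  qed (use l0 in auto)
  then have "(\<lambda>M. sqrt ((L2_disc_norm (r M))\<^sup>2)) \<longlonglongrightarrow> sqrt 0" by (intro tendsto_intros)
  then have N0: "(\<lambda>M. L2_disc_norm (r M) * L2_disc_norm (disc_power n)) \<longlonglongrightarrow> 0"
    by (auto intro!: tendsto_eq_intros)
  have "(\<lambda>M. L2_inner (r M) (disc_power n)) \<longlonglongrightarrow> 0"
    by (rule Lim_null_comparison[OF _ N0]) (intro always_eventually allI L2_Cauchy_Schwarz rL disc_power_L2)
  then have z: "(\<lambda>M. of_nat (n + 1) * L2_inner (r M) (disc_power n)) \<longlonglongrightarrow> of_nat (n+1) * 0"
    by (intro tendsto_intros)
  have "of_nat (n + 1) * L2_inner (r M) (disc_power n) = bcoeff (disc_series b) n - b n" if "M > n" for M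
  proof -
    have "L2_inner (r M) (disc_power n) =
      L2_inner (disc_series b) (disc_power n) - L2_inner (disc_poly b M) (disc_power n)"
      unfolding r_def
      by (intro L2_inner_diff_left bergmanD(1) disc_series_bergman[OF bd] disc_poly_bergman disc_power_bergman)
    then have "of_nat (n + 1) * L2_inner (r M) (disc_power n) = bcoeff (disc_series b) n - bcoeff (disc_poly b M) n"
      by (simp only: bcoeff_def right_diff_distrib)
    also have "bcoeff (disc_poly b M) n = b n"
      unfolding disc_poly_def [abs_def] using that by (simp add: bcoeff_disc_power_sum)
    finally show ?thesis .
  qed
  then have "eventually (\<lambda>M. of_nat (n + 1) * L2_inner (r M) (disc_power n) = bcoeff (disc_series b) n - b n) sequentially"
    by (intro eventually_sequentiallyI[of "Suc n"]) auto
  then have "(\<lambda>M::nat. bcoeff (disc_series b) n - b n) \<longlonglongrightarrow> of_nat (n+1) * 0"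
    using z by (rule Lim_transform_eventually[rotated])
  then show ?thesis by (simp add: LIMSEQ_const_iff)
qed

text \<open>
  The substitution \<open>z \<mapsto> r z\<close> costs the factor \<open>r\<^sup>-\<^sup>2\<close>, and the disc of radius \<open>r\<close> is part of the unit
  disc.
\<close>

lemma dilation_bergman_norm:
  assumes f: "f \<in> bergman_space" and r: "0 < r" "r < 1"
    and g: "g \<in> L2_disc" "\<And>z. norm z < 1 \<Longrightarrow> g z = f (of_real r * z)"
  shows "(L2_disc_norm g)\<^sup>2 \<le> (L2_disc_norm f)\<^sup>2 / r\<^sup>2"
proof -
  have nn: "(\<integral>\<^sup>+z. ennreal ((norm (h z))\<^sup>2) \<partial>disc_measure) = ennreal ((L2_disc_norm h)\<^sup>2)"
    if "h \<in> L2_disc" for h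
    unfolding L2_norm_square by (rule nn_integral_eq_integral[OF L2_discD(2)[OF that]]) auto
  have fm [measurable]: "f \<in> borel_measurable borel" by (rule L2_discD(1)[OF bergmanD(1)[OF f]])
  have gm [measurable]: "g \<in> borel_measurable borel" by (rule L2_discD(1)[OF g(1)])
  define F where "F = (\<lambda>z. ennreal ((norm (f z))\<^sup>2) * indicator (ball 0 1) z)"
  have Fm [measurable]: "F \<in> borel_measurable borel"
    unfolding F_def by (intro borel_measurable_times_ennreal borel_measurable_indicator) (auto intro!: borel_measurable_power)
  have "(\<integral>\<^sup>+z. F z \<partial>lborel) = (\<integral>\<^sup>+z. F z \<partial>(density (distr lborel borel (\<lambda>x. 0 + r *\<^sub>R x)) (\<lambda>_. \<bar>r\<bar>^DIM(complex))))"
    by (subst lborel_affine[of r 0]) (use r in auto)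
  also have "\<dots> = (\<integral>\<^sup>+z. ennreal (r\<^sup>2) * F (r *\<^sub>R z) \<partial>lborel)"
    using r by (subst nn_integral_density) (auto simp: nn_integral_distr)
  also have "\<dots> = ennreal (r\<^sup>2) * (\<integral>\<^sup>+z. F (r *\<^sub>R z) \<partial>lborel)"
    by (rule nn_integral_cmult) measurable
  finally have scale: "(\<integral>\<^sup>+z. F z \<partial>lborel) = ennreal (r\<^sup>2) * (\<integral>\<^sup>+z. F (r *\<^sub>R z) \<partial>lborel)" .
  have "ennreal (r\<^sup>2 * (L2_disc_norm g)\<^sup>2) = ennreal (r\<^sup>2) * (\<integral>\<^sup>+z. ennreal ((norm (g z))\<^sup>2) \<partial>disc_measure)"
    by (simp add: nn g(1) ennreal_mult)
  also have "\<dots> = ennreal (r\<^sup>2) * ((\<integral>\<^sup>+z. ennreal ((norm (g z))\<^sup>2) * indicator (ball 0 1) z \<partial>lborel) / ennreal pi)"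
    by (subst nn_integral_disc) simp_all
  also have "\<dots> \<le> ennreal (r\<^sup>2) * ((\<integral>\<^sup>+z. F (r *\<^sub>R z) \<partial>lborel) / ennreal pi)"
  proof (intro mult_left_mono divide_right_mono_ennreal nn_integral_mono)
    fix z :: complex
    have "norm (r *\<^sub>R z) < 1" if "norm z < 1"
      using r that mult_strict_mono[of r 1 "norm z" 1] by simp
    then show "ennreal ((norm (g z))\<^sup>2) * indicator (ball 0 1) z \<le> F (r *\<^sub>R z)"
      using g(2)[of z] by (auto simp: F_def indicator_def scaleR_conv_of_real)
  qed simp
  also have "\<dots> = (\<integral>\<^sup>+z. F z \<partial>lborel) / ennreal pi"
    by (simp add: scale ennreal_times_divide)
  also have "\<dots> = (\<integral>\<^sup>+z. ennreal ((norm (f z))\<^sup>2) \<partial>disc_measure)"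
    unfolding F_def by (subst nn_integral_disc) simp_all
  also have "\<dots> = ennreal ((L2_disc_norm f)\<^sup>2)"
    by (rule nn[OF bergmanD(1)[OF f]])
  finally show ?thesis using r by (simp add: field_simps)
qed

text \<open>
  The dilates \<open>f (r z)\<close> have absolutely summable coefficients, so the theory of series above
  applies to them and Bessel's inequality bounds their coefficients by the norm of \<open>f\<close>. Each partial
  sum is then continuous in \<open>r\<close> up to \<open>r = 1\<close>.
\<close>

lemma bergman_coefficients:
  assumes f: "f \<in> bergman_space"
  obtains d where "f = disc_series d"
    "\<And>M. (\<Sum>n<M. (norm (d n))\<^sup>2 / real (n + 1)) \<le> (L2_disc_norm f)\<^sup>2"
proof -
  define d where "d n = (deriv ^^ n) f 0 / fact n" for n
  have sums: "(\<lambda>n. d n * z ^ n) sums f z" if "norm z < 1" for z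
    using holomorphic_power_series[OF bergmanD(2)[OF f], of z] that by (simp add: d_def)
  have feq: "f = disc_series d"
    using sums bergmanD(3)[OF f] by (auto simp: disc_series_def fun_eq_iff sums_iff not_less)
  have dil: "(\<Sum>n<M. (norm (d n * of_real r ^ n))\<^sup>2 / real (n + 1)) \<le> (L2_disc_norm f)\<^sup>2 / r\<^sup>2"
    if r: "0 < r" "r < 1" for r M
  proof -
    define b where "b n = d n * of_real r ^ n" for n
    \<comment> \<open>convergence at a point beyond \<open>r\<close> makes the series at \<open>r\<close> absolutely convergent\<close>
    have "summable (\<lambda>n. d n * of_real ((1 + r) / 2) ^ n)"
      using sums[of "of_real ((1 + r) / 2)"] r by (auto simp: sums_iff simp del: of_real_divide of_real_add)
    then have sb: "summable (\<lambda>n. norm (b n))"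
      unfolding b_def by (rule powser_insidea) (use r in \<open>simp del: of_real_divide of_real_add\<close>)
    define S where "S = (\<Sum>n. norm (b n))"
    have S: "(\<Sum>n<M. norm (b n)) \<le> S" for M
      unfolding S_def by (rule sum_le_suminf[OF sb]) auto
    have bS: "norm (b n) \<le> S" for n
      using S[of "Suc n"] sum_nonneg[of "{..<n}" "\<lambda>n. norm (b n)"] by simp
    have bd: "(\<Sum>n<M. (norm (b n))\<^sup>2 / real (n + 1)) \<le> S * S" for M
    proof -
      have "(\<Sum>n<M. (norm (b n))\<^sup>2 / real (n + 1)) \<le> (\<Sum>n<M. S * norm (b n))"
      proof (rule sum_mono)
        fix n
        have "(norm (b n))\<^sup>2 / real (n + 1) \<le> (norm (b n))\<^sup>2 / 1"
          by (intro divide_left_mono) auto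
        also have "\<dots> \<le> S * norm (b n)" unfolding power2_eq_square using bS by (simp add: mult_right_mono)
        finally show "(norm (b n))\<^sup>2 / real (n + 1) \<le> S * norm (b n)" .
      qed
      also have "\<dots> \<le> S * S"
        unfolding sum_distrib_left[symmetric]
        using S bS[of 0] by (intro mult_left_mono) (auto intro: order_trans[OF norm_ge_zero])
      finally show ?thesis .
    qed
    have gA: "disc_series b \<in> bergman_space" by (rule disc_series_bergman[OF bd])
    have geq: "disc_series b z = f (of_real r * z)" if z: "norm z < 1" for z
    proof -
      have "norm (of_real r * z) < 1"
        using r z mult_strict_mono[of r 1 "norm z" 1] by (simp add: norm_mult)
      from sums[OF this] have "(\<lambda>n. b n * z ^ n) sums f (of_real r * z)"
        by (simp add: b_def power_mult_distrib mult_ac)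
      with disc_series_sums[OF bd z] show ?thesis by (rule sums_unique2)
    qed
    have "(\<Sum>n<M. (norm (b n))\<^sup>2 / real (n + 1)) \<le> (L2_disc_norm (disc_series b))\<^sup>2"
      using L2_Bessel[OF bergmanD(1)[OF gA], of M] by (simp add: bcoeff_disc_series[OF bd])
    also have "\<dots> \<le> (L2_disc_norm f)\<^sup>2 / r\<^sup>2"
      by (rule dilation_bergman_norm[OF f r bergmanD(1)[OF gA] geq])
    finally show ?thesis by (simp add: b_def)
  qed
  have "(\<Sum>n<M. (norm (d n))\<^sup>2 / real (n + 1)) \<le> (L2_disc_norm f)\<^sup>2" for M
  proof (rule tendsto_le)
    show "((\<lambda>r. (L2_disc_norm f)\<^sup>2 / r\<^sup>2) \<longlongrightarrow> (L2_disc_norm f)\<^sup>2) (at_left 1)"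
      by (auto intro!: tendsto_eq_intros)
    show "((\<lambda>r. \<Sum>n<M. (norm (d n * of_real r ^ n))\<^sup>2 / real (n + 1)) \<longlongrightarrow>
        (\<Sum>n<M. (norm (d n))\<^sup>2 / real (n + 1))) (at_left 1)"
      by (rule tendsto_eq_rhs, (rule tendsto_intros | simp)+)
    have "eventually (\<lambda>r::real. r \<in> {0<..<1}) (at_left 1)"
      by (rule eventually_at_leftI[of 0]) auto
    then show "\<forall>\<^sub>F r in at_left 1. (\<Sum>n<M. (norm (d n * of_real r ^ n))\<^sup>2 / real (n + 1)) \<le> (L2_disc_norm f)\<^sup>2 / r\<^sup>2"
      by eventually_elim (use dil in auto)
  qed simp
  with feq show ?thesis by (rule that)
qed

lemma bergman_disc_series:
  assumes "f \<in> bergman_space"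
  shows "f = disc_series (bcoeff f)"
proof -
  obtain d where d: "f = disc_series d"
    "\<And>M. (\<Sum>n<M. (norm (d n))\<^sup>2 / real (n + 1)) \<le> (L2_disc_norm f)\<^sup>2"
    using bergman_coefficients[OF assms] by blast
  then have "bcoeff f = d" using bcoeff_disc_series[OF d(2)] by auto
  then show ?thesis using d(1) by simp
qed

lemma bergman_eqI:
  assumes "f \<in> bergman_space" "g \<in> bergman_space" "\<And>n. bcoeff f n = bcoeff g n"
  shows "f = g"
  using bergman_disc_series[OF assms(1)] bergman_disc_series[OF assms(2)] assms(3)
  by (metis ext)

lemma bergman_sums:
  assumes "f \<in> bergman_space" "norm z < 1"
  shows "(\<lambda>n. bcoeff f n * z ^ n) sums f z"
  using disc_series_sums[OF L2_Bessel[OF bergmanD(1)[OF assms(1)]] assms(2)]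
  by (simp flip: bergman_disc_series[OF assms(1)])

lemma bergman_parseval:
  assumes f: "f \<in> bergman_space"
  shows "(\<lambda>n. (norm (bcoeff f n))\<^sup>2 / real (n + 1)) sums (L2_disc_norm f)\<^sup>2"
proof -
  have B: "(\<Sum>n<M. (norm (bcoeff f n))\<^sup>2 / real (n + 1)) \<le> (L2_disc_norm f)\<^sup>2" for M
    by (rule L2_Bessel[OF bergmanD(1)[OF f]])
  have sm: "summable (\<lambda>n. (norm (bcoeff f n))\<^sup>2 / real (n + 1))"
    by (rule weighted_summable[OF B])
  have le: "(\<Sum>n<M. (norm (bcoeff f n))\<^sup>2 / real (n + 1)) \<le> (\<Sum>n. (norm (bcoeff f n))\<^sup>2 / real (n + 1))" for M
    by (rule sum_le_suminf[OF sm]) auto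
  have "(L2_disc_norm f)\<^sup>2 \<le> (\<Sum>n. (norm (bcoeff f n))\<^sup>2 / real (n + 1))"
    using disc_series_norm_le[OF le] by (simp flip: bergman_disc_series[OF f])
  moreover have "(\<Sum>n. (norm (bcoeff f n))\<^sup>2 / real (n + 1)) \<le> (L2_disc_norm f)\<^sup>2"
    by (rule suminf_le_const[OF sm B])
  ultimately show ?thesis using sm by (simp add: sums_iff)
qed

lemma bergman_poly_approx:
  assumes f: "f \<in> bergman_space"
  shows "(\<lambda>M. L2_disc_norm (\<lambda>z. f z - disc_poly (bcoeff f) M z)) \<longlonglongrightarrow> 0"
proof -
  have "(\<lambda>M. (L2_disc_norm f)\<^sup>2 - (\<Sum>n<M. (norm (bcoeff f n))\<^sup>2 / real (n + 1))) \<longlonglongrightarrow>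
      (L2_disc_norm f)\<^sup>2 - (L2_disc_norm f)\<^sup>2"
    using bergman_parseval[OF f] unfolding sums_def by (intro tendsto_intros)
  then have "(\<lambda>M. (L2_disc_norm (\<lambda>z. f z - disc_poly (bcoeff f) M z))\<^sup>2) \<longlonglongrightarrow> 0"
    by (simp add: L2_best_approximation[OF bergmanD(1)[OF f]])
  then have "(\<lambda>M. sqrt ((L2_disc_norm (\<lambda>z. f z - disc_poly (bcoeff f) M z))\<^sup>2)) \<longlonglongrightarrow> sqrt 0"
    by (intro tendsto_intros)
  then show ?thesis by simp
qed

section \<open>The Bergman projection\<close>

lemma L2_norm_zero [simp]: "L2_disc_norm (\<lambda>z. 0) = 0"
  by (simp add: L2_disc_norm_def)

lemma bcoeff_add:
  "f \<in> L2_disc \<Longrightarrow> g \<in> L2_disc \<Longrightarrow> bcoeff (\<lambda>z. f z + g z) n = bcoeff f n + bcoeff g n"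
  by (simp add: bcoeff_def L2_inner_add_left distrib_left del: of_nat_Suc)

lemma bcoeff_diff:
  "f \<in> L2_disc \<Longrightarrow> g \<in> L2_disc \<Longrightarrow> bcoeff (\<lambda>z. f z - g z) n = bcoeff f n - bcoeff g n"
  by (simp add: bcoeff_def L2_inner_diff_left right_diff_distrib del: of_nat_Suc)

lemma bcoeff_cmult: "bcoeff (\<lambda>z. c * f z) n = c * bcoeff f n"
  by (simp add: bcoeff_def L2_inner_cmult_left del: of_nat_Suc)

lemma bcoeff_le:
  assumes "f \<in> L2_disc"
  shows "norm (bcoeff f n) \<le> real (n + 1) * L2_disc_norm (disc_power n) * L2_disc_norm f"
  using mult_left_mono[OF L2_Cauchy_Schwarz[OF assms disc_power_L2[of n]], of "real (n + 1)"]
  unfolding bcoeff_def norm_mult norm_of_nat by (simp only: mult_ac of_nat_0_le_iff simp_thms)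

lemma bergman_norm_eq_0:
  assumes f: "f \<in> bergman_space" and "L2_disc_norm f = 0"
  shows "f = (\<lambda>z. 0)"
proof (rule bergman_eqI[OF f bergman_zero])
  fix n
  have "bcoeff f n = 0" using bcoeff_le[OF bergmanD(1)[OF f], of n] assms(2) by simp
  moreover have "bcoeff (\<lambda>z. 0) n = 0" by (simp add: bcoeff_def L2_inner_def)
  ultimately show "bcoeff f n = bcoeff (\<lambda>z. 0) n" by simp
qed

text \<open>
  The polynomials are dense in the Bergman space.
\<close>

lemma orthogonal_bergman:
  assumes g: "g \<in> L2_disc" and c: "\<And>n. bcoeff g n = 0" and h: "h \<in> bergman_space"
  shows "L2_inner g h = 0"
proof -
  have e: "norm (L2_inner g h) \<le> L2_disc_norm g * L2_disc_norm (\<lambda>z. h z - disc_poly (bcoeff h) M z)" for M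
  proof -
    have "L2_inner g (disc_poly (bcoeff h) M) = 0"
      unfolding disc_poly_def [abs_def] using inner_disc_power_sum[OF g] c by simp
    then have "L2_inner g h = L2_inner g (\<lambda>z. h z - disc_poly (bcoeff h) M z)"
      using g h by (simp add: L2_inner_diff_right bergmanD(1) disc_poly_bergman)
    then show ?thesis
      using L2_Cauchy_Schwarz[OF g L2_diff[OF bergmanD(1)[OF h] bergmanD(1)[OF disc_poly_bergman]]] by metis
  qed
  have "(\<lambda>M. L2_disc_norm g * L2_disc_norm (\<lambda>z. h z - disc_poly (bcoeff h) M z)) \<longlonglongrightarrow> L2_disc_norm g * 0"
    by (intro tendsto_intros bergman_poly_approx h)
  then have "norm (L2_inner g h) \<le> L2_disc_norm g * 0"
    by (rule LIMSEQ_le_const) (use e in auto)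
  then show ?thesis by simp
qed

text \<open>
  The projection keeps the coefficients, and an element of the Bergman space is determined by
  them. This reduces additivity in the symbol and the rule for conjugate factors to coefficients.
\<close>

lemma bergman_proj_eqI:
  assumes g: "g \<in> L2_disc" and f: "f \<in> bergman_space" and c: "\<And>n. bcoeff f n = bcoeff g n"
  shows "bergman_proj g = f"
  unfolding bergman_proj_def
proof (rule the_equality)
  show "f \<in> bergman_space \<and> (\<forall>h\<in>bergman_space. L2_inner (\<lambda>z. g z - f z) h = 0)"
    using f c orthogonal_bergman[OF L2_diff[OF g bergmanD(1)[OF f]]]
    by (simp add: bcoeff_diff g bergmanD(1))
next
  fix f' assume *: "f' \<in> bergman_space \<and> (\<forall>h\<in>bergman_space. L2_inner (\<lambda>z. g z - f' z) h = 0)"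
  then have f': "f' \<in> bergman_space" by simp
  show "f' = f"
  proof (rule bergman_eqI[OF f' f])
    fix n
    have "bcoeff (\<lambda>z. g z - f' z) n = 0" using * by (simp add: bcoeff_def)
    then show "bcoeff f' n = bcoeff f n" by (simp add: bcoeff_diff g bergmanD(1)[OF f'] c)
  qed
qed

lemma bergman_proj_series:
  assumes "g \<in> L2_disc"
  shows "bergman_proj g = disc_series (bcoeff g)"
  by (intro bergman_proj_eqI assms disc_series_bergman[OF L2_Bessel] bcoeff_disc_series[OF L2_Bessel])

lemma bergman_proj_bergman:
  assumes "g \<in> L2_disc"
  shows "bergman_proj g \<in> bergman_space"
  unfolding bergman_proj_series[OF assms] by (rule disc_series_bergman[OF L2_Bessel[OF assms]])

lemma bcoeff_bergman_proj:
  assumes "g \<in> L2_disc"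
  shows "bcoeff (bergman_proj g) n = bcoeff g n"
  unfolding bergman_proj_series[OF assms] by (rule bcoeff_disc_series[OF L2_Bessel[OF assms]])

lemma bergman_proj_norm_le:
  assumes "g \<in> L2_disc"
  shows "L2_disc_norm (bergman_proj g) \<le> L2_disc_norm g"
  unfolding bergman_proj_series[OF assms]
  by (rule power2_le_imp_le) (simp_all add: disc_series_norm_le[OF L2_Bessel[OF assms]])

lemma inner_bergman_proj:
  assumes g: "g \<in> L2_disc" and h: "h \<in> bergman_space"
  shows "L2_inner (bergman_proj g) h = L2_inner g h"
proof -
  have p: "bergman_proj g \<in> L2_disc" by (rule bergmanD(1)[OF bergman_proj_bergman[OF g]])
  have "L2_inner (\<lambda>z. g z - bergman_proj g z) h = 0"
    by (rule orthogonal_bergman[OF L2_diff[OF g p] _ h]) (simp add: bcoeff_diff g p bcoeff_bergman_proj)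
  then show ?thesis by (simp add: L2_inner_diff_left g p bergmanD(1)[OF h])
qed

section \<open>Toeplitz operators with bounded symbols\<close>

text \<open>
  The bound concerns the disc only, so that reciprocals of polynomials with zeros elsewhere
  qualify.
\<close>

definition bounded_symbol :: "(complex \<Rightarrow> complex) \<Rightarrow> bool" where
  "bounded_symbol \<phi> \<longleftrightarrow>
     \<phi> \<in> borel_measurable borel \<and> (\<exists>B. \<forall>z. norm z < 1 \<longrightarrow> norm (\<phi> z) \<le> B)"

lemma bounded_symbol_continuous:
  assumes c: "continuous_on UNIV \<phi>"
  shows "bounded_symbol \<phi>"
proof -
  have "compact (\<phi> ` cball 0 1)"
    by (intro compact_continuous_image continuous_on_subset[OF c]) auto
  then obtain B where "\<forall>x\<in>\<phi> ` cball 0 1. norm x \<le> B"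
    using compact_imp_bounded bounded_iff by metis
  then show ?thesis
    using borel_measurable_continuous_onI[OF c] by (auto simp: bounded_symbol_def intro!: exI[of _ B])
qed

lemma bounded_symbol_add:
  assumes "bounded_symbol \<phi>" "bounded_symbol \<psi>"
  shows "bounded_symbol (\<lambda>z. \<phi> z + \<psi> z)"
proof -
  obtain B C where "\<And>z. norm z < 1 \<Longrightarrow> norm (\<phi> z) \<le> B" "\<And>z. norm z < 1 \<Longrightarrow> norm (\<psi> z) \<le> C"
    using assms by (auto simp: bounded_symbol_def)
  then have "norm (\<phi> z + \<psi> z) \<le> B + C" if "norm z < 1" for z
    using that by (intro norm_triangle_le add_mono) auto
  then show ?thesis using assms by (auto simp: bounded_symbol_def)
qed

lemma bounded_symbol_mult:
  assumes "bounded_symbol \<phi>" "bounded_symbol \<psi>"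
  shows "bounded_symbol (\<lambda>z. \<phi> z * \<psi> z)"
proof -
  obtain B C where B: "\<And>z. norm z < 1 \<Longrightarrow> norm (\<phi> z) \<le> B" and C: "\<And>z. norm z < 1 \<Longrightarrow> norm (\<psi> z) \<le> C"
    using assms by (auto simp: bounded_symbol_def)
  have "norm (\<phi> z * \<psi> z) \<le> B * C" if "norm z < 1" for z
    unfolding norm_mult
    by (rule mult_mono) (use that B C in \<open>auto intro: order_trans[OF norm_ge_zero]\<close>)
  then show ?thesis using assms by (auto simp: bounded_symbol_def)
qed

lemma bounded_symbol_L2:
  "bounded_symbol \<phi> \<Longrightarrow> f \<in> L2_disc \<Longrightarrow> (\<lambda>z. \<phi> z * f z) \<in> L2_disc"
  unfolding bounded_symbol_def using L2_mult_bounded(1) by blast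

lemma toeplitz_bergman:
  "bounded_symbol \<phi> \<Longrightarrow> f \<in> bergman_space \<Longrightarrow> toeplitz \<phi> f \<in> bergman_space"
  unfolding toeplitz_def by (intro bergman_proj_bergman bounded_symbol_L2 bergmanD(1))

lemma toeplitz_eqI:
  assumes "bounded_symbol \<phi>" "f \<in> bergman_space" "g \<in> bergman_space"
    and "\<And>n. bcoeff g n = bcoeff (\<lambda>z. \<phi> z * f z) n"
  shows "toeplitz \<phi> f = g"
  unfolding toeplitz_def using assms by (intro bergman_proj_eqI bounded_symbol_L2 bergmanD(1))

lemma bcoeff_toeplitz:
  "bounded_symbol \<phi> \<Longrightarrow> f \<in> bergman_space \<Longrightarrow> bcoeff (toeplitz \<phi> f) n = bcoeff (\<lambda>z. \<phi> z * f z) n"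
  unfolding toeplitz_def by (intro bcoeff_bergman_proj bounded_symbol_L2 bergmanD(1))

lemma toeplitz_norm_le_mult:
  "bounded_symbol \<phi> \<Longrightarrow> f \<in> bergman_space \<Longrightarrow> L2_disc_norm (toeplitz \<phi> f) \<le> L2_disc_norm (\<lambda>z. \<phi> z * f z)"
  unfolding toeplitz_def by (intro bergman_proj_norm_le bounded_symbol_L2 bergmanD(1))

lemma toeplitz_norm_le:
  assumes "bounded_symbol \<phi>" "f \<in> bergman_space" "\<And>z. norm z < 1 \<Longrightarrow> norm (\<phi> z) \<le> B"
  shows "L2_disc_norm (toeplitz \<phi> f) \<le> B * L2_disc_norm f"
  using toeplitz_norm_le_mult[OF assms(1,2)] L2_mult_bounded(2)[OF bergmanD(1)[OF assms(2)] _ assms(3)] assms(1)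
  by (force simp: bounded_symbol_def)

lemma bounded_bergman_op_toeplitz:
  assumes b: "bounded_symbol \<phi>"
  shows "bounded_bergman_op (toeplitz \<phi>)"
proof -
  obtain B where B: "\<And>z. norm z < 1 \<Longrightarrow> norm (\<phi> z) \<le> B" using b by (auto simp: bounded_symbol_def)
  show ?thesis
    unfolding bounded_bergman_op_def
  proof (intro conjI ballI allI exI)
    fix f g assume f: "f \<in> bergman_space" and g: "g \<in> bergman_space"
    show "toeplitz \<phi> (\<lambda>z. f z + g z) = (\<lambda>z. toeplitz \<phi> f z + toeplitz \<phi> g z)"
      using b f g
      by (intro toeplitz_eqI bergman_add toeplitz_bergman)
        (simp_all add: bcoeff_add bergmanD(1) toeplitz_bergman bcoeff_toeplitz distrib_left bounded_symbol_L2)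
  next
    fix c f assume f: "f \<in> bergman_space"
    have "bcoeff (\<lambda>z. \<phi> z * (c * f z)) n = c * bcoeff (\<lambda>z. \<phi> z * f z) n" for n
      unfolding bcoeff_cmult[symmetric] by (simp add: mult_ac)
    then show "toeplitz \<phi> (\<lambda>z. c * f z) = (\<lambda>z. c * toeplitz \<phi> f z)"
      using b f by (intro toeplitz_eqI bergman_cmult toeplitz_bergman) (simp_all add: bcoeff_cmult bcoeff_toeplitz)
    next
    fix f assume "f \<in> bergman_space"
    then show "toeplitz \<phi> f \<in> bergman_space" "L2_disc_norm (toeplitz \<phi> f) \<le> B * L2_disc_norm f"
      using b B by (blast intro: toeplitz_bergman toeplitz_norm_le)+
  qed
qed

lemma toeplitz_add:
  assumes "bounded_symbol \<phi>" "bounded_symbol \<psi>" "f \<in> bergman_space"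
  shows "toeplitz (\<lambda>z. \<phi> z + \<psi> z) f = (\<lambda>z. toeplitz \<phi> f z + toeplitz \<psi> f z)"
  using assms
  by (intro toeplitz_eqI bounded_symbol_add bergman_add toeplitz_bergman)
    (simp_all add: bcoeff_add bergmanD(1) toeplitz_bergman bcoeff_toeplitz distrib_right bounded_symbol_L2)

text \<open>
  When \<open>h f\<close> lies in the Bergman space, this is the rule \<open>T\<^sub>\<phi> T\<^sub>h = T\<^sub>\<phi>\<^sub>h\<close> for analytic \<open>h\<close>.
\<close>

lemma toeplitz_mult_right:
  "toeplitz \<phi> (\<lambda>z. h z * f z) = toeplitz (\<lambda>z. \<phi> z * h z) f"
  by (simp add: toeplitz_def mult.assoc)

lemma toeplitz_cong:
  assumes "f \<in> bergman_space" "\<And>z. norm z < 1 \<Longrightarrow> \<phi> z = \<psi> z"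
  shows "toeplitz \<phi> f = toeplitz \<psi> f"
proof -
  have "(\<lambda>z. \<phi> z * f z) = (\<lambda>z. \<psi> z * f z)"
    using assms bergmanD(3)[OF assms(1)] by (metis mult_zero_right not_less)
  then show ?thesis by (simp add: toeplitz_def)
qed

lemma toeplitz_analytic:
  assumes b: "bounded_symbol h" and h: "h holomorphic_on ball 0 1" and f: "f \<in> bergman_space"
  shows "(\<lambda>z. h z * f z) \<in> bergman_space" "toeplitz h f = (\<lambda>z. h z * f z)"
proof -
  show *: "(\<lambda>z. h z * f z) \<in> bergman_space"
    using b bergman_mult[OF f h] by (auto simp: bounded_symbol_def)
  show "toeplitz h f = (\<lambda>z. h z * f z)"
    by (rule toeplitz_eqI[OF b f *]) simp
qed

text \<open>
  The adjoint of the rule for analytic factors on the right: in an inner product with a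
  monomial, the conjugate factor moves to the monomial, and the projection does not change an inner
  product with an element of the Bergman space.
\<close>

lemma toeplitz_coanalytic_left:
  assumes b: "bounded_symbol (\<lambda>z. cnj (h z))" and h: "h holomorphic_on ball 0 1"
    and c: "bounded_symbol \<psi>" and f: "f \<in> bergman_space"
  shows "toeplitz (\<lambda>z. cnj (h z)) (toeplitz \<psi> f) = toeplitz (\<lambda>z. cnj (h z) * \<psi> z) f"
proof (rule toeplitz_eqI[OF b toeplitz_bergman[OF c f]])
  have bc: "bounded_symbol (\<lambda>z. cnj (h z) * \<psi> z)" by (rule bounded_symbol_mult[OF b c])
  then show "toeplitz (\<lambda>z. cnj (h z) * \<psi> z) f \<in> bergman_space" by (rule toeplitz_bergman[OF _ f])
  fix n
  obtain B where "\<And>z. norm z < 1 \<Longrightarrow> norm (h z) \<le> B" using b by (auto simp: bounded_symbol_def)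
  then have hn: "(\<lambda>z. h z * disc_power n z) \<in> bergman_space"
    by (rule bergman_mult[OF disc_power_bergman h])
  have move: "L2_inner (\<lambda>z. cnj (h z) * u z) (disc_power n) = L2_inner u (\<lambda>z. h z * disc_power n z)" for u
    by (simp add: L2_inner_def mult_ac)
  have "L2_inner (\<lambda>z. cnj (h z) * toeplitz \<psi> f z) (disc_power n) = L2_inner (\<lambda>z. \<psi> z * f z) (\<lambda>z. h z * disc_power n z)"
    unfolding move toeplitz_def by (rule inner_bergman_proj[OF bounded_symbol_L2[OF c bergmanD(1)[OF f]] hn])
  also have "\<dots> = L2_inner (\<lambda>z. cnj (h z) * \<psi> z * f z) (disc_power n)"
    unfolding move[symmetric] by (simp add: mult.assoc)
  finally show "bcoeff (toeplitz (\<lambda>z. cnj (h z) * \<psi> z) f) n = bcoeff (\<lambda>z. cnj (h z) * toeplitz \<psi> f z) n"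
    unfolding bcoeff_toeplitz[OF bc f] by (simp add: bcoeff_def)
qed

section \<open>Bounded and invertible operators\<close>

lemma bounded_opD:
  assumes "bounded_bergman_op T"
  shows "f \<in> bergman_space \<Longrightarrow> T f \<in> bergman_space"
    and "f \<in> bergman_space \<Longrightarrow> g \<in> bergman_space \<Longrightarrow> T (\<lambda>z. f z + g z) = (\<lambda>z. T f z + T g z)"
    and "f \<in> bergman_space \<Longrightarrow> T (\<lambda>z. c * f z) = (\<lambda>z. c * T f z)"
  using assms by (auto simp: bounded_bergman_op_def)

lemma bounded_op_norm:
  assumes "bounded_bergman_op T"
  obtains K where "K > 0" "\<And>f. f \<in> bergman_space \<Longrightarrow> L2_disc_norm (T f) \<le> K * L2_disc_norm f"
proof -
  obtain K where K: "\<And>f. f \<in> bergman_space \<Longrightarrow> L2_disc_norm (T f) \<le> K * L2_disc_norm f"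
    using assms unfolding bounded_bergman_op_def by blast
  show ?thesis
  proof (rule that[of "max K 1"])
    fix f assume "f \<in> bergman_space"
    then have "L2_disc_norm (T f) \<le> K * L2_disc_norm f" by (rule K)
    also have "\<dots> \<le> max K 1 * L2_disc_norm f" by (intro mult_right_mono) auto
    finally show "L2_disc_norm (T f) \<le> max K 1 * L2_disc_norm f" .
  qed simp
qed

lemma bounded_op_diff:
  assumes "bounded_bergman_op T" "f \<in> bergman_space" "g \<in> bergman_space"
  shows "T (\<lambda>z. f z - g z) = (\<lambda>z. T f z - T g z)"
  using bounded_opD(2)[OF assms(1,2) bergman_cmult[OF assms(3), of "-1"]]
    bounded_opD(3)[OF assms(1,3), of "-1"] by simp

lemma bounded_op_zero:
  assumes "bounded_bergman_op T"
  shows "T (\<lambda>z. 0) = (\<lambda>z. 0)"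
  using bounded_opD(3)[OF assms bergman_zero, of 0] by simp

lemma bounded_op_cong:
  assumes "bounded_bergman_op T" "\<And>f. f \<in> bergman_space \<Longrightarrow> T' f = T f"
  shows "bounded_bergman_op T'"
  using assms unfolding bounded_bergman_op_def by (auto simp: bergman_add bergman_cmult)

lemma bounded_op_add:
  assumes T: "bounded_bergman_op T" and R: "bounded_bergman_op R"
  shows "bounded_bergman_op (\<lambda>f z. T f z + R f z)"
proof -
  obtain K where K: "\<And>f. f \<in> bergman_space \<Longrightarrow> L2_disc_norm (T f) \<le> K * L2_disc_norm f"
    using bounded_op_norm[OF T] by metis
  obtain L where L: "\<And>f. f \<in> bergman_space \<Longrightarrow> L2_disc_norm (R f) \<le> L * L2_disc_norm f"
    using bounded_op_norm[OF R] by metis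
  have "L2_disc_norm (\<lambda>z. T f z + R f z) \<le> (K + L) * L2_disc_norm f" if f: "f \<in> bergman_space" for f
  proof -
    have "L2_disc_norm (\<lambda>z. T f z + R f z) \<le> L2_disc_norm (T f) + L2_disc_norm (R f)"
      by (intro L2_norm_triangle bergmanD(1) bounded_opD(1)[OF T] bounded_opD(1)[OF R] f)
    with K[OF f] L[OF f] show ?thesis by (simp add: distrib_right)
  qed
  then have "\<exists>M. \<forall>f\<in>bergman_space. L2_disc_norm (\<lambda>z. T f z + R f z) \<le> M * L2_disc_norm f" by blast
  then show ?thesis
    unfolding bounded_bergman_op_def
    by (simp add: bounded_opD[OF T] bounded_opD[OF R] bergman_add distrib_left add_ac)
qed

lemma bounded_op_compose:
  assumes T: "bounded_bergman_op T" and S: "bounded_bergman_op S"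
  shows "bounded_bergman_op (\<lambda>f. T (S f))"
proof -
  obtain K where K: "K > 0" "\<And>f. f \<in> bergman_space \<Longrightarrow> L2_disc_norm (T f) \<le> K * L2_disc_norm f"
    using bounded_op_norm[OF T] by metis
  obtain L where L: "\<And>f. f \<in> bergman_space \<Longrightarrow> L2_disc_norm (S f) \<le> L * L2_disc_norm f"
    using bounded_op_norm[OF S] by metis
  have "L2_disc_norm (T (S f)) \<le> (K * L) * L2_disc_norm f" if f: "f \<in> bergman_space" for f
  proof -
    have "L2_disc_norm (T (S f)) \<le> K * L2_disc_norm (S f)" by (rule K(2)[OF bounded_opD(1)[OF S f]])
    also have "\<dots> \<le> K * (L * L2_disc_norm f)" using K(1) L[OF f] by simp
    finally show ?thesis by (simp add: mult.assoc)
  qed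
  then have "\<exists>M. \<forall>f\<in>bergman_space. L2_disc_norm (T (S f)) \<le> M * L2_disc_norm f" by blast
  then show ?thesis
    unfolding bounded_bergman_op_def
    by (simp add: bounded_opD[OF T] bounded_opD[OF S])
qed

lemma bounded_op_cmult: "bounded_bergman_op (\<lambda>f z. c * f z)"
  unfolding bounded_bergman_op_def
  by (intro conjI exI[of _ "norm c"]) (simp_all add: bergman_cmult distrib_left mult_ac L2_norm_cmult)

text \<open>
  The lower bound gives injectivity and at the same time the bound for the inverse.
\<close>

lemma invertible_iff_bounded_below_onto:
  assumes T: "bounded_bergman_op T"
  shows "invertible_bergman_op T \<longleftrightarrow>
    (\<exists>C. \<forall>f\<in>bergman_space. L2_disc_norm f \<le> C * L2_disc_norm (T f)) \<and>
    (\<forall>g\<in>bergman_space. \<exists>f\<in>bergman_space. T f = g)"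
proof
  assume "invertible_bergman_op T"
  then obtain S where S: "bounded_bergman_op S"
    and ST: "\<And>f. f \<in> bergman_space \<Longrightarrow> S (T f) = f" "\<And>f. f \<in> bergman_space \<Longrightarrow> T (S f) = f"
    unfolding invertible_bergman_op_def by blast
  obtain K where K: "\<And>f. f \<in> bergman_space \<Longrightarrow> L2_disc_norm (S f) \<le> K * L2_disc_norm f"
    using bounded_op_norm[OF S] by metis
  have "L2_disc_norm f \<le> K * L2_disc_norm (T f)" if "f \<in> bergman_space" for f
    using K[OF bounded_opD(1)[OF T that]] ST(1)[OF that] by simp
  then show "(\<exists>C. \<forall>f\<in>bergman_space. L2_disc_norm f \<le> C * L2_disc_norm (T f)) \<and>
    (\<forall>g\<in>bergman_space. \<exists>f\<in>bergman_space. T f = g)"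
    using ST(2) bounded_opD(1)[OF S] by blast
next
  assume R: "(\<exists>C. \<forall>f\<in>bergman_space. L2_disc_norm f \<le> C * L2_disc_norm (T f)) \<and>
    (\<forall>g\<in>bergman_space. \<exists>f\<in>bergman_space. T f = g)"
  then obtain C where C: "\<And>f. f \<in> bergman_space \<Longrightarrow> L2_disc_norm f \<le> C * L2_disc_norm (T f)" by blast
  have inj: "f = g" if f: "f \<in> bergman_space" and g: "g \<in> bergman_space" and eq: "T f = T g" for f g
  proof -
    have "T (\<lambda>z. f z - g z) = (\<lambda>z. 0)" by (simp add: bounded_op_diff[OF T f g] eq)
    then have "L2_disc_norm (\<lambda>z. f z - g z) \<le> C * L2_disc_norm (\<lambda>z. 0)"
      using C[OF bergman_diff[OF f g]] by simp
    then have "L2_disc_norm (\<lambda>z. f z - g z) = 0"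
      using L2_norm_nonneg[of "\<lambda>z. f z - g z"] by (simp del: L2_norm_nonneg)
    from bergman_norm_eq_0[OF bergman_diff[OF f g] this] show ?thesis by (simp add: fun_eq_iff)
  qed
  define S where "S g = (SOME f. f \<in> bergman_space \<and> T f = g)" for g
  have S: "S g \<in> bergman_space \<and> T (S g) = g" if "g \<in> bergman_space" for g
  proof -
    have "\<exists>f. f \<in> bergman_space \<and> T f = g" using R that by blast
    then show ?thesis unfolding S_def by (rule someI_ex)
  qed
  have SI: "S g = f" if "f \<in> bergman_space" "T f = g" "g \<in> bergman_space" for f g
    using S[OF that(3)] that inj by auto
  have "bounded_bergman_op S"
    unfolding bounded_bergman_op_def
  proof (intro conjI ballI allI exI)
    fix f g assume f: "f \<in> bergman_space" and g: "g \<in> bergman_space"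
    show "S (\<lambda>z. f z + g z) = (\<lambda>z. S f z + S g z)"
      by (rule SI) (use S[OF f] S[OF g] f g in \<open>auto simp: bounded_opD(2)[OF T] intro: bergman_add\<close>)
  next
    fix c f assume f: "f \<in> bergman_space"
    show "S (\<lambda>z. c * f z) = (\<lambda>z. c * S f z)"
      by (rule SI) (use S[OF f] f in \<open>auto simp: bounded_opD(3)[OF T] intro: bergman_cmult\<close>)
  next
    fix f assume f: "f \<in> bergman_space"
    show "L2_disc_norm (S f) \<le> C * L2_disc_norm f" using S[OF f] C[of "S f"] by auto
  qed (use S in auto)
  moreover have "S (T f) = f \<and> T (S f) = f" if f: "f \<in> bergman_space" for f
    using S[OF f] SI[OF f refl bounded_opD(1)[OF T f]] by simp
  ultimately show "invertible_bergman_op T"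
    unfolding invertible_bergman_op_def using T by blast
qed

lemma invertible_op_bounded: "invertible_bergman_op T \<Longrightarrow> bounded_bergman_op T"
  by (simp add: invertible_bergman_op_def)

lemma invertible_op_onto:
  "invertible_bergman_op T \<Longrightarrow> g \<in> bergman_space \<Longrightarrow> \<exists>f\<in>bergman_space. T f = g"
  using invertible_iff_bounded_below_onto[OF invertible_op_bounded] by blast

lemma invertible_op_bounded_below:
  assumes "invertible_bergman_op T"
  obtains C where "C > 0" "\<And>f. f \<in> bergman_space \<Longrightarrow> L2_disc_norm f \<le> C * L2_disc_norm (T f)"
proof -
  obtain C where C: "\<And>f. f \<in> bergman_space \<Longrightarrow> L2_disc_norm f \<le> C * L2_disc_norm (T f)"
    using assms invertible_iff_bounded_below_onto[OF invertible_op_bounded] by blast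
  show ?thesis
  proof (rule that[of "max C 1"])
    fix f assume "f \<in> bergman_space"
    then have "L2_disc_norm f \<le> C * L2_disc_norm (T f)" by (rule C)
    also have "\<dots> \<le> max C 1 * L2_disc_norm (T f)" by (intro mult_right_mono) auto
    finally show "L2_disc_norm f \<le> max C 1 * L2_disc_norm (T f)" .
  qed simp
qed

lemma invertible_op_cong:
  assumes "\<And>f. f \<in> bergman_space \<Longrightarrow> T' f = T f"
  shows "invertible_bergman_op T' \<longleftrightarrow> invertible_bergman_op T"
proof -
  have *: "bounded_bergman_op T' \<longleftrightarrow> bounded_bergman_op T"
    using bounded_op_cong[of T T'] bounded_op_cong[of T' T] assms by metis
  show ?thesis
  proof (cases "bounded_bergman_op T")
    case True
    with * have "bounded_bergman_op T'" by simp
    with True show ?thesis by (simp add: invertible_iff_bounded_below_onto assms)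
  qed (use * invertible_op_bounded in blast)
qed

lemma invertible_op_compose:
  assumes T: "invertible_bergman_op T" and S: "invertible_bergman_op S"
  shows "invertible_bergman_op (\<lambda>f. T (S f))"
proof -
  note bT = invertible_op_bounded[OF T] and bS = invertible_op_bounded[OF S]
  obtain C where C: "C > 0" "\<And>f. f \<in> bergman_space \<Longrightarrow> L2_disc_norm f \<le> C * L2_disc_norm (T f)"
    using invertible_op_bounded_below[OF T] by metis
  obtain D where D: "D > 0" "\<And>f. f \<in> bergman_space \<Longrightarrow> L2_disc_norm f \<le> D * L2_disc_norm (S f)"
    using invertible_op_bounded_below[OF S] by metis
  show ?thesis
    unfolding invertible_iff_bounded_below_onto[OF bounded_op_compose[OF bT bS]]
  proof (intro conjI exI ballI)
    fix f assume f: "f \<in> bergman_space"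
    have "L2_disc_norm f \<le> D * L2_disc_norm (S f)" by (rule D(2)[OF f])
    also have "\<dots> \<le> D * (C * L2_disc_norm (T (S f)))"
      using D(1) C(2)[OF bounded_opD(1)[OF bS f]] by simp
    finally show "L2_disc_norm f \<le> (D * C) * L2_disc_norm (T (S f))" by (simp add: mult.assoc)
  next
    fix g assume "g \<in> bergman_space"
    then show "\<exists>f\<in>bergman_space. T (S f) = g"
      using invertible_op_onto[OF T] invertible_op_onto[OF S] by metis
  qed
qed

interpretation bergman: Metric_space bergman_space "\<lambda>f g. L2_disc_norm (\<lambda>z. f z - g z)"
proof
  fix f g h assume f: "f \<in> bergman_space" and g: "g \<in> bergman_space"
  show "(L2_disc_norm (\<lambda>z. f z - g z) = 0) = (f = g)"
  proof
    assume "L2_disc_norm (\<lambda>z. f z - g z) = 0"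
    from bergman_norm_eq_0[OF bergman_diff[OF f g] this] show "f = g" by (simp add: fun_eq_iff)
  qed simp
  assume h: "h \<in> bergman_space"
  show "L2_disc_norm (\<lambda>z. f z - h z) \<le> L2_disc_norm (\<lambda>z. f z - g z) + L2_disc_norm (\<lambda>z. g z - h z)"
    using L2_norm_triangle[of "\<lambda>z. f z - g z" "\<lambda>z. g z - h z"] f g h by (simp add: L2_diff bergmanD(1))
qed (simp, rule L2_norm_minus_commute)

text \<open>
  The coefficients of a Cauchy sequence converge, since each of them is a continuous
  functional. Only differences of the members are controlled, so the limit is built as one member plus
  the series of the coefficients that it lacks.
\<close>

lemma bergman_mcomplete: "bergman.mcomplete"
  unfolding bergman.mcomplete_def
proof (intro allI impI)
  fix \<sigma> assume "bergman.MCauchy \<sigma>"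
  then have \<sigma>: "\<And>k. \<sigma> k \<in> bergman_space"
    and cau: "\<And>e. e > 0 \<Longrightarrow> \<exists>N. \<forall>k j. N \<le> k \<longrightarrow> N \<le> j \<longrightarrow> L2_disc_norm (\<lambda>z. \<sigma> k z - \<sigma> j z) < e"
    by (auto simp: bergman.MCauchy_def)
  define c where "c k n = bcoeff (\<sigma> k) n" for k n
  have cdiff: "bcoeff (\<lambda>z. \<sigma> k z - \<sigma> j z) n = c k n - c j n" for k j n
    by (simp add: c_def bcoeff_diff bergmanD(1)[OF \<sigma>])
  have "Cauchy (\<lambda>k. c k n)" for n
  proof (rule metric_CauchyI)
    fix e :: real assume e: "e > 0"
    define L where "L = real (n + 1) * L2_disc_norm (disc_power n)"
    have L: "L \<ge> 0" by (simp add: L_def)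
    obtain N where N: "\<forall>k j. N \<le> k \<longrightarrow> N \<le> j \<longrightarrow> L2_disc_norm (\<lambda>z. \<sigma> k z - \<sigma> j z) < e / (L + 1)"
      using cau[of "e / (L + 1)"] e L by auto
    have "dist (c k n) (c j n) < e" if "k \<ge> N" "j \<ge> N" for k j
    proof -
      have "dist (c k n) (c j n) \<le> L * L2_disc_norm (\<lambda>z. \<sigma> k z - \<sigma> j z)"
        unfolding dist_norm cdiff[symmetric] L_def by (rule bcoeff_le[OF L2_diff[OF bergmanD(1)[OF \<sigma>] bergmanD(1)[OF \<sigma>]]])
      also have "\<dots> \<le> L * (e / (L + 1))" using N that L by (intro mult_left_mono) (auto simp: less_imp_le)
      also have "\<dots> < e" using e L by (simp add: field_simps)
      finally show ?thesis .
    qed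
    then show "\<exists>M. \<forall>m\<ge>M. \<forall>k\<ge>M. dist (c m n) (c k n) < e" by blast
  qed
  then have "\<exists>b. \<forall>n. (\<lambda>k. c k n) \<longlonglongrightarrow> b n"
    by (intro choice allI) (simp add: Cauchy_convergent_iff convergent_def)
  then obtain b where b: "\<And>n. (\<lambda>k. c k n) \<longlonglongrightarrow> b n" by blast
  have close: "(\<Sum>n<M. (norm (b n - c k n))\<^sup>2 / real (n + 1)) \<le> e\<^sup>2"
    if N: "\<forall>k j. N \<le> k \<longrightarrow> N \<le> j \<longrightarrow> L2_disc_norm (\<lambda>z. \<sigma> k z - \<sigma> j z) < e" and k: "k \<ge> N" for e N k M
  proof (rule LIMSEQ_le_const2)
    show "(\<lambda>j. \<Sum>n<M. (norm (c j n - c k n))\<^sup>2 / real (n + 1)) \<longlonglongrightarrow> (\<Sum>n<M. (norm (b n - c k n))\<^sup>2 / real (n + 1))"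
      by (intro tendsto_intros b) simp
    have "(\<Sum>n<M. (norm (c j n - c k n))\<^sup>2 / real (n + 1)) \<le> e\<^sup>2" if "j \<ge> N" for j
    proof -
      have "(\<Sum>n<M. (norm (c j n - c k n))\<^sup>2 / real (n + 1)) \<le> (L2_disc_norm (\<lambda>z. \<sigma> j z - \<sigma> k z))\<^sup>2"
        unfolding cdiff[symmetric] by (rule L2_Bessel[OF L2_diff[OF bergmanD(1)[OF \<sigma>] bergmanD(1)[OF \<sigma>]]])
      also have "\<dots> \<le> e\<^sup>2" using N k that by (intro power_mono) (auto simp: less_imp_le)
      finally show ?thesis .
    qed
    then show "\<exists>N. \<forall>j\<ge>N. (\<Sum>n<M. (norm (c j n - c k n))\<^sup>2 / real (n + 1)) \<le> e\<^sup>2" by blast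
  qed
  obtain N1 where N1: "\<forall>k j. N1 \<le> k \<longrightarrow> N1 \<le> j \<longrightarrow> L2_disc_norm (\<lambda>z. \<sigma> k z - \<sigma> j z) < 1"
    using cau[of 1] by auto
  define g where "g = disc_series (\<lambda>n. b n - c N1 n)"
  have g: "g \<in> bergman_space" unfolding g_def by (rule disc_series_bergman[OF close[OF N1]]) simp
  have bg: "bcoeff g n = b n - c N1 n" for n
    unfolding g_def by (rule bcoeff_disc_series[OF close[OF N1]]) simp
  define x where "x = (\<lambda>z. g z + \<sigma> N1 z)"
  have x: "x \<in> bergman_space" unfolding x_def by (rule bergman_add[OF g \<sigma>])
  have bx: "bcoeff (\<lambda>z. x z - \<sigma> k z) n = b n - c k n" for k n
    by (subst bcoeff_diff) (simp_all add: x bergmanD(1)[OF x] bergmanD(1)[OF \<sigma>] bergmanD(1)[OF g] x_def bcoeff_add bg L2_add c_def)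
  have "eventually (\<lambda>k. \<sigma> k \<in> bergman_space \<and> L2_disc_norm (\<lambda>z. \<sigma> k z - x z) < e) sequentially"
    if e: "e > 0" for e
  proof -
    obtain N where N: "\<forall>k j. N \<le> k \<longrightarrow> N \<le> j \<longrightarrow> L2_disc_norm (\<lambda>z. \<sigma> k z - \<sigma> j z) < e / 2"
      using cau[of "e / 2"] e by auto
    have "L2_disc_norm (\<lambda>z. \<sigma> k z - x z) < e" if k: "k \<ge> N" for k
    proof -
      have xs: "(\<lambda>z. x z - \<sigma> k z) \<in> bergman_space" by (rule bergman_diff[OF x \<sigma>])
      have "(L2_disc_norm (\<lambda>z. x z - \<sigma> k z))\<^sup>2 \<le> (e / 2)\<^sup>2"
        using bergman_parseval[OF xs] close[OF N k] unfolding sums_iff bx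
        by (metis suminf_le_const)
      then have "L2_disc_norm (\<lambda>z. x z - \<sigma> k z) \<le> e / 2" by (rule power2_le_imp_le) (use e in simp)
      with e show ?thesis by (simp add: L2_norm_minus_commute[of "\<sigma> k"])
    qed
    then show ?thesis using \<sigma> by (auto simp: eventually_sequentially)
  qed
  with x show "\<exists>x. limitin bergman.mtopology \<sigma> x sequentially"
    by (auto simp: bergman.limitin_metric)
qed

text \<open>
  The equation \<open>T f + R f = g\<close> is the fixed point equation of \<open>f \<mapsto> T\<^sup>-\<^sup>1 (g - R f)\<close>, a contraction
  with the constant \<open>C e\<close>.
\<close>

lemma invertible_op_perturbation:
  assumes T: "invertible_bergman_op T" and R: "bounded_bergman_op R"
    and C: "C > 0" "\<And>f. f \<in> bergman_space \<Longrightarrow> L2_disc_norm f \<le> C * L2_disc_norm (T f)"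
    and e: "\<And>f. f \<in> bergman_space \<Longrightarrow> L2_disc_norm (R f) \<le> e * L2_disc_norm f" and small: "C * e < 1"
  shows "invertible_bergman_op (\<lambda>f z. T f z + R f z)"
proof -
  note bT = invertible_op_bounded[OF T]
  show ?thesis
    unfolding invertible_iff_bounded_below_onto[OF bounded_op_add[OF bT R]]
  proof (intro conjI exI ballI)
    fix f assume f: "f \<in> bergman_space"
    have "L2_disc_norm (T f) \<le> L2_disc_norm (\<lambda>z. T f z + R f z) + L2_disc_norm (R f)"
      using L2_norm_triangle_diff[of "\<lambda>z. T f z + R f z" "R f"] f
      by (simp add: L2_add bergmanD(1) bounded_opD(1)[OF bT] bounded_opD(1)[OF R])
    also have "\<dots> \<le> L2_disc_norm (\<lambda>z. T f z + R f z) + e * L2_disc_norm f" using e[OF f] by simp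
    finally have "C * L2_disc_norm (T f) \<le> C * (L2_disc_norm (\<lambda>z. T f z + R f z) + e * L2_disc_norm f)"
      using C(1) by simp
    with C(2)[OF f] have "(1 - C * e) * L2_disc_norm f \<le> C * L2_disc_norm (\<lambda>z. T f z + R f z)"
      by (simp add: algebra_simps)
    with small show "L2_disc_norm f \<le> (C / (1 - C * e)) * L2_disc_norm (\<lambda>z. T f z + R f z)"
      by (simp add: field_simps)
  next
    fix g assume g: "g \<in> bergman_space"
    obtain S where S: "bounded_bergman_op S"
      and TS: "\<And>f. f \<in> bergman_space \<Longrightarrow> T (S f) = f"
      using T unfolding invertible_bergman_op_def by blast
    define \<Phi> where "\<Phi> f = S (\<lambda>z. g z - R f z)" for f
    have in1: "(\<lambda>z. g z - R f z) \<in> bergman_space" if "f \<in> bergman_space" for f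
      by (intro bergman_diff g bounded_opD(1)[OF R] that)
    obtain f where f: "f \<in> bergman_space" "\<Phi> f = f"
    proof (rule bergman.Banach_fixedpoint_thm[OF bergman_mcomplete, of \<Phi> "C * e"])
      show "bergman_space \<noteq> {}" using bergman_zero by blast
      show "\<Phi> \<in> bergman_space \<rightarrow> bergman_space"
        unfolding \<Phi>_def by (intro Pi_I bounded_opD(1)[OF S] in1)
      fix f h assume f: "f \<in> bergman_space" and h: "h \<in> bergman_space"
      have hf: "(\<lambda>z. h z - f z) \<in> bergman_space" by (rule bergman_diff[OF h f])
      have Rhf: "R (\<lambda>z. h z - f z) \<in> bergman_space" by (rule bounded_opD(1)[OF R hf])
      have "(\<lambda>z. \<Phi> f z - \<Phi> h z) = S (\<lambda>z. (g z - R f z) - (g z - R h z))"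
        unfolding \<Phi>_def by (rule bounded_op_diff[OF S in1[OF f] in1[OF h], symmetric])
      also have "(\<lambda>z. (g z - R f z) - (g z - R h z)) = R (\<lambda>z. h z - f z)"
        by (simp add: bounded_op_diff[OF R h f])
      finally have "L2_disc_norm (\<lambda>z. \<Phi> f z - \<Phi> h z) = L2_disc_norm (S (R (\<lambda>z. h z - f z)))" by simp
      also have "\<dots> \<le> C * L2_disc_norm (R (\<lambda>z. h z - f z))"
        using C(2)[OF bounded_opD(1)[OF S Rhf]] by (simp add: TS[OF Rhf])
      also have "\<dots> \<le> C * (e * L2_disc_norm (\<lambda>z. h z - f z))"
        using e[OF hf] C(1) by simp
      finally show "L2_disc_norm (\<lambda>z. \<Phi> f z - \<Phi> h z) \<le> C * e * L2_disc_norm (\<lambda>z. f z - h z)"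
        by (simp add: L2_norm_minus_commute[of f] mult.assoc)
    qed (use small in auto)
    have "T f = (\<lambda>z. g z - R f z)"
      using TS[OF in1[OF f(1)]] f(2) by (simp add: \<Phi>_def)
    then have "(\<lambda>z. T f z + R f z) = g" by (simp add: fun_eq_iff)
    with f(1) show "\<exists>f\<in>bergman_space. (\<lambda>z. T f z + R f z) = g" by blast
  qed
qed

section \<open>Operators of finite rank\<close>

lemma linear_system_inverse:
  fixes A :: "nat \<Rightarrow> nat \<Rightarrow> 'a::field"
  assumes inj: "\<And>c. (\<And>i. i < M \<Longrightarrow> (\<Sum>j<M. A i j * c j) = 0) \<Longrightarrow> (\<And>j. j < M \<Longrightarrow> c j = 0)"
  obtains D where "\<And>i k. i < M \<Longrightarrow> k < M \<Longrightarrow> (\<Sum>j<M. A i j * D k j) = (if i = k then 1 else 0)"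
proof -
  define B where "B = mat M M (\<lambda>(i, j). A i j)"
  have B: "B \<in> carrier_mat M M" by (simp add: B_def)
  have "det B \<noteq> 0"
  proof
    assume "det B = 0"
    then obtain v where v: "v \<in> carrier_vec M" "v \<noteq> 0\<^sub>v M" "B *\<^sub>v v = 0\<^sub>v M"
      using det_0_iff_vec_prod_zero_field[OF B] by auto
    have "(\<Sum>j<M. A i j * vec_index v j) = 0" if i: "i < M" for i
    proof -
      have "vec_index (B *\<^sub>v v) i = (\<Sum>j<M. A i j * vec_index v j)"
        using v(1) i by (auto simp: B_def scalar_prod_def atLeast0LessThan intro!: sum.cong)
      then show ?thesis using v(3) i by simp
    qed
    then have "vec_index v j = 0" if "j < M" for j using inj that by blast
    then have "v = 0\<^sub>v M" using v(1) by (intro eq_vecI) auto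
    with v(2) show False by simp
  qed
  then obtain E where E: "E \<in> carrier_mat M M" "B * E = 1\<^sub>m M"
    using det_non_zero_imp_unit[OF B, of "()"]
    by (auto simp: Units_def ring_mat_def)
  show ?thesis
  proof (rule that[of "\<lambda>k j. index_mat E (j, k)"])
    fix i k assume i: "i < M" and k: "k < M"
    have "(\<Sum>j<M. A i j * index_mat E (j, k)) = index_mat (B * E) (i, k)"
      using E(1) i k by (auto simp: B_def scalar_prod_def atLeast0LessThan intro!: sum.cong)
    also have "\<dots> = (if i = k then 1 else 0)" using i k by (simp add: E(2))
    finally show "(\<Sum>j<M. A i j * index_mat E (j, k)) = (if i = k then 1 else 0)" .
  qed
qed


lemma bcoeff_sum:
  assumes "\<And>i. i \<in> I \<Longrightarrow> f i \<in> L2_disc"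
  shows "bcoeff (\<lambda>z. \<Sum>i\<in>I. f i z) n = (\<Sum>i\<in>I. bcoeff (f i) n)"
  using assms
proof (induction I rule: infinite_finite_induct)
  case (insert i I)
  then show ?case by (simp add: bcoeff_add L2_sum)
qed (simp_all add: bcoeff_def L2_inner_def)

lemma bounded_op_sum:
  assumes T: "bounded_bergman_op T" and f: "\<And>i. i \<in> I \<Longrightarrow> f i \<in> bergman_space"
  shows "T (\<lambda>z. \<Sum>i\<in>I. c i * f i z) = (\<lambda>z. \<Sum>i\<in>I. c i * T (f i) z)"
  using f
proof (induction I rule: infinite_finite_induct)
  case (insert i I)
  then show ?case
    by (simp add: bounded_opD(2,3)[OF T] bergman_cmult bergman_sum)
qed (simp_all add: bounded_op_zero[OF T])

lemma L2_norm_sum_le: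
  assumes "\<And>i. i \<in> I \<Longrightarrow> f i \<in> L2_disc"
  shows "L2_disc_norm (\<lambda>z. \<Sum>i\<in>I. f i z) \<le> (\<Sum>i\<in>I. L2_disc_norm (f i))"
  using assms
proof (induction I rule: infinite_finite_induct)
  case (insert i I)
  have "L2_disc_norm (\<lambda>z. f i z + (\<Sum>i\<in>I. f i z)) \<le> L2_disc_norm (f i) + L2_disc_norm (\<lambda>z. \<Sum>i\<in>I. f i z)"
    using insert by (intro L2_norm_triangle L2_sum) auto
  with insert show ?case by simp
qed simp_all

lemma bounded_op_finite_rank:
  assumes v: "\<And>i. i < M \<Longrightarrow> v i \<in> bergman_space"
  shows "bounded_bergman_op (\<lambda>f z. \<Sum>i<M. bcoeff f i * v i z)"
proof -
  define L where "L = (\<Sum>i<M. real (i + 1) * L2_disc_norm (disc_power i) * L2_disc_norm (v i))"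
  have le: "L2_disc_norm (\<lambda>z. \<Sum>i<M. bcoeff f i * v i z) \<le> L * L2_disc_norm f" if f: "f \<in> bergman_space" for f
  proof -
    have "L2_disc_norm (\<lambda>z. \<Sum>i<M. bcoeff f i * v i z) \<le> (\<Sum>i<M. L2_disc_norm (\<lambda>z. bcoeff f i * v i z))"
      using v by (intro L2_norm_sum_le L2_cmult bergmanD(1)) auto
    also have "\<dots> \<le> (\<Sum>i<M. (real (i + 1) * L2_disc_norm (disc_power i) * L2_disc_norm f) * L2_disc_norm (v i))"
      unfolding L2_norm_cmult by (intro sum_mono mult_right_mono bcoeff_le bergmanD(1) f L2_norm_nonneg)
    also have "\<dots> = L * L2_disc_norm f" unfolding L_def sum_distrib_right by (intro sum.cong) (simp_all add: mult_ac)
    finally show ?thesis .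
  qed
  show ?thesis
    unfolding bounded_bergman_op_def
  proof (intro conjI ballI allI exI)
    fix f g assume "f \<in> bergman_space" "g \<in> bergman_space"
    then show "(\<lambda>z. \<Sum>i<M. bcoeff (\<lambda>z. f z + g z) i * v i z) =
      (\<lambda>z. (\<Sum>i<M. bcoeff f i * v i z) + (\<Sum>i<M. bcoeff g i * v i z))"
      by (simp add: bcoeff_add bergmanD(1) distrib_right sum.distrib)
  next
    fix c f
    show "(\<lambda>z. \<Sum>i<M. bcoeff (\<lambda>z. c * f z) i * v i z) = (\<lambda>z. c * (\<Sum>i<M. bcoeff f i * v i z))"
      by (simp add: bcoeff_cmult sum_distrib_left mult.assoc)
  next
    fix f assume f: "f \<in> bergman_space"
    show "(\<lambda>z. \<Sum>i<M. bcoeff f i * v i z) \<in> bergman_space"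
      using v by (intro bergman_sum bergman_cmult) auto
    show "L2_disc_norm (\<lambda>z. \<Sum>i<M. bcoeff f i * v i z) \<le> L * L2_disc_norm f" by (rule le[OF f])
  qed
qed

lemma bounded_op_id: "bounded_bergman_op (\<lambda>f. f)"
  using bounded_op_cmult[of 1] by simp

text \<open>
  The equation \<open>f + (\<Sum>i<M. bcoeff f i v\<^sub>i) = g\<close> determines \<open>f\<close> from its first \<open>M\<close> coefficients,
  and these solve a linear system with the matrix \<open>A\<close> below. A vector in the kernel of \<open>A\<close> gives an
  element of the kernel of the operator, so \<open>A\<close> has an inverse. It leads to an explicit inverse of the
  operator that is again the identity plus an operator of finite rank, hence bounded.
\<close>

lemma invertible_identity_plus_finite_rank:
  assumes v: "\<And>i. i < M \<Longrightarrow> v i \<in> bergman_space"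
    and inj: "\<And>f. f \<in> bergman_space \<Longrightarrow> (\<lambda>z. f z + (\<Sum>i<M. bcoeff f i * v i z)) = (\<lambda>z. 0) \<Longrightarrow> f = (\<lambda>z. 0)"
  shows "invertible_bergman_op (\<lambda>f z. f z + (\<Sum>i<M. bcoeff f i * v i z))"
proof -
  define V where "V = (\<lambda>f z. f z + (\<Sum>i<M. bcoeff f i * v i z))"
  have bV: "bounded_bergman_op V"
    unfolding V_def by (rule bounded_op_add[OF bounded_op_id bounded_op_finite_rank[OF v]])
  have vL: "i < M \<Longrightarrow> v i \<in> L2_disc" for i by (rule bergmanD(1)[OF v])
  have bsum: "bcoeff (\<lambda>z. \<Sum>j<M. c j * v j z) i = (\<Sum>j<M. c j * bcoeff (v j) i)" for c i
    by (subst bcoeff_sum) (auto intro!: L2_cmult vL simp: bcoeff_cmult)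
  have sumA: "(\<lambda>z. \<Sum>j<M. c j * v j z) \<in> bergman_space" for c
    by (intro bergman_sum bergman_cmult v) simp
  define A where "A i j = (if i = j then 1 else 0) + bcoeff (v j) i" for i j
  have A: "(\<Sum>j<M. A i j * c j) = c i + (\<Sum>j<M. c j * bcoeff (v j) i)" if "i < M" for c i
  proof -
    have "(\<Sum>j<M. A i j * c j) = (\<Sum>j<M. (if j = i then c j else 0) + c j * bcoeff (v j) i)"
      by (intro sum.cong) (auto simp: A_def algebra_simps)
    also have "\<dots> = c i + (\<Sum>j<M. c j * bcoeff (v j) i)"
      unfolding sum.distrib using that by simp
    finally show ?thesis .
  qed
  obtain D where D: "\<And>i k. i < M \<Longrightarrow> k < M \<Longrightarrow> (\<Sum>j<M. A i j * D k j) = (if i = k then 1 else 0)"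
  proof (rule linear_system_inverse[of M A])
    fix c j assume c: "\<And>i. i < M \<Longrightarrow> (\<Sum>j<M. A i j * c j) = 0" and j: "j < M"
    define x where "x = (\<lambda>z. \<Sum>j<M. c j * v j z)"
    have xc: "bcoeff x i = - c i" if "i < M" for i
      using c[OF that] unfolding A[OF that] x_def bsum by (simp add: eq_neg_iff_add_eq_0 add.commute)
    have "(\<lambda>z. x z + (\<Sum>i<M. bcoeff x i * v i z)) = (\<lambda>z. 0)"
      by (simp add: xc) (simp add: x_def sum_negf)
    then have "x = (\<lambda>z. 0)" by (rule inj[rotated]) (simp only: x_def sumA)
    then have "bcoeff x j = 0" by (simp add: bcoeff_def L2_inner_def)
    then show "c j = 0" using xc[OF j] by simp
  qed blast
  \<comment> \<open>the inverse: \<open>D\<close> recovers the coefficients of the solution from those of \<open>g\<close>\<close>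
  define W where "W g = (\<lambda>z. g z - (\<Sum>k<M. bcoeff g k * (\<Sum>j<M. D k j * v j z)))" for g
  have WA: "W g \<in> bergman_space" if "g \<in> bergman_space" for g
    unfolding W_def by (intro bergman_diff bergman_sum bergman_cmult sumA that)
  have VW: "V (W g) = g" if g: "g \<in> bergman_space" for g
  proof -
    \<comment> \<open>the first \<open>M\<close> coefficients of \<open>W g\<close>\<close>
    define d where "d j = (\<Sum>k<M. bcoeff g k * D k j)" for j
    have Wd: "W g = (\<lambda>z. g z - (\<Sum>j<M. d j * v j z))"
    proof
      fix z
      have "(\<Sum>k<M. bcoeff g k * (\<Sum>j<M. D k j * v j z)) = (\<Sum>k<M. \<Sum>j<M. bcoeff g k * D k j * v j z)"
        by (simp add: sum_distrib_left mult.assoc)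
      also have "\<dots> = (\<Sum>j<M. \<Sum>k<M. bcoeff g k * D k j * v j z)" by (rule sum.swap)
      also have "\<dots> = (\<Sum>j<M. d j * v j z)" by (simp add: d_def sum_distrib_right)
      finally show "W g z = g z - (\<Sum>j<M. d j * v j z)" by (simp add: W_def)
    qed
    have "bcoeff (W g) i = d i" if i: "i < M" for i
    proof -
      have "d i + (\<Sum>j<M. d j * bcoeff (v j) i) = (\<Sum>j<M. A i j * d j)" by (simp add: A[OF i])
      also have "\<dots> = (\<Sum>j<M. \<Sum>k<M. bcoeff g k * (A i j * D k j))"
        by (simp add: d_def sum_distrib_left mult_ac)
      also have "\<dots> = (\<Sum>k<M. bcoeff g k * (\<Sum>j<M. A i j * D k j))"
        by (subst sum.swap) (simp add: sum_distrib_left)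
      also have "\<dots> = (\<Sum>k<M. if i = k then bcoeff g k else 0)"
        using D[OF i] by (intro sum.cong) auto
      also have "\<dots> = bcoeff g i" using i by simp
      finally have "bcoeff g i - (\<Sum>j<M. d j * bcoeff (v j) i) = d i" by (simp add: algebra_simps)
      then show ?thesis
        unfolding Wd by (simp add: bcoeff_diff bergmanD(1) g sumA bsum)
    qed
    then have "V (W g) = (\<lambda>z. W g z + (\<Sum>i<M. d i * v i z))" by (simp add: V_def)
    then show ?thesis by (simp add: Wd)
  qed
  have bW: "bounded_bergman_op W"
  proof -
    have "bounded_bergman_op (\<lambda>g z. (\<Sum>k<M. bcoeff g k * (\<Sum>j<M. D k j * v j z)))"
      by (rule bounded_op_finite_rank[OF sumA])
    from bounded_op_compose[OF bounded_op_cmult[of "-1"] this]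
    have "bounded_bergman_op (\<lambda>f z. f z + (- 1) * (\<Sum>k<M. bcoeff f k * (\<Sum>j<M. D k j * v j z)))"
      by (rule bounded_op_add[OF bounded_op_id])
    then show ?thesis unfolding W_def by simp
  qed
  have WV: "W (V f) = f" if f: "f \<in> bergman_space" for f
  proof -
    have Vf: "V f \<in> bergman_space" by (rule bounded_opD(1)[OF bV f])
    have "V (\<lambda>z. W (V f) z - f z) = (\<lambda>z. 0)"
      by (simp add: bounded_op_diff[OF bV WA[OF Vf] f] VW[OF Vf])
    then have "(\<lambda>z. W (V f) z - f z) = (\<lambda>z. 0)"
      unfolding V_def by (rule inj[OF bergman_diff[OF WA[OF Vf[unfolded V_def]] f]])
    then show ?thesis by (simp add: fun_eq_iff)
  qed
  have "invertible_bergman_op V"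
    unfolding invertible_bergman_op_def using bV bW VW WV by blast
  then show ?thesis by (simp add: V_def)
qed

section \<open>Symbols that vanish on the circle\<close>

lemma bergman_shift:
  assumes f: "f \<in> bergman_space"
  shows "(\<lambda>z. z * f z) \<in> bergman_space"
    and "bcoeff (\<lambda>z. z * f z) n = (case n of 0 \<Rightarrow> 0 | Suc k \<Rightarrow> bcoeff f k)"
proof -
  define c where "c n = (case n of 0 \<Rightarrow> 0 | Suc k \<Rightarrow> bcoeff f k)" for n
  have bd: "(\<Sum>n<M. (norm (c n))\<^sup>2 / real (n + 1)) \<le> (L2_disc_norm f)\<^sup>2" for M
  proof -
    have "(\<Sum>n<M. (norm (c n))\<^sup>2 / real (n + 1)) \<le> (\<Sum>n<Suc M. (norm (c n))\<^sup>2 / real (n + 1))"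
      by (intro sum_mono2) auto
    also have "\<dots> = (\<Sum>n<M. (norm (bcoeff f n))\<^sup>2 / real (Suc n + 1))"
      by (subst sum.lessThan_Suc_shift) (simp add: c_def)
    also have "\<dots> \<le> (\<Sum>n<M. (norm (bcoeff f n))\<^sup>2 / real (n + 1))"
      by (intro sum_mono divide_left_mono) auto
    also have "\<dots> \<le> (L2_disc_norm f)\<^sup>2" by (rule L2_Bessel[OF bergmanD(1)[OF f]])
    finally show ?thesis .
  qed
  have eq: "(\<lambda>z. z * f z) = disc_series c"
  proof
    fix z :: complex
    show "z * f z = disc_series c z"
    proof (cases "norm z < 1")
      case True
      have "(\<lambda>n. z * (bcoeff f n * z ^ n)) sums (z * f z)"
        by (intro sums_mult bergman_sums f True)
      then have "(\<lambda>n. c (Suc n) * z ^ Suc n) sums (z * f z)"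
        by (simp add: c_def mult_ac)
      then have "(\<lambda>n. c n * z ^ n) sums (z * f z)"
        by (subst (asm) sums_Suc_iff) (simp add: c_def)
      with disc_series_sums[OF bd True] show ?thesis by (rule sums_unique2[rotated])
    qed (simp add: bergmanD(3)[OF f] disc_series_def)
  qed
  show "(\<lambda>z. z * f z) \<in> bergman_space"
    unfolding eq by (rule disc_series_bergman[OF bd])
  show "bcoeff (\<lambda>z. z * f z) n = (case n of 0 \<Rightarrow> 0 | Suc k \<Rightarrow> bcoeff f k)"
    unfolding eq bcoeff_disc_series[OF bd] by (simp add: c_def)
qed

text \<open>
  The left-hand side is the integral of \<open>(1 - |z|\<^sup>2) |f|\<^sup>2\<close>. Multiplication by \<open>z\<close> shifts the
  coefficients, so this integral weighs \<open>|bcoeff f n|\<^sup>2\<close> with \<open>1 / (n + 1) - 1 / (n + 2)\<close>, which is smaller by the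
  factor \<open>n + 2\<close> than the weight in the norm of \<open>f\<close>.
\<close>

lemma bergman_boundary_weight:
  assumes f: "f \<in> bergman_space" and low: "\<And>n. n < M \<Longrightarrow> bcoeff f n = 0"
  shows "(L2_disc_norm f)\<^sup>2 - (L2_disc_norm (\<lambda>z. z * f z))\<^sup>2 \<le> (L2_disc_norm f)\<^sup>2 / real (M + 1)"
proof -
  note p = bergman_parseval[OF f]
  define t where "t n = (norm (bcoeff (\<lambda>z. z * f z) n))\<^sup>2 / real (n + 1)" for n
  have t: "t 0 = 0" "t (Suc n) = (norm (bcoeff f n))\<^sup>2 / real (Suc n + 1)" for n
    by (simp_all add: t_def bergman_shift(2)[OF f])
  have "t sums (L2_disc_norm (\<lambda>z. z * f z))\<^sup>2"
    unfolding t_def by (rule bergman_parseval[OF bergman_shift(1)[OF f]])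
  then have "(\<lambda>n. t (Suc n)) sums (L2_disc_norm (\<lambda>z. z * f z))\<^sup>2"
    unfolding sums_Suc_iff by (simp add: t(1))
  then have "(\<lambda>n. (norm (bcoeff f n))\<^sup>2 / real (Suc n + 1)) sums (L2_disc_norm (\<lambda>z. z * f z))\<^sup>2"
    by (simp only: t(2))
  from sums_diff[OF p this]
  have d: "(\<lambda>n. (norm (bcoeff f n))\<^sup>2 / real (n + 1) - (norm (bcoeff f n))\<^sup>2 / real (Suc n + 1)) sums
    ((L2_disc_norm f)\<^sup>2 - (L2_disc_norm (\<lambda>z. z * f z))\<^sup>2)" .
  have e: "(\<lambda>n. ((norm (bcoeff f n))\<^sup>2 / real (n + 1)) / real (M + 1)) sums ((L2_disc_norm f)\<^sup>2 / real (M + 1))"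
    by (rule sums_divide[OF p])
  show ?thesis
  proof (rule sums_le[OF _ d e])
    fix n
    show "(norm (bcoeff f n))\<^sup>2 / real (n + 1) - (norm (bcoeff f n))\<^sup>2 / real (Suc n + 1)
        \<le> ((norm (bcoeff f n))\<^sup>2 / real (n + 1)) / real (M + 1)"
    proof (cases "n < M")
      case False
      have "(norm (bcoeff f n))\<^sup>2 / real (n + 1) - (norm (bcoeff f n))\<^sup>2 / real (Suc n + 1)
          = ((norm (bcoeff f n))\<^sup>2 / real (n + 1)) / real (Suc n + 1)"
        by (simp add: divide_simps) (simp add: algebra_simps)
      also have "\<dots> \<le> ((norm (bcoeff f n))\<^sup>2 / real (n + 1)) / real (M + 1)"
        using False by (intro divide_left_mono) auto
      finally show ?thesis .
    qed (simp add: low)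
  qed
qed

text \<open>
  The points of the closed disc with \<open>|\<psi>|\<^sup>2 \<ge> e\<close> form a compact set that avoids the circle, so
  \<open>1 - |z|\<^sup>2\<close> has a positive minimum on it.
\<close>

lemma vanishing_symbol_bound:
  fixes \<psi> :: "complex \<Rightarrow> complex"
  assumes c: "continuous_on UNIV \<psi>" and b: "\<And>z. norm z = 1 \<Longrightarrow> \<psi> z = 0" and e: "e > 0"
  obtains C where "C \<ge> 0" "\<And>z. norm z < 1 \<Longrightarrow> (norm (\<psi> z))\<^sup>2 \<le> e + C * (1 - (norm z)\<^sup>2)"
proof -
  define S where "S = cball 0 1 \<inter> {z. e \<le> (norm (\<psi> z))\<^sup>2}"
  have cS: "compact S"
    unfolding S_def
    by (intro compact_Int_closed closed_Collect_le continuous_intros c) simp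
  have "bounded (\<psi> ` cball 0 1)"
    by (intro compact_imp_bounded compact_continuous_image continuous_on_subset[OF c]) auto
  then obtain B where B: "\<And>z. norm z \<le> 1 \<Longrightarrow> norm (\<psi> z) \<le> B" by (force simp: bounded_iff)
  show ?thesis
  proof (cases "S = {}")
    case True
    have "(norm (\<psi> z))\<^sup>2 \<le> e + 0 * (1 - (norm z)\<^sup>2)" if "norm z < 1" for z
    proof -
      have "z \<notin> S" using True by simp
      then show ?thesis using that by (simp add: S_def)
    qed
    then show ?thesis by (intro that[of 0]) simp_all
  next
    case False
    have "continuous_on S (\<lambda>z. 1 - (norm z)\<^sup>2)" by (intro continuous_intros)
    from continuous_attains_inf[OF cS False this] obtain w where
      w: "w \<in> S" "\<And>z. z \<in> S \<Longrightarrow> 1 - (norm w)\<^sup>2 \<le> 1 - (norm z)\<^sup>2" by blast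
    define d where "d = 1 - (norm w)\<^sup>2"
    have "norm w \<noteq> 1" using w(1) b e by (auto simp: S_def)
    then have "norm w < 1" using w(1) by (simp add: S_def)
    then have d: "d > 0" by (simp add: d_def abs_square_less_1)
    show ?thesis
    proof (rule that[of "B\<^sup>2 / d"])
      fix z :: complex assume z: "norm z < 1"
      then have pos: "1 - (norm z)\<^sup>2 > 0" by (simp add: abs_square_less_1)
      show "(norm (\<psi> z))\<^sup>2 \<le> e + B\<^sup>2 / d * (1 - (norm z)\<^sup>2)"
      proof (cases "z \<in> S")
        case True
        have "(norm (\<psi> z))\<^sup>2 \<le> B\<^sup>2" using B z by (intro power_mono) auto
        also have "\<dots> = B\<^sup>2 / d * d" using d by simp
        also have "\<dots> \<le> B\<^sup>2 / d * (1 - (norm z)\<^sup>2)"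
          using w(2)[OF True] d unfolding d_def by (intro mult_left_mono) auto
        finally show ?thesis using e by simp
      next
        case F: False
        then have "(norm (\<psi> z))\<^sup>2 \<le> e" using z by (simp add: S_def)
        also have "\<dots> \<le> e + B\<^sup>2 / d * (1 - (norm z)\<^sup>2)" using pos d by simp
        finally show ?thesis .
      qed
    qed (use d in simp)
  qed
qed

text \<open>
  Compactness of the Toeplitz operator with the symbol \<open>\<psi>\<close>, in quantitative form: the
  multiplication by \<open>\<psi>\<close>, and so the operator, is small on a subspace of finite codimension.
\<close>

lemma vanishing_symbol_tail:
  assumes c: "continuous_on UNIV \<psi>" and b: "\<And>z. norm z = 1 \<Longrightarrow> \<psi> z = 0" and e: "e > 0"
  obtains M where "\<And>f. f \<in> bergman_space \<Longrightarrow> (\<And>n. n < M \<Longrightarrow> bcoeff f n = 0) \<Longrightarrow>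
    L2_disc_norm (\<lambda>z. \<psi> z * f z) \<le> e * L2_disc_norm f"
proof -
  obtain C where C: "C \<ge> 0" "\<And>z. norm z < 1 \<Longrightarrow> (norm (\<psi> z))\<^sup>2 \<le> e\<^sup>2 / 2 + C * (1 - (norm z)\<^sup>2)"
    using vanishing_symbol_bound[OF c b, of "e\<^sup>2 / 2"] e by auto
  obtain M :: nat where M: "C / (e\<^sup>2 / 2) < real M" using reals_Archimedean2 by blast
  have CM: "C / real (M + 1) \<le> e\<^sup>2 / 2"
  proof -
    have "C \<le> e\<^sup>2 / 2 * real M" using M e by (simp add: field_simps)
    also have "\<dots> \<le> e\<^sup>2 / 2 * real (M + 1)" by (intro mult_left_mono) auto
    finally show ?thesis by (simp add: pos_divide_le_eq)
  qed
  show ?thesis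
  proof (rule that[of M])
    fix f assume f: "f \<in> bergman_space" and low: "\<And>n. n < M \<Longrightarrow> bcoeff f n = 0"
    let ?g = "\<lambda>z. e\<^sup>2 / 2 * (norm (f z))\<^sup>2 + C * ((norm (f z))\<^sup>2 - (norm (z * f z))\<^sup>2)"
    have i1: "integrable disc_measure (\<lambda>z. (norm (f z))\<^sup>2)" by (rule L2_discD(2)[OF bergmanD(1)[OF f]])
    have i2: "integrable disc_measure (\<lambda>z. (norm (z * f z))\<^sup>2)"
      by (rule L2_discD(2)[OF bergmanD(1)[OF bergman_shift(1)[OF f]]])
    have i3: "integrable disc_measure (\<lambda>z. (norm (\<psi> z * f z))\<^sup>2)"
      by (rule L2_discD(2)[OF bounded_symbol_L2[OF bounded_symbol_continuous[OF c] bergmanD(1)[OF f]]])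
    have "(L2_disc_norm (\<lambda>z. \<psi> z * f z))\<^sup>2 \<le> (LINT z|disc_measure. ?g z)"
      unfolding L2_norm_square
    proof (rule integral_mono_AE[OF i3])
      show "integrable disc_measure ?g" using i1 i2 by simp
      show "AE z in disc_measure. (norm (\<psi> z * f z))\<^sup>2 \<le> ?g z"
        using AE_disc
      proof eventually_elim
        case (elim z)
        then have "(norm (\<psi> z))\<^sup>2 * (norm (f z))\<^sup>2 \<le> (e\<^sup>2 / 2 + C * (1 - (norm z)\<^sup>2)) * (norm (f z))\<^sup>2"
          by (intro mult_right_mono C(2)) auto
        then show ?case by (simp add: norm_mult power_mult_distrib algebra_simps)
      qed
    qed
    also have "\<dots> = e\<^sup>2 / 2 * (L2_disc_norm f)\<^sup>2 + C * ((L2_disc_norm f)\<^sup>2 - (L2_disc_norm (\<lambda>z. z * f z))\<^sup>2)"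
      unfolding L2_norm_square using i1 i2 by simp
    also have "\<dots> \<le> e\<^sup>2 / 2 * (L2_disc_norm f)\<^sup>2 + C * ((L2_disc_norm f)\<^sup>2 / real (M + 1))"
      using bergman_boundary_weight[OF f low] C(1) by (intro add_left_mono mult_left_mono) auto
    also have "\<dots> = (e\<^sup>2 / 2 + C / real (M + 1)) * (L2_disc_norm f)\<^sup>2" by (simp add: distrib_right)
    also have "\<dots> \<le> (e\<^sup>2 / 2 + e\<^sup>2 / 2) * (L2_disc_norm f)\<^sup>2"
      by (intro mult_right_mono add_left_mono CM) simp
    also have "\<dots> = (e * L2_disc_norm f)\<^sup>2" by (simp add: power_mult_distrib)
    finally show "L2_disc_norm (\<lambda>z. \<psi> z * f z) \<le> e * L2_disc_norm f"
      by (rule power2_le_imp_le) (use e in simp)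
  qed
qed

text \<open>
  The Fredholm alternative. Split \<open>f\<close> into its Taylor polynomial of degree below \<open>M\<close> and the
  remainder \<open>Q f\<close>. On the remainder the second operator is a small perturbation \<open>R\<close>, so \<open>S = T + R\<close> is
  invertible; the whole sum factors as \<open>S V\<close> with \<open>V\<close> the identity plus an operator of finite rank,
  for which injectivity implies invertibility.
\<close>

lemma invertible_op_plus_vanishing_toeplitz:
  assumes T: "invertible_bergman_op T"
    and c: "continuous_on UNIV \<psi>" and b: "\<And>z. norm z = 1 \<Longrightarrow> \<psi> z = 0"
    and inj: "\<And>f. f \<in> bergman_space \<Longrightarrow> (\<lambda>z. T f z + toeplitz \<psi> f z) = (\<lambda>z. 0) \<Longrightarrow> f = (\<lambda>z. 0)"
  shows "invertible_bergman_op (\<lambda>f z. T f z + toeplitz \<psi> f z)"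
proof -
  note sym = bounded_symbol_continuous[OF c]
  note bt = bounded_bergman_op_toeplitz[OF sym]
  obtain C where C: "C > 0" "\<And>f. f \<in> bergman_space \<Longrightarrow> L2_disc_norm f \<le> C * L2_disc_norm (T f)"
    using invertible_op_bounded_below[OF T] by metis
  \<comment> \<open>small enough to perturb \<open>T\<close> and keep it invertible\<close>
  define e where "e = 1 / (2 * C)"
  have e: "e > 0" "C * e < 1" using C(1) by (auto simp: e_def)
  obtain M where M: "\<And>f. f \<in> bergman_space \<Longrightarrow> (\<And>n. n < M \<Longrightarrow> bcoeff f n = 0) \<Longrightarrow>
    L2_disc_norm (\<lambda>z. \<psi> z * f z) \<le> e * L2_disc_norm f"
    using vanishing_symbol_tail[OF c b e(1)] by metis
  define Q where "Q = (\<lambda>f z. f z - disc_poly (bcoeff f) M z)"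
  have bQ: "bounded_bergman_op Q"
  proof -
    have "bounded_bergman_op (\<lambda>f z. \<Sum>i<M. bcoeff f i * disc_power i z)"
      by (rule bounded_op_finite_rank) simp
    from bounded_op_compose[OF bounded_op_cmult[of "-1"] this]
    have "bounded_bergman_op (\<lambda>f z. f z + (- 1) * (\<Sum>i<M. bcoeff f i * disc_power i z))"
      by (rule bounded_op_add[OF bounded_op_id])
    then show ?thesis unfolding Q_def disc_poly_def by simp
  qed
  define R where "R = (\<lambda>f. toeplitz \<psi> (Q f))"
  have bR: "bounded_bergman_op R" unfolding R_def by (rule bounded_op_compose[OF bt bQ])
  have QA: "Q f \<in> bergman_space" if "f \<in> bergman_space" for f by (rule bounded_opD(1)[OF bQ that])
  have R: "L2_disc_norm (R f) \<le> e * L2_disc_norm f" if f: "f \<in> bergman_space" for f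
  proof -
    have "bcoeff (Q f) n = 0" if "n < M" for n
      unfolding Q_def using that f
      by (subst bcoeff_diff) (simp_all add: bergmanD(1) disc_poly_bergman, simp add: disc_poly_def [abs_def] bcoeff_disc_power_sum)
    then have "L2_disc_norm (\<lambda>z. \<psi> z * Q f z) \<le> e * L2_disc_norm (Q f)" by (rule M[OF QA[OF f]])
    moreover have "L2_disc_norm (R f) \<le> L2_disc_norm (\<lambda>z. \<psi> z * Q f z)"
      unfolding R_def by (rule toeplitz_norm_le_mult[OF sym QA[OF f]])
    moreover have "L2_disc_norm (Q f) \<le> L2_disc_norm f"
    proof (rule power2_le_imp_le)
      show "(L2_disc_norm (Q f))\<^sup>2 \<le> (L2_disc_norm f)\<^sup>2"
        unfolding Q_def L2_best_approximation[OF bergmanD(1)[OF f]] by (simp add: sum_nonneg)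
    qed simp
    then have "e * L2_disc_norm (Q f) \<le> e * L2_disc_norm f" using e(1) by simp
    ultimately show ?thesis by linarith
  qed
  define S where "S = (\<lambda>f z. T f z + R f z)"
  have iS: "invertible_bergman_op S"
    unfolding S_def by (rule invertible_op_perturbation[OF T bR C R e(2)])
  note bS = invertible_op_bounded[OF iS]
  have "\<forall>i. \<exists>v\<in>bergman_space. S v = toeplitz \<psi> (disc_power i)"
    using invertible_op_onto[OF iS toeplitz_bergman[OF sym disc_power_bergman]] by blast
  then obtain v where v: "\<And>i. v i \<in> bergman_space" "\<And>i. S (v i) = toeplitz \<psi> (disc_power i)" by metis
  define V where "V = (\<lambda>f z. f z + (\<Sum>i<M. bcoeff f i * v i z))"
  have factor: "S (V f) = (\<lambda>z. T f z + toeplitz \<psi> f z)" if f: "f \<in> bergman_space" for f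
  proof -
    have "S (V f) = (\<lambda>z. S f z + S (\<lambda>z. \<Sum>i<M. bcoeff f i * v i z) z)"
      unfolding V_def by (intro bounded_opD(2)[OF bS f] bergman_sum bergman_cmult v)
    also have "S (\<lambda>z. \<Sum>i<M. bcoeff f i * v i z) = (\<lambda>z. \<Sum>i<M. bcoeff f i * toeplitz \<psi> (disc_power i) z)"
      by (simp add: bounded_op_sum[OF bS v(1)] v(2))
    also have "\<dots> = toeplitz \<psi> (disc_poly (bcoeff f) M)"
      unfolding disc_poly_def [abs_def] by (simp add: bounded_op_sum[OF bt])
    also have "(\<lambda>z. S f z + toeplitz \<psi> (disc_poly (bcoeff f) M) z) = (\<lambda>z. T f z + toeplitz \<psi> f z)"
      unfolding S_def R_def Q_def by (simp add: bounded_op_diff[OF bt f disc_poly_bergman])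
    finally show ?thesis .
  qed
  have "invertible_bergman_op V"
    unfolding V_def
  proof (rule invertible_identity_plus_finite_rank[OF v(1)])
    fix f assume f: "f \<in> bergman_space" and "(\<lambda>z. f z + (\<Sum>i<M. bcoeff f i * v i z)) = (\<lambda>z. 0)"
    then have "V f = (\<lambda>z. 0)" by (simp add: V_def)
    then have "(\<lambda>z. T f z + toeplitz \<psi> f z) = (\<lambda>z. 0)"
      using factor[OF f] bounded_op_zero[OF bS] by simp
    then show "f = (\<lambda>z. 0)" by (rule inj[OF f])
  qed
  then have "invertible_bergman_op (\<lambda>f. S (V f))" by (rule invertible_op_compose[OF iS])
  then show ?thesis using invertible_op_cong[of "\<lambda>f. S (V f)", OF factor] by simp
qed

section \<open>Analytic and conjugate analytic factors\<close>

lemma toeplitz_one: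
  assumes f: "f \<in> bergman_space"
  shows "toeplitz (\<lambda>z. 1) f = f"
  using toeplitz_analytic(2)[of "\<lambda>z. 1" f] f bounded_symbol_continuous[of "\<lambda>z. 1"] by simp

lemma bounded_symbol_inverse:
  assumes c: "continuous_on UNIV h" and nz: "\<And>z. norm z \<le> 1 \<Longrightarrow> h z \<noteq> 0"
  shows "bounded_symbol (\<lambda>z. inverse (h z))"
proof -
  have "bounded ((\<lambda>z. inverse (h z)) ` cball 0 1)"
    using nz
    by (intro compact_imp_bounded compact_continuous_image continuous_intros continuous_on_subset[OF c]) auto
  then obtain B where B: "\<And>z. norm z \<le> 1 \<Longrightarrow> norm (inverse (h z)) \<le> B" by (force simp: bounded_iff)
  have "(\<lambda>z. inverse (h z)) \<in> borel_measurable borel"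
    by (rule borel_measurable_inverse[OF borel_measurable_continuous_onI[OF c]])
  then show ?thesis unfolding bounded_symbol_def using B less_imp_le by blast
qed

lemma bounded_symbol_cnj:
  assumes "bounded_symbol h"
  shows "bounded_symbol (\<lambda>z. cnj (h z))"
proof -
  have "(cnj :: complex \<Rightarrow> complex) \<in> borel_measurable borel"
    by (intro borel_measurable_continuous_onI continuous_intros)
  from measurable_compose[OF _ this] assms show ?thesis by (auto simp: bounded_symbol_def)
qed

text \<open>
  \<open>T\<^sub>\<theta>\<close> has norm at most \<open>r < 1\<close>, so the identity plus \<open>T\<^sub>\<theta>\<close> is a small perturbation of the identity.
\<close>

lemma invertible_toeplitz_near_one:
  assumes b: "bounded_symbol \<theta>" and r: "\<And>z. norm z < 1 \<Longrightarrow> norm (\<theta> z) \<le> r" "r < 1"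
  shows "invertible_bergman_op (toeplitz (\<lambda>z. 1 + \<theta> z))"
proof -
  have id: "invertible_bergman_op (\<lambda>f. f)"
    unfolding invertible_bergman_op_def using bounded_op_id by blast
  have "invertible_bergman_op (\<lambda>f z. f z + toeplitz \<theta> f z)"
    by (rule invertible_op_perturbation[OF id bounded_bergman_op_toeplitz[OF b], where C = 1 and e = r])
      (use r toeplitz_norm_le[OF b] in auto)
  moreover have "toeplitz (\<lambda>z. 1 + \<theta> z) f = (\<lambda>z. f z + toeplitz \<theta> f z)" if f: "f \<in> bergman_space" for f
    using toeplitz_add[OF bounded_symbol_continuous[of "\<lambda>z. 1"] b f] by (simp add: toeplitz_one[OF f])
  ultimately show ?thesis by (simp cong: invertible_op_cong)
qed

context
  fixes h :: "complex \<Rightarrow> complex"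
  assumes c: "continuous_on UNIV h" and hol: "h holomorphic_on ball 0 1"
    and nz: "\<And>z. norm z \<le> 1 \<Longrightarrow> h z \<noteq> 0"
begin

lemma bounded_symbol_reciprocal: "bounded_symbol (\<lambda>z. inverse (h z))"
  by (rule bounded_symbol_inverse[OF c]) (rule nz)

text \<open>
  The operator is the multiplication by \<open>h\<close>; its inverse is the multiplication by \<open>1 / h\<close>.
\<close>

lemma invertible_toeplitz_analytic: "invertible_bergman_op (toeplitz h)"
proof -
  have inv: "(\<lambda>z. inverse (h z)) holomorphic_on ball 0 1"
    using nz by (intro holomorphic_intros hol) auto
  note a1 = toeplitz_analytic[OF bounded_symbol_continuous[OF c] hol]
  note a2 = toeplitz_analytic[OF bounded_symbol_reciprocal inv]
  have "toeplitz (\<lambda>z. inverse (h z)) (toeplitz h f) = f \<and> toeplitz h (toeplitz (\<lambda>z. inverse (h z)) f) = f"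
    if f: "f \<in> bergman_space" for f
  proof -
    have "inverse (h z) * (h z * f z) = f z" "h z * (inverse (h z) * f z) = f z" for z
      using nz[of z] bergmanD(3)[OF f, of z] by (cases "norm z < 1"; simp)+
    then have e: "(\<lambda>z. inverse (h z) * (h z * f z)) = f" "(\<lambda>z. h z * (inverse (h z) * f z)) = f"
      by (simp_all only:)
    show ?thesis unfolding a1(2)[OF f] a2(2)[OF f] a1(2)[OF a2(1)[OF f]] a2(2)[OF a1(1)[OF f]] e by simp
  qed
  then show ?thesis
    unfolding invertible_bergman_op_def
    using bounded_bergman_op_toeplitz[OF bounded_symbol_continuous[OF c]]
      bounded_bergman_op_toeplitz[OF bounded_symbol_reciprocal] by blast
qed

text \<open>
  By the rule for conjugate factors on the left, the inverse has the symbol \<open>1 / cnj h\<close>.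
\<close>

lemma invertible_toeplitz_coanalytic: "invertible_bergman_op (toeplitz (\<lambda>z. cnj (h z)))"
proof -
  have inv: "(\<lambda>z. inverse (h z)) holomorphic_on ball 0 1"
    using nz by (intro holomorphic_intros hol) auto
  note b1 = bounded_symbol_cnj[OF bounded_symbol_continuous[OF c]]
  note b2 = bounded_symbol_cnj[OF bounded_symbol_reciprocal]
  have "toeplitz (\<lambda>z. cnj (inverse (h z))) (toeplitz (\<lambda>z. cnj (h z)) f) = f \<and>
    toeplitz (\<lambda>z. cnj (h z)) (toeplitz (\<lambda>z. cnj (inverse (h z))) f) = f" if f: "f \<in> bergman_space" for f
  proof -
    have "toeplitz (\<lambda>z. cnj (inverse (h z)) * cnj (h z)) f = toeplitz (\<lambda>z. 1) f"
      "toeplitz (\<lambda>z. cnj (h z) * cnj (inverse (h z))) f = toeplitz (\<lambda>z. 1) f"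
      using nz by (auto intro!: toeplitz_cong[OF f])
    then show ?thesis
      unfolding toeplitz_coanalytic_left[OF b1 hol b2 f] toeplitz_coanalytic_left[OF b2 inv b1 f]
      by (simp add: toeplitz_one[OF f])
  qed
  then show ?thesis
    unfolding invertible_bergman_op_def
    using bounded_bergman_op_toeplitz[OF b1] bounded_bergman_op_toeplitz[OF b2] by blast
qed

end

section \<open>Symbols with a zero inside the disc\<close>

context
  fixes w :: complex and n m :: nat
  assumes w: "norm w < 1" "w \<noteq> 0"
begin

lemma coanalytic_factor_nonzero:
  assumes "norm z \<le> 1"
  shows "(z - inverse (cnj w)) ^ m \<noteq> 0"
proof
  assume "(z - inverse (cnj w)) ^ m = 0"
  then have "z = inverse (cnj w)" by simp
  then have "norm z = inverse (norm w)" by (simp add: norm_inverse)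
  moreover have "inverse (norm w) > 1" using w by (simp add: one_less_inverse)
  ultimately show False using assms by simp
qed

text \<open>
  With \<open>q(z) = (z - 1 / cnj w)\<^sup>m\<close> the symbol is \<open>cnj q (1 + \<theta>)\<close>. The zero of \<open>q\<close> lies outside the
  closed disc, and \<open>|\<theta>| \<le> |a| |w|\<^sup>m\<close> because the disc automorphism \<open>(z - w) / (1 - cnj w z)\<close> is bounded
  by 1.
\<close>

lemma invertible_toeplitz_dominated:
  assumes a: "norm a * norm w ^ m < 1"
  shows "invertible_bergman_op (toeplitz (\<lambda>z. a * z ^ n * (z - w) ^ m + (cnj z - inverse w) ^ m))"
proof -
  define q where "q z = (z - inverse (cnj w)) ^ m" for z
  have qc: "continuous_on UNIV q" unfolding q_def by (intro continuous_intros)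
  have qh: "q holomorphic_on ball 0 1" unfolding q_def by (intro holomorphic_intros)
  have qnz: "q z \<noteq> 0" if "norm z \<le> 1" for z unfolding q_def by (rule coanalytic_factor_nonzero[OF that])
  have cq: "cnj (q z) = (cnj z - inverse w) ^ m" for z by (simp add: q_def)
  define \<theta> where "\<theta> z = (a * z ^ n * (z - w) ^ m) * cnj (inverse (q z))" for z
  have b\<theta>: "bounded_symbol \<theta>"
    unfolding \<theta>_def
    by (intro bounded_symbol_mult bounded_symbol_cnj bounded_symbol_inverse[OF qc qnz]
        bounded_symbol_continuous continuous_intros)
  have le: "norm (\<theta> z) \<le> norm a * norm w ^ m" if z: "norm z < 1" for z
  proof -
    have "norm (z - w) \<le> norm w * norm (cnj z - inverse w)"
    proof -
      have "norm (Moebius_function 0 w z) < 1"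
        by (rule Moebius_function_norm_lt_1[OF w(1) z])
      moreover have "1 - cnj w * z \<noteq> 0"
      proof
        assume "1 - cnj w * z = 0"
        then have "norm (cnj w * z) = 1" by (metis eq_iff_diff_eq_0 norm_one)
        moreover have "norm w * norm z < 1 * 1" using w z by (intro mult_strict_mono) auto
        ultimately show False by (simp add: norm_mult)
      qed
      ultimately have "norm (z - w) \<le> norm (1 - cnj w * z)"
        by (simp add: Moebius_function_def norm_divide norm_mult divide_simps split: if_splits)
      also have "1 - cnj w * z = cnj (- w * (cnj z - inverse w))"
        using w(2) by (simp add: algebra_simps)
      also have "norm \<dots> = norm w * norm (cnj z - inverse w)"
        by (simp only: complex_mod_cnj norm_mult norm_minus_cancel)
      finally show ?thesis .
    qed
    then have "norm (z - w) ^ m \<le> (norm w * norm (cnj z - inverse w)) ^ m" by (intro power_mono) auto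
    also have "\<dots> = norm w ^ m * norm (cnj (q z))" by (simp add: cq power_mult_distrib norm_power)
    finally have 1: "norm ((z - w) ^ m) \<le> norm w ^ m * norm (cnj (q z))" by (simp add: norm_power)
    have "norm (\<theta> z) = norm a * norm z ^ n * (norm ((z - w) ^ m) / norm (cnj (q z)))"
      by (simp add: \<theta>_def norm_mult norm_power norm_inverse divide_inverse)
    also have "\<dots> \<le> norm a * 1 * norm w ^ m"
      using 1 z qnz[of z]
      by (intro mult_mono power_le_one) (auto simp: pos_divide_le_eq)
    finally show ?thesis by simp
  qed
  have inv: "invertible_bergman_op (\<lambda>f. toeplitz (\<lambda>z. cnj (q z)) (toeplitz (\<lambda>z. 1 + \<theta> z) f))"
    by (rule invertible_op_compose[OF invertible_toeplitz_coanalytic[OF qc qh qnz] invertible_toeplitz_near_one[OF b\<theta> le a]])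
  have "toeplitz (\<lambda>z. a * z ^ n * (z - w) ^ m + (cnj z - inverse w) ^ m) f =
    toeplitz (\<lambda>z. cnj (q z)) (toeplitz (\<lambda>z. 1 + \<theta> z) f)" if f: "f \<in> bergman_space" for f
  proof -
    have bs: "bounded_symbol (\<lambda>z. 1 + \<theta> z)"
      by (intro bounded_symbol_add b\<theta> bounded_symbol_continuous continuous_intros)
    have "toeplitz (\<lambda>z. cnj (q z)) (toeplitz (\<lambda>z. 1 + \<theta> z) f) = toeplitz (\<lambda>z. cnj (q z) * (1 + \<theta> z)) f"
      by (rule toeplitz_coanalytic_left[OF bounded_symbol_cnj[OF bounded_symbol_continuous[OF qc]] qh bs f])
    also have "\<dots> = toeplitz (\<lambda>z. a * z ^ n * (z - w) ^ m + (cnj z - inverse w) ^ m) f"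
    proof (rule toeplitz_cong[OF f])
      fix z :: complex assume "norm z < 1"
      then have "cnj (q z) * cnj (inverse (q z)) = 1"
        using qnz[of z] by simp
      then have "cnj (q z) * \<theta> z = a * z ^ n * (z - w) ^ m"
        unfolding \<theta>_def by (metis mult.left_commute mult.right_neutral)
      then show "cnj (q z) * (1 + \<theta> z) = a * z ^ n * (z - w) ^ m + (cnj z - inverse w) ^ m"
        by (simp add: distrib_left cq)
    qed
    finally show ?thesis by simp
  qed
  then show ?thesis using inv by (simp cong: invertible_op_cong)
qed

text \<open>
  On the circle \<open>cnj z = 1 / z\<close>, so the symbol \<open>\<phi>\<close> agrees there with
  \<open>\<xi>(z) = (a + b cnj z\<^sup>n\<^sup>+\<^sup>m) z\<^sup>n (z - w)\<^sup>m\<close>, where \<open>b = (-1 / w)\<^sup>m\<close>. As \<open>|b| < |a|\<close>, the first factor is the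
  conjugate of a zero-free analytic function, and \<open>T\<^sub>\<xi>\<close> is an invertible operator after the multiplication
  by \<open>z\<^sup>n (z - w)\<^sup>m\<close>. It is therefore injective, but not onto, since the multiples vanish at \<open>w\<close>. If \<open>T\<^sub>\<phi>\<close>
  were invertible, the Fredholm alternative would make \<open>T\<^sub>\<xi>\<close> invertible. (The index of \<open>T\<^sub>\<phi>\<close> is
  \<open>-(n + m)\<close>.)
\<close>

lemma not_invertible_toeplitz_winding:
  assumes a: "norm a * norm w ^ m > 1" and m: "m \<ge> 1"
  shows "\<not> invertible_bergman_op (toeplitz (\<lambda>z. a * z ^ n * (z - w) ^ m + (cnj z - inverse w) ^ m))"
proof
  define \<phi> where "\<phi> z = a * z ^ n * (z - w) ^ m + (cnj z - inverse w) ^ m" for z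
  assume "invertible_bergman_op (toeplitz (\<lambda>z. a * z ^ n * (z - w) ^ m + (cnj z - inverse w) ^ m))"
  then have inv: "invertible_bergman_op (toeplitz \<phi>)" by (simp add: \<phi>_def [abs_def])
  define b where "b = (- inverse w) ^ m"
  have nb: "norm b < norm a"
  proof -
    have "norm b = inverse (norm w ^ m)"
      by (simp add: b_def norm_power norm_inverse power_inverse)
    then have "norm b * norm w ^ m = 1" using w(2) by simp
    then have "norm b * norm w ^ m < norm a * norm w ^ m" using a by simp
    then show ?thesis by (rule mult_right_less_imp_less) simp
  qed
  define h where "h z = cnj a + cnj b * z ^ (n + m)" for z
  define p where "p z = z ^ n * (z - w) ^ m" for z
  define \<xi> where "\<xi> z = cnj (h z) * p z" for z
  have hc: "continuous_on UNIV h" unfolding h_def by (intro continuous_intros)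
  have hh: "h holomorphic_on ball 0 1" unfolding h_def by (intro holomorphic_intros)
  have hnz: "h z \<noteq> 0" if z: "norm z \<le> 1" for z
  proof
    assume "h z = 0"
    then have "norm (cnj a) = norm (cnj b * z ^ (n + m))"
      unfolding h_def by (metis add_eq_0_iff2 norm_minus_cancel)
    also have "\<dots> \<le> norm b * 1"
      unfolding norm_mult norm_power by (intro mult_mono power_le_one) (use z in auto)
    finally show False using nb by simp
  qed
  have pc: "continuous_on UNIV p" unfolding p_def by (intro continuous_intros)
  have ph: "p holomorphic_on ball 0 1" unfolding p_def by (intro holomorphic_intros)
  note pt = toeplitz_analytic[OF bounded_symbol_continuous[OF pc] ph]
  have \<phi>c: "continuous_on UNIV \<phi>" unfolding \<phi>_def by (intro continuous_intros)
  have \<xi>c: "continuous_on UNIV \<xi>" unfolding \<xi>_def by (intro continuous_intros hc pc)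
  have T\<xi>: "toeplitz \<xi> f = toeplitz (\<lambda>z. cnj (h z)) (\<lambda>z. p z * f z)" for f
    unfolding \<xi>_def by (rule toeplitz_mult_right[symmetric])
  have ih: "invertible_bergman_op (toeplitz (\<lambda>z. cnj (h z)))"
    by (rule invertible_toeplitz_coanalytic[OF hc hh hnz])
  have ih0: "f = g" if f: "f \<in> bergman_space" and g: "g \<in> bergman_space"
    and eq: "toeplitz (\<lambda>z. cnj (h z)) f = toeplitz (\<lambda>z. cnj (h z)) g" for f g
    using ih f g eq unfolding invertible_bergman_op_def by metis
  define \<psi> where "\<psi> z = \<xi> z - \<phi> z" for z
  have \<psi>c: "continuous_on UNIV \<psi>" unfolding \<psi>_def by (intro continuous_intros \<xi>c \<phi>c)
  have \<psi>0: "\<psi> z = 0" if z: "norm z = 1" for z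
  proof -
    \<comment> \<open>move \<open>n + m\<close> powers of \<open>cnj z\<close> into the factors \<open>z\<^sup>n\<close> and \<open>(z - w)\<^sup>m\<close>\<close>
    have zz: "cnj z * z = 1" using z by (simp add: complex_norm_square[symmetric] mult.commute)
    have "cnj z ^ (n + m) * (z ^ n * (z - w) ^ m) = (cnj z * z) ^ n * (cnj z * (z - w)) ^ m"
      by (simp add: power_add power_mult_distrib mult_ac)
    also have "\<dots> = (1 - cnj z * w) ^ m" by (simp add: zz right_diff_distrib)
    finally have "b * (cnj z ^ (n + m) * (z ^ n * (z - w) ^ m)) = (- inverse w * (1 - cnj z * w)) ^ m"
      by (simp only: b_def power_mult_distrib)
    also have "- inverse w * (1 - cnj z * w) = cnj z - inverse w"
      using w(2) by (simp add: field_simps)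
    finally show ?thesis
      by (simp add: \<psi>_def \<xi>_def \<phi>_def h_def p_def distrib_right mult.assoc)
  qed
  have sum: "(\<lambda>z. toeplitz \<phi> f z + toeplitz \<psi> f z) = toeplitz \<xi> f" if f: "f \<in> bergman_space" for f
    using toeplitz_add[OF bounded_symbol_continuous[OF \<phi>c] bounded_symbol_continuous[OF \<psi>c] f]
    by (simp add: \<psi>_def)
  have "invertible_bergman_op (\<lambda>f z. toeplitz \<phi> f z + toeplitz \<psi> f z)"
  proof (rule invertible_op_plus_vanishing_toeplitz[OF inv \<psi>c \<psi>0])
    fix f assume f: "f \<in> bergman_space" and "(\<lambda>z. toeplitz \<phi> f z + toeplitz \<psi> f z) = (\<lambda>z. 0)"
    then have "toeplitz (\<lambda>z. cnj (h z)) (\<lambda>z. p z * f z) = toeplitz (\<lambda>z. cnj (h z)) (\<lambda>z. 0)"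
      by (simp add: sum[OF f] T\<xi> bounded_op_zero[OF invertible_op_bounded[OF ih]])
    then have pf: "(\<lambda>z. p z * f z) = (\<lambda>z. 0)" by (rule ih0[OF pt(1)[OF f] bergman_zero])
    \<comment> \<open>off the null set \<open>{0, w}\<close> the factor \<open>p\<close> is nonzero, which suffices for the norm of \<open>f\<close>\<close>
    have f0: "f z = 0" if "z \<noteq> 0" "z \<noteq> w" for z
    proof -
      have "p z * f z = 0" using pf by metis
      then show ?thesis using that by (simp add: p_def)
    qed
    have "AE z in disc_measure. z \<noteq> 0 \<and> z \<noteq> w"
      unfolding disc_measure_def
    proof (rule AE_uniform_measureI)
      show "AE z in lborel. z \<in> ball 0 1 \<longrightarrow> z \<noteq> 0 \<and> z \<noteq> w"
        using AE_lborel_singleton[of 0] AE_lborel_singleton[of w] by eventually_elim simp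
    qed simp
    then have "AE z in disc_measure. (norm (f z))\<^sup>2 = 0"
      by eventually_elim (simp add: f0)
    then have "(L2_disc_norm f)\<^sup>2 = 0"
      unfolding L2_norm_square by (rule integral_eq_zero_AE)
    then show "f = (\<lambda>z. 0)" by (intro bergman_norm_eq_0 f) simp
  qed
  from invertible_op_onto[OF this bounded_opD(1)[OF invertible_op_bounded[OF ih] disc_power_bergman[of 0]]]
  obtain f where f: "f \<in> bergman_space"
    and "toeplitz (\<lambda>z. cnj (h z)) (\<lambda>z. p z * f z) = toeplitz (\<lambda>z. cnj (h z)) (disc_power 0)"
    using sum T\<xi> by metis
  from ih0[OF pt(1)[OF f] disc_power_bergman this(2)]
  \<comment> \<open>the constant 1 cannot be a multiple of \<open>z - w\<close>\<close>
  have "p w * f w = disc_power 0 w" by metis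
  then show False using m w by (simp add: p_def disc_power_def power_0_left)
qed

text \<open>
  The invertible operators form an open set: if \<open>a\<close> gave an invertible operator, so would
  \<open>a (1 + e)\<close> for small \<open>e > 0\<close>. This reduces equality to the strict inequality.
\<close>

lemma not_invertible_toeplitz_undominated:
  assumes a: "norm a * norm w ^ m \<ge> 1" and m: "m \<ge> 1"
  shows "\<not> invertible_bergman_op (toeplitz (\<lambda>z. a * z ^ n * (z - w) ^ m + (cnj z - inverse w) ^ m))"
proof
  define \<phi> where "\<phi> z = a * z ^ n * (z - w) ^ m + (cnj z - inverse w) ^ m" for z
  assume "invertible_bergman_op (toeplitz (\<lambda>z. a * z ^ n * (z - w) ^ m + (cnj z - inverse w) ^ m))"
  then have inv: "invertible_bergman_op (toeplitz \<phi>)" by (simp add: \<phi>_def [abs_def])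
  obtain C where C: "C > 0" "\<And>f. f \<in> bergman_space \<Longrightarrow> L2_disc_norm f \<le> C * L2_disc_norm (toeplitz \<phi> f)"
    using invertible_op_bounded_below[OF inv] by metis
  have a0: "a \<noteq> 0" using a by auto
  define p where "p z = a * z ^ n * (z - w) ^ m" for z
  have pc: "continuous_on UNIV p" unfolding p_def by (intro continuous_intros)
  obtain B where B: "\<And>z. norm z < 1 \<Longrightarrow> norm (p z) \<le> B"
    using bounded_symbol_continuous[OF pc] by (auto simp: bounded_symbol_def)
  define e where "e = 1 / (2 * C * (\<bar>B\<bar> + 1))"
  have e: "e > 0" using C(1) by (simp add: e_def add_nonneg_pos)
  have Ce: "C * (e * \<bar>B\<bar>) < 1" 
  proof -
    have "C * (e * \<bar>B\<bar>) = \<bar>B\<bar> / (2 * (\<bar>B\<bar> + 1))" using C(1) by (simp add: e_def)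
    also have "\<dots> < 1" by (simp add: divide_less_eq)
    finally show ?thesis .
  qed
  define r where "r z = of_real e * p z" for z
  have rc: "continuous_on UNIV r" unfolding r_def by (intro continuous_intros pc)
  have \<phi>c: "continuous_on UNIV \<phi>" unfolding \<phi>_def by (intro continuous_intros)
  note rs = bounded_symbol_continuous[OF rc]
  have rB: "norm (r z) \<le> e * \<bar>B\<bar>" if "norm z < 1" for z
    unfolding r_def norm_mult using B[OF that] e by (auto intro!: mult_left_mono)
  have "invertible_bergman_op (\<lambda>f z. toeplitz \<phi> f z + toeplitz r f z)"
    by (rule invertible_op_perturbation[OF inv bounded_bergman_op_toeplitz[OF rs] C toeplitz_norm_le[OF rs _ rB] Ce])
  moreover have "(\<lambda>z. toeplitz \<phi> f z + toeplitz r f z) =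
    toeplitz (\<lambda>z. (a * of_real (1 + e)) * z ^ n * (z - w) ^ m + (cnj z - inverse w) ^ m) f"
    if f: "f \<in> bergman_space" for f
    unfolding toeplitz_add[OF bounded_symbol_continuous[OF \<phi>c] rs f, symmetric]
    by (intro toeplitz_cong[OF f]) (simp add: \<phi>_def r_def p_def algebra_simps)
  ultimately have "invertible_bergman_op (toeplitz (\<lambda>z. (a * of_real (1 + e)) * z ^ n * (z - w) ^ m + (cnj z - inverse w) ^ m))"
    by (simp cong: invertible_op_cong)
  moreover have "norm (a * of_real (1 + e)) * norm w ^ m > 1"
  proof -
    have "1 < 1 * (1 + e)" using e by simp
    also have "\<dots> \<le> (norm a * norm w ^ m) * (1 + e)" using a e by (intro mult_right_mono) auto
    also have "\<dots> = norm (a * of_real (1 + e)) * norm w ^ m"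
    proof -
      have "norm (of_real (1 + e) :: complex) = 1 + e" by (subst norm_of_real) (use e in simp)
      then show ?thesis by (simp only: norm_mult mult_ac)
    qed
    finally show ?thesis .
  qed
  ultimately show False using not_invertible_toeplitz_winding[OF _ m] by blast
qed

lemma invertible_toeplitz_iff:
  assumes m: "m \<ge> 1"
  shows "invertible_bergman_op (toeplitz (\<lambda>z. a * z ^ n * (z - w) ^ m + (cnj z - inverse w) ^ m))
    \<longleftrightarrow> norm a < norm w powi (- int m)"
proof -
  have "norm a < norm w powi (- int m) \<longleftrightarrow> norm a * norm w ^ m < 1"
    using w(2) by (simp add: power_int_minus field_simps)
  moreover have "invertible_bergman_op (toeplitz (\<lambda>z. a * z ^ n * (z - w) ^ m + (cnj z - inverse w) ^ m))
      \<longleftrightarrow> norm a * norm w ^ m < 1"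
  proof (cases "norm a * norm w ^ m < 1")
    case True
    then show ?thesis by (simp only: invertible_toeplitz_dominated[OF True] simp_thms)
  next
    case False
    then have "1 \<le> norm a * norm w ^ m" by simp
    from not_invertible_toeplitz_undominated[OF this m] False show ?thesis by simp
  qed
  ultimately show ?thesis by simp
qed

end

section \<open>Winding numbers on the circle\<close>

text \<open>
  A power of \<open>z\<close> has a continuous logarithm on the circle only if its exponent is 0. The function
  \<open>H\<close> below takes values in the multiples of \<open>2\<pi>i\<close>, so it is constant, while over one period it changes
  by \<open>-2\<pi>i (j - k)\<close>.
\<close>

lemma winding_exponent_unique:
  fixes g :: "complex \<Rightarrow> complex" and j k :: nat
  assumes g: "continuous_on (sphere 0 1) g"
    and eq: "\<And>z. norm z = 1 \<Longrightarrow> z ^ j = z ^ k * exp (g z)"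
  shows "j = k"
proof -
  define H where "H t = g (cis t) - \<i> * of_real ((real j - real k) * t)" for t
  have "continuous_on UNIV (\<lambda>t. g (cis t))"
    by (rule continuous_on_compose2[OF g]) (auto intro!: continuous_intros)
  then have cH: "continuous_on UNIV H" unfolding H_def by (intro continuous_intros)
  have expH: "exp (H t) = 1" for t
  proof -
    have "cis t ^ j = cis t ^ k * exp (g (cis t))" by (rule eq) simp
    then have "exp (g (cis t)) = cis (real j * t) / cis (real k * t)"
      by (simp add: Complex.DeMoivre field_simps)
    also have "\<dots> = cis ((real j - real k) * t)"
      by (simp only: cis_divide left_diff_distrib)
    also have "\<dots> = exp (\<i> * of_real ((real j - real k) * t))"
      by (rule cis_conv_exp)
    finally show ?thesis by (simp add: H_def exp_diff)
  qed
  have "H constant_on UNIV"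
  proof (rule continuous_discrete_range_constant[OF connected_UNIV cH])
    fix s
    have "1 \<le> norm (H t - H s)" if ne: "H t \<noteq> H s" for t
    proof -
      have "exp (H t - H s) = 1" by (simp add: exp_diff expH)
      then obtain n :: int where n: "Re (H t - H s) = 0" "Im (H t - H s) = of_int (2 * n) * pi"
        by (auto simp: exp_eq_1)
      have "n \<noteq> 0" using n ne by (auto simp: complex_eq_iff)
      then have "1 \<le> \<bar>real_of_int n\<bar>" by linarith
      moreover have "norm (H t - H s) = \<bar>real_of_int n\<bar> * (2 * pi)"
        using n by (simp add: cmod_def abs_mult)
      ultimately show ?thesis using pi_ge_two mult_mono[of 1 "\<bar>real_of_int n\<bar>" 1 "2 * pi"] by simp
    qed
    then show "\<exists>e>0. \<forall>t. t \<in> UNIV \<and> H t \<noteq> H s \<longrightarrow> e \<le> norm (H t - H s)" by (intro exI[of _ 1]) auto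
  qed
  then have "H (2 * pi) = H 0" by (auto simp: constant_on_def)
  moreover have "cis (2 * pi) = cis 0" by simp
  ultimately show ?thesis by (simp add: H_def)
qed

text \<open>
  The number of zeros inside the disc is the winding number. For \<open>|\<rho>| > 1\<close> it is split off by
  \<open>1 - \<rho> z = z (cnj z - \<rho>)\<close>, valid on the circle, where the second factor is zero-free on the whole
  closed disc.
\<close>

lemma linear_factor_winding:
  fixes \<rho> :: complex
  assumes "norm \<rho> \<noteq> 1"
  obtains g where "continuous_on (sphere 0 1) g"
    "\<And>z. norm z = 1 \<Longrightarrow> 1 - \<rho> * z = z ^ (if norm \<rho> > 1 then 1 else 0) * exp (g z)"
proof (cases "norm \<rho> > 1")
  case True
  have nz: "cnj z - \<rho> \<noteq> 0" if "z \<in> cball 0 1" for z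
  proof
    assume "cnj z - \<rho> = 0"
    then have "norm \<rho> = norm z" by (metis complex_mod_cnj eq_iff_diff_eq_0)
    with that True show False by simp
  qed
  have c: "continuous_on (cball 0 1) (\<lambda>z. cnj z - \<rho>)" by (intro continuous_intros)
  obtain g where g: "continuous_on (cball 0 1) g" "\<And>z. z \<in> cball 0 1 \<Longrightarrow> cnj z - \<rho> = exp (g z)"
    using continuous_logarithm_on_cball[OF c] nz by metis
  show ?thesis
  proof (rule that)
    show "continuous_on (sphere 0 1) g" by (rule continuous_on_subset[OF g(1)]) auto
    fix z :: complex assume z: "norm z = 1"
    then have "z * cnj z = 1" by (simp add: complex_norm_square[symmetric])
    then have "1 - \<rho> * z = z * (cnj z - \<rho>)" by (simp add: right_diff_distrib mult.commute)
    then show "1 - \<rho> * z = z ^ (if norm \<rho> > 1 then 1 else 0) * exp (g z)"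
      using True g(2)[of z] z by simp
  qed
next
  case False
  with assms have l: "norm \<rho> < 1" by simp
  have nz: "1 - \<rho> * z \<noteq> 0" if "z \<in> cball 0 1" for z
  proof
    assume "1 - \<rho> * z = 0"
    then have "norm (\<rho> * z) = 1" by (metis eq_iff_diff_eq_0 norm_one)
    moreover have "norm \<rho> * norm z \<le> norm \<rho> * 1" using that by (intro mult_left_mono) auto
    ultimately show False using l by (simp add: norm_mult)
  qed
  have c: "continuous_on (cball 0 1) (\<lambda>z. 1 - \<rho> * z)" by (intro continuous_intros)
  obtain g where g: "continuous_on (cball 0 1) g" "\<And>z. z \<in> cball 0 1 \<Longrightarrow> 1 - \<rho> * z = exp (g z)"
    using continuous_logarithm_on_cball[OF c] nz by metis
  show ?thesis
  proof (rule that)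
    show "continuous_on (sphere 0 1) g" by (rule continuous_on_subset[OF g(1)]) auto
  qed (use False g(2) in simp)
qed

text \<open>
  The numbers \<open>\<zeta>\<close>, \<open>\<alpha>\<close>, \<open>\<beta>\<close> are the roots of \<open>z\<^sup>3 + a z\<^sup>2 + b z + c\<close>. Consequently the reversed
  polynomial \<open>1 + a z + b z\<^sup>2 + c z\<^sup>3\<close> is \<open>(1 - \<zeta> z) (1 - \<alpha> z) (1 - \<beta> z)\<close>, also when its degree is below 3.
\<close>

lemma cubic_reversed_factorization:
  fixes a b c :: complex
  obtains \<zeta> \<alpha> \<beta> where "a = - (\<zeta> + \<alpha> + \<beta>)" "b = \<zeta> * \<alpha> + \<zeta> * \<beta> + \<alpha> * \<beta>" "c = - (\<zeta> * \<alpha> * \<beta>)"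
proof -
  obtain \<zeta> where "(\<Sum>i\<le>3. [c, b, a, 1] ! i * \<zeta> ^ i) = 0"
  proof (rule fundamental_theorem_of_algebra[of "\<lambda>i. [c, b, a, 1] ! i" 3])
    show "[c, b, a, 1] ! 0 = 0 \<or> (\<exists>i\<in>{1..3}. [c, b, a, 1] ! i \<noteq> 0)"
      by (intro disjI2 bexI[of _ 3]) simp_all
  qed
  then have \<zeta>: "\<zeta> ^ 3 + a * \<zeta>\<^sup>2 + b * \<zeta> + c = 0"
    by (simp add: eval_nat_numeral algebra_simps)
  define s where "s = a + \<zeta>"
  define t where "t = b + \<zeta> * s"
  obtain \<alpha> where "(\<Sum>i\<le>2. [t, s, 1] ! i * \<alpha> ^ i) = 0"
  proof (rule fundamental_theorem_of_algebra[of "\<lambda>i. [t, s, 1] ! i" 2])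
    show "[t, s, 1] ! 0 = 0 \<or> (\<exists>i\<in>{1..2}. [t, s, 1] ! i \<noteq> 0)"
      by (intro disjI2 bexI[of _ 2]) simp_all
  qed
  then have \<alpha>: "\<alpha>\<^sup>2 + s * \<alpha> + t = 0"
    by (simp add: eval_nat_numeral algebra_simps)
  define \<beta> where "\<beta> = - s - \<alpha>"
  have "t - \<alpha> * \<beta> = \<alpha>\<^sup>2 + s * \<alpha> + t" by (simp add: \<beta>_def algebra_simps power2_eq_square)
  then have t: "t = \<alpha> * \<beta>" by (simp add: \<alpha>)
  show ?thesis
  proof (rule that[of \<zeta> \<alpha> \<beta>])
    show "a = - (\<zeta> + \<alpha> + \<beta>)" by (simp add: \<beta>_def s_def)
    have "b = t - \<zeta> * s" by (simp add: t_def)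
    then show b: "b = \<zeta> * \<alpha> + \<zeta> * \<beta> + \<alpha> * \<beta>" unfolding t by (simp add: \<beta>_def algebra_simps)
    have "c + \<zeta> * t = \<zeta> ^ 3 + a * \<zeta>\<^sup>2 + b * \<zeta> + c"
      by (simp add: t_def s_def algebra_simps power2_eq_square power3_eq_cube)
    then have "c = - (\<zeta> * t)" by (simp add: \<zeta> eq_neg_iff_add_eq_0)
    then show "c = - (\<zeta> * \<alpha> * \<beta>)" by (simp add: t mult.assoc)
  qed
qed

section \<open>The equation for the kernel\<close>

lemma bcoeff_toeplitz_cnj:
  assumes f: "f \<in> bergman_space"
  shows "bcoeff (toeplitz cnj f) n = of_nat (n + 1) / of_nat (n + 2) * bcoeff f (n + 1)"
proof -
  have bs: "bounded_symbol cnj" by (intro bounded_symbol_continuous continuous_intros)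
  have "L2_inner (\<lambda>z. cnj z * f z) (disc_power n) = L2_inner f (disc_power (n + 1))"
    unfolding L2_inner_def
    by (intro Bochner_Integration.integral_cong refl) (simp add: disc_power_def)
  moreover have "of_nat (n + 1 + 1) \<noteq> (0 :: complex)" unfolding of_nat_eq_0_iff by simp
  ultimately show ?thesis
    unfolding bcoeff_toeplitz[OF bs f] unfolding bcoeff_def by (simp add: field_simps del: of_nat_Suc of_nat_add)
qed

text \<open>
  By the weights in \<open>bcoeff_toeplitz_cnj\<close>, the function \<open>z f - z\<^sup>2 T f\<close>, with \<open>T\<close> the Toeplitz operator of
  the symbol \<open>cnj\<close>, has the Taylor coefficients of the primitive of \<open>f\<close> that vanishes at 0. This turns
  equations for Toeplitz operators with symbols \<open>cnj z + p(z)\<close> into differential equations.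
\<close>

lemma toeplitz_cnj_primitive:
  assumes f: "f \<in> bergman_space" and z: "norm z < 1"
  shows "((\<lambda>z. z * f z - z\<^sup>2 * toeplitz cnj f z) has_field_derivative f z) (at z)"
proof -
  have bs: "bounded_symbol cnj" by (intro bounded_symbol_continuous continuous_intros)
  have tA: "toeplitz cnj f \<in> bergman_space" by (rule toeplitz_bergman[OF bs f])
  define d where "d k = (case k of 0 \<Rightarrow> 0 | Suc n \<Rightarrow> bcoeff f n / of_nat (n + 1))" for k
  have dS: "(\<lambda>n. d n * x ^ n) sums (x * f x - x\<^sup>2 * toeplitz cnj f x)" if x: "norm x < 1" for x
  proof -
    have s1: "(\<lambda>n. x * (bcoeff f n * x ^ n)) sums (x * f x)"
      by (intro sums_mult bergman_sums f x)
    \<comment> \<open>the series of \<open>x\<^sup>2\<close> times the Toeplitz image; its term for \<open>n = 0\<close> is 0, which absorbs the shift\<close>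
    define u where "u n = of_nat n / of_nat (n + 1) * bcoeff f n * x ^ (n + 1)" for n
    have "(\<lambda>n. x\<^sup>2 * (bcoeff (toeplitz cnj f) n * x ^ n)) sums (x\<^sup>2 * toeplitz cnj f x)"
      by (intro sums_mult bergman_sums tA x)
    then have "(\<lambda>n. u (Suc n)) sums (x\<^sup>2 * toeplitz cnj f x)"
      by (simp add: u_def bcoeff_toeplitz_cnj[OF f] power2_eq_square mult_ac)
    then have "u sums (x\<^sup>2 * toeplitz cnj f x)"
      by (subst (asm) sums_Suc_iff) (simp add: u_def)
    from sums_diff[OF s1 this]
    have "(\<lambda>n. x * (bcoeff f n * x ^ n) - u n) sums (x * f x - x\<^sup>2 * toeplitz cnj f x)" .
    also have "(\<lambda>n. x * (bcoeff f n * x ^ n) - u n) = (\<lambda>n. d (Suc n) * x ^ Suc n)"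
    proof
      fix n
      have nz: "of_nat (n + 1) \<noteq> (0::complex)" unfolding of_nat_eq_0_iff by simp
      have "x * (bcoeff f n * x ^ n) - u n = (1 - of_nat n / of_nat (n + 1)) * (bcoeff f n * x ^ Suc n)"
        by (simp add: u_def algebra_simps)
      also have "1 - of_nat n / of_nat (n + 1) = 1 / (of_nat (n + 1) :: complex)"
        using nz by (simp add: field_simps)
      finally show "x * (bcoeff f n * x ^ n) - u n = d (Suc n) * x ^ Suc n"
        by (simp add: d_def)
    qed
    finally have "(\<lambda>n. d (Suc n) * x ^ Suc n) sums (x * f x - x\<^sup>2 * toeplitz cnj f x)" .
    then show ?thesis by (subst (asm) sums_Suc_iff) (simp add: d_def)
  qed
  have "((\<lambda>z. \<Sum>n. d n * z ^ n) has_field_derivative (\<Sum>n. diffs d n * z ^ n)) (at z)"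
    by (rule termdiffs_strong'[where K = 1]) (use dS z in \<open>auto simp: sums_iff\<close>)
  also have "diffs d = bcoeff f"
  proof
    fix n
    have "of_nat (n + 1) \<noteq> (0::complex)" unfolding of_nat_eq_0_iff by simp
    then show "diffs d n = bcoeff f n" by (simp add: diffs_def d_def)
  qed
  also have "(\<Sum>n. bcoeff f n * z ^ n) = f z"
    using bergman_sums[OF f z] by (simp add: sums_iff)
  finally have "((\<lambda>z. \<Sum>n. d n * z ^ n) has_field_derivative f z) (at z)" .
  then show ?thesis
    by (rule has_field_derivative_transform_within_open[where S = "ball 0 1"])
      (use z dS in \<open>auto simp: sums_iff\<close>)
qed

text \<open>
  The argument of each factor lies strictly between \<open>-\<pi>/2\<close> and \<open>\<pi>/2\<close>, so that of the product is
  never \<open>\<pi>\<close>.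
\<close>

lemma product_not_negative_real:
  fixes x y :: complex and n :: nat
  assumes "Re x > 0" "Re y > 0"
  shows "of_nat n * (x * y) \<noteq> -1"
proof
  assume eq: "of_nat n * (x * y) = -1"
  have y: "y \<noteq> 0" using assms by auto
  have "of_nat n * x = - inverse y" using eq y by (simp add: field_simps)
  then have "Re (of_nat n * x) = Re (- inverse y)" by simp
  then have "real n * Re x = - (Re y / ((Re y)\<^sup>2 + (Im y)\<^sup>2))" by simp
  moreover have "Re y / ((Re y)\<^sup>2 + (Im y)\<^sup>2) > 0" using assms by (intro divide_pos_pos add_pos_nonneg) auto
  moreover have "real n * Re x \<ge> 0" using assms by simp
  ultimately show False by linarith
qed

text \<open>
  The equation \<open>F = z (1 - \<zeta> z) r F'\<close> has a regular singular point at \<open>1 / \<zeta>\<close>, inside the disc, where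
  every solution vanishes. If the zero has a finite order \<open>n\<close>, comparison of the leading coefficients gives
  \<open>n r(1 / \<zeta>) = -1\<close>.
\<close>

lemma singular_ode_trivial:
  fixes F f r :: "complex \<Rightarrow> complex"
  assumes F: "\<And>z. norm z < 1 \<Longrightarrow> (F has_field_derivative f z) (at z)"
    and ode: "\<And>z. norm z < 1 \<Longrightarrow> F z = z * ((1 - \<zeta> * z) * r z) * f z"
    and r: "continuous_on (ball 0 1) r" and \<zeta>: "norm \<zeta> > 1"
    and res: "\<And>n::nat. of_nat n * r (inverse \<zeta>) \<noteq> -1"
    and z: "norm z < 1"
  shows "f z = 0"
proof -
  let ?p = "inverse \<zeta>"
  have \<zeta>0: "\<zeta> \<noteq> 0" using \<zeta> by auto
  have p: "?p \<in> ball 0 1" using \<zeta> by (simp add: norm_inverse inverse_less_1_iff)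
  have holF: "F holomorphic_on ball 0 1"
  proof (rule holomorphic_onI)
    fix x :: complex assume "x \<in> ball 0 1"
    then have "(F has_field_derivative f x) (at x)" by (intro F) simp
    then show "F field_differentiable at x within ball 0 1"
      unfolding field_differentiable_def using has_field_derivative_at_within by blast
  qed
  have F0: "F ?p = 0" using ode[of ?p] p \<zeta>0 by simp
  have "F constant_on ball 0 1"
  proof (rule ccontr)
    assume nc: "\<not> F constant_on ball 0 1"
    obtain g s n where s: "0 < (n::nat)" "0 < s" "ball ?p s \<subseteq> ball 0 1" "g holomorphic_on ball ?p s"
      and Fg: "\<And>w. w \<in> ball ?p s \<Longrightarrow> F w = (w - ?p) ^ n * g w"
      and g0: "\<And>w. w \<in> ball ?p s \<Longrightarrow> g w \<noteq> 0"
      by (rule holomorphic_factor_zero_nonconstant[OF holF open_ball connected_ball p F0 nc]) blast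
    \<comment> \<open>the differential equation divided by \<open>(w - 1 / \<zeta>)\<^sup>n\<close>; it passes to \<open>1 / \<zeta>\<close> by continuity\<close>
    define H where "H w = - \<zeta> * w * r w * (of_nat n * g w + (w - ?p) * deriv g w) - g w" for w
    have H0: "H w = 0" if w: "w \<in> ball ?p s" and ne: "w \<noteq> ?p" for w
    proof -
      have gd: "(g has_field_derivative deriv g w) (at w)"
        using s(4) w by (intro holomorphic_derivI) auto
      have "((\<lambda>w. (w - ?p) ^ n * g w) has_field_derivative
          of_nat n * (w - ?p) ^ (n - 1) * g w + (w - ?p) ^ n * deriv g w) (at w)"
        by (auto intro!: derivative_eq_intros gd simp: mult_ac)
      then have "(F has_field_derivative
          of_nat n * (w - ?p) ^ (n - 1) * g w + (w - ?p) ^ n * deriv g w) (at w)"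
        by (rule has_field_derivative_transform_within_open[where S = "ball ?p s"]) (use w Fg in auto)
      moreover have w1: "norm w < 1" using w s(3) by auto
      ultimately have fw: "f w = of_nat n * (w - ?p) ^ (n - 1) * g w + (w - ?p) ^ n * deriv g w"
        using F DERIV_unique by blast
      have fac: "1 - \<zeta> * w = - \<zeta> * (w - ?p)" using \<zeta>0 by (simp add: algebra_simps)
      have pw: "(w - ?p) * (w - ?p) ^ (n - 1) = (w - ?p) ^ n" using s(1) by (cases n) auto
      have "(w - ?p) * f w = (w - ?p) ^ n * (of_nat n * g w + (w - ?p) * deriv g w)"
        unfolding fw distrib_left pw[symmetric] by (simp add: mult_ac)
      then have "(w - ?p) ^ n * g w = - \<zeta> * w * r w * ((w - ?p) ^ n * (of_nat n * g w + (w - ?p) * deriv g w))"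
        using ode[OF w1] unfolding Fg[OF w] fac by (simp add: mult_ac)
      then have "(w - ?p) ^ n * H w = 0" by (simp add: H_def algebra_simps)
      then show ?thesis using ne by simp
    qed
    have pin: "?p \<in> ball ?p s" using s(2) by simp
    have "continuous_on (ball ?p s) H"
      unfolding H_def using s(4) s(3)
      by (intro continuous_intros holomorphic_on_imp_continuous_on[OF s(4)] continuous_on_subset[OF r]
          holomorphic_on_imp_continuous_on[OF holomorphic_deriv[OF s(4)]]) auto
    then have "isCont H ?p" using pin by (simp add: continuous_on_eq_continuous_at)
    then have l1: "H \<midarrow>?p\<rightarrow> H ?p" by (simp add: isCont_def)
    have "eventually (\<lambda>w. H w = 0) (at ?p)"
      unfolding eventually_at_topological using H0 pin by (intro exI[of _ "ball ?p s"]) auto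
    then have l2: "H \<midarrow>?p\<rightarrow> 0" by (rule tendsto_eventually)
    have "H ?p = 0" by (rule tendsto_unique[OF _ l1 l2]) simp
    moreover have "H ?p = - (g ?p * (of_nat n * r ?p + 1))"
      using \<zeta>0 by (simp add: H_def algebra_simps)
    ultimately have "g ?p * (of_nat n * r ?p + 1) = 0" by simp
    then have "of_nat n * r ?p = -1" using g0[OF pin] by (simp add: eq_neg_iff_add_eq_0)
    with res show False by blast
  qed
  then obtain k where k: "\<And>w. norm w < 1 \<Longrightarrow> F w = k" by (auto simp: constant_on_def)
  have "((\<lambda>_. k) has_field_derivative f z) (at z)"
    by (rule has_field_derivative_transform_within_open[OF F[OF z], where S = "ball 0 1"]) (use z k in auto)
  then show ?thesis using DERIV_const DERIV_unique by blast
qed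

section \<open>Symbols without zeros in the closed disc\<close>

text \<open>
  Write \<open>\<phi>(z) = cnj z + p(z)\<close>. On the circle \<open>\<phi> = cnj z (1 + z p) = (cnj z - \<zeta>) (1 - \<alpha> z) (1 - \<beta> z) = \<xi>\<close>, and
  \<open>T\<^sub>\<xi>\<close> is invertible since its two factors are a conjugate analytic and an analytic function without zeros
  in the closed disc. By the Fredholm alternative it remains to see that \<open>T\<^sub>\<phi>\<close> is injective. If \<open>T\<^sub>\<phi> f = 0\<close>, the
  primitive \<open>F\<close> of \<open>f\<close> satisfies \<open>F = z (1 + z p) F'\<close>, and a nonzero \<open>F\<close> would require
  \<open>n (1 - \<alpha> / \<zeta>) (1 - \<beta> / \<zeta>) = -1\<close>, although both factors have positive real part.
\<close>

lemma invertible_toeplitz_one_zero: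
  assumes \<zeta>: "norm \<zeta> > 1" and \<alpha>: "norm \<alpha> < 1" and \<beta>: "norm \<beta> < 1"
    and a: "a = - (\<zeta> + \<alpha> + \<beta>)" and b: "b = \<zeta> * \<alpha> + \<zeta> * \<beta> + \<alpha> * \<beta>" and c: "c = - (\<zeta> * \<alpha> * \<beta>)"
  shows "invertible_bergman_op (toeplitz (\<lambda>z. cnj z + a + b * z + c * z\<^sup>2))"
proof -
  define \<phi> where "\<phi> z = cnj z + a + b * z + c * z\<^sup>2" for z
  define p where "p z = a + b * z + c * z\<^sup>2" for z
  define r where "r z = (1 - \<alpha> * z) * (1 - \<beta> * z)" for z
  define h where "h z = z - cnj \<zeta>" for z
  have q: "1 + z * p z = (1 - \<zeta> * z) * r z" for z
    unfolding p_def r_def a b c by (simp add: algebra_simps power2_eq_square)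
  have lin: "1 - \<rho> * z \<noteq> 0" if "norm \<rho> < 1" "norm z \<le> 1" for \<rho> z :: complex
  proof
    assume "1 - \<rho> * z = 0"
    then have "norm (\<rho> * z) = 1" by (metis eq_iff_diff_eq_0 norm_one)
    moreover have "norm \<rho> * norm z \<le> norm \<rho> * 1" using that by (intro mult_left_mono) auto
    ultimately show False using that by (simp add: norm_mult)
  qed
  have rc: "continuous_on UNIV r" unfolding r_def by (intro continuous_intros)
  have rh: "r holomorphic_on ball 0 1" unfolding r_def by (intro holomorphic_intros)
  have rnz: "r z \<noteq> 0" if "norm z \<le> 1" for z unfolding r_def using lin[OF \<alpha> that] lin[OF \<beta> that] by simp
  have hc: "continuous_on UNIV h" unfolding h_def by (intro continuous_intros)
  have hh: "h holomorphic_on ball 0 1" unfolding h_def by (intro holomorphic_intros)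
  have hnz: "h z \<noteq> 0" if "norm z \<le> 1" for z using that \<zeta> by (auto simp: h_def)
  have pc: "continuous_on UNIV p" unfolding p_def by (intro continuous_intros)
  have ph: "p holomorphic_on ball 0 1" unfolding p_def by (intro holomorphic_intros)
  have cc: "continuous_on UNIV cnj" by (intro continuous_intros)
  have \<phi>c: "continuous_on UNIV \<phi>" unfolding \<phi>_def by (intro continuous_intros)
  define \<xi> where "\<xi> z = cnj (h z) * r z" for z
  have \<xi>c: "continuous_on UNIV \<xi>" unfolding \<xi>_def by (intro continuous_intros hc rc)
  have "invertible_bergman_op (\<lambda>f. toeplitz (\<lambda>z. cnj (h z)) (toeplitz r f))"
    by (rule invertible_op_compose[OF invertible_toeplitz_coanalytic[OF hc hh hnz] invertible_toeplitz_analytic[OF rc rh rnz]])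
  moreover have "toeplitz (\<lambda>z. cnj (h z)) (toeplitz r f) = toeplitz \<xi> f" if f: "f \<in> bergman_space" for f
    unfolding \<xi>_def
    by (rule toeplitz_coanalytic_left[OF bounded_symbol_cnj[OF bounded_symbol_continuous[OF hc]] hh bounded_symbol_continuous[OF rc] f])
  ultimately have i\<xi>: "invertible_bergman_op (toeplitz \<xi>)"
    by (simp cong: invertible_op_cong)
  define \<psi> where "\<psi> z = \<phi> z - \<xi> z" for z
  have \<psi>c: "continuous_on UNIV \<psi>" unfolding \<psi>_def by (intro continuous_intros \<xi>c \<phi>c)
  have \<psi>0: "\<psi> z = 0" if z: "norm z = 1" for z
  proof -
    have zz: "cnj z * z = 1" using z by (simp add: complex_norm_square[symmetric] mult.commute)
    have "\<phi> z = cnj z * (1 + z * p z)"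
      using zz by (simp add: \<phi>_def p_def distrib_left mult.assoc[symmetric])
    also have "\<dots> = (cnj z - \<zeta> * (cnj z * z)) * r z" unfolding q by (simp add: algebra_simps)
    also have "\<dots> = \<xi> z" by (simp add: zz \<xi>_def h_def)
    finally show ?thesis by (simp add: \<psi>_def)
  qed
  have sum: "(\<lambda>z. toeplitz \<xi> f z + toeplitz \<psi> f z) = toeplitz \<phi> f" if f: "f \<in> bergman_space" for f
    using toeplitz_add[OF bounded_symbol_continuous[OF \<xi>c] bounded_symbol_continuous[OF \<psi>c] f]
    by (simp add: \<psi>_def)
  have "invertible_bergman_op (\<lambda>f z. toeplitz \<xi> f z + toeplitz \<psi> f z)"
  proof (rule invertible_op_plus_vanishing_toeplitz[OF i\<xi> \<psi>c \<psi>0])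
    fix f assume f: "f \<in> bergman_space" and "(\<lambda>z. toeplitz \<xi> f z + toeplitz \<psi> f z) = (\<lambda>z. 0)"
    then have T0: "toeplitz \<phi> f = (\<lambda>z. 0)" by (simp add: sum[OF f])
    have "toeplitz (\<lambda>z. cnj z + p z) f = (\<lambda>z. toeplitz cnj f z + p z * f z)"
      using toeplitz_add[OF bounded_symbol_continuous[OF cc] bounded_symbol_continuous[OF pc] f]
      by (simp add: toeplitz_analytic(2)[OF bounded_symbol_continuous[OF pc] ph f])
    moreover have "(\<lambda>z. cnj z + p z) = \<phi>" by (simp add: \<phi>_def p_def fun_eq_iff)
    ultimately have t: "toeplitz cnj f z = - (p z * f z)" for z
      using T0 by (simp add: fun_eq_iff eq_neg_iff_add_eq_0)
    define F where "F z = z * f z - z\<^sup>2 * toeplitz cnj f z" for z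
    have "f z = 0" if z: "norm z < 1" for z
    proof (rule singular_ode_trivial[of F f \<zeta> r, OF _ _ _ \<zeta> _ z])
      show "(F has_field_derivative f z) (at z)" if "norm z < 1" for z
        unfolding F_def by (rule toeplitz_cnj_primitive[OF f that])
      show "F z = z * ((1 - \<zeta> * z) * r z) * f z" if "norm z < 1" for z
        unfolding q[symmetric] F_def t by (simp add: algebra_simps power2_eq_square)
      show "continuous_on (ball 0 1) r" by (rule continuous_on_subset[OF rc]) simp
      fix n :: nat
      have "Re (1 - \<rho> * inverse \<zeta>) > 0" if \<rho>: "norm \<rho> < 1" for \<rho>
      proof -
        have "Re (\<rho> * inverse \<zeta>) \<le> norm (\<rho> * inverse \<zeta>)" by (rule complex_Re_le_cmod)
        also have "\<dots> = norm \<rho> / norm \<zeta>" by (simp add: norm_mult norm_inverse divide_inverse)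
        also have "\<dots> < 1" using \<rho> \<zeta> by (simp add: divide_less_eq)
        finally show ?thesis by simp
      qed
      from product_not_negative_real[OF this[OF \<alpha>] this[OF \<beta>]]
      show "of_nat n * r (inverse \<zeta>) \<noteq> -1" unfolding r_def .
    qed
    moreover have "f z = 0" if "\<not> norm z < 1" for z using bergmanD(3)[OF f] that by simp
    ultimately show "f = (\<lambda>z. 0)" by blast
  qed
  then have "invertible_bergman_op (toeplitz \<phi>)"
    using invertible_op_cong[of "\<lambda>f z. toeplitz \<xi> f z + toeplitz \<psi> f z" "toeplitz \<phi>", OF sum] by simp
  then show ?thesis by (simp add: \<phi>_def [abs_def])
qed

text \<open>
  A symbol \<open>\<phi>\<close> without zeros in the closed disc has a continuous logarithm there, so it has winding
  number 0 on the circle. As \<open>z \<phi> = (1 - \<zeta> z) (1 - \<alpha> z) (1 - \<beta> z)\<close> on the circle, exactly one of the three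
  factors has its zero inside the disc.
\<close>

lemma invertible_toeplitz_nonvanishing:
  assumes nz: "\<And>z. norm z \<le> 1 \<Longrightarrow> cnj z + a + b * z + c * z\<^sup>2 \<noteq> 0"
  shows "invertible_bergman_op (toeplitz (\<lambda>z. cnj z + a + b * z + c * z\<^sup>2))"
proof -
  obtain \<zeta> \<alpha> \<beta> where a: "a = - (\<zeta> + \<alpha> + \<beta>)" and b: "b = \<zeta> * \<alpha> + \<zeta> * \<beta> + \<alpha> * \<beta>" and c: "c = - (\<zeta> * \<alpha> * \<beta>)"
    by (rule cubic_reversed_factorization)
  have q: "z * (cnj z + a + b * z + c * z\<^sup>2) = (1 - \<zeta> * z) * (1 - \<alpha> * z) * (1 - \<beta> * z)" if z: "norm z = 1" for z
  proof -
    have zz: "z * cnj z = 1" using z by (simp add: complex_norm_square[symmetric])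
    have "z * (cnj z + a + b * z + c * z\<^sup>2) = z * cnj z + z * (a + b * z + c * z\<^sup>2)"
      by (simp add: algebra_simps)
    also have "\<dots> = (1 - \<zeta> * z) * (1 - \<alpha> * z) * (1 - \<beta> * z)"
      unfolding zz a b c by (simp add: algebra_simps power2_eq_square)
    finally show ?thesis .
  qed
  have off: "norm \<rho> \<noteq> 1" if "\<rho> \<in> {\<zeta>, \<alpha>, \<beta>}" for \<rho>
  proof
    assume \<rho>: "norm \<rho> = 1"
    then have z: "norm (cnj \<rho>) = 1" by simp
    have "\<rho> * cnj \<rho> = 1" using \<rho> by (simp add: complex_norm_square[symmetric])
    then have "(1 - \<zeta> * cnj \<rho>) * (1 - \<alpha> * cnj \<rho>) * (1 - \<beta> * cnj \<rho>) = 0" using that by auto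
    with q[OF z] nz[of "cnj \<rho>"] z show False by auto
  qed
  define k where "k \<rho> = (if norm \<rho> > 1 then 1 else 0 :: nat)" for \<rho> :: complex
  obtain g1 where g1: "continuous_on (sphere 0 1) g1" "\<And>z. norm z = 1 \<Longrightarrow> 1 - \<zeta> * z = z ^ k \<zeta> * exp (g1 z)"
    using linear_factor_winding[OF off[of \<zeta>]] unfolding k_def by blast
  obtain g2 where g2: "continuous_on (sphere 0 1) g2" "\<And>z. norm z = 1 \<Longrightarrow> 1 - \<alpha> * z = z ^ k \<alpha> * exp (g2 z)"
    using linear_factor_winding[OF off[of \<alpha>]] unfolding k_def by blast
  obtain g3 where g3: "continuous_on (sphere 0 1) g3" "\<And>z. norm z = 1 \<Longrightarrow> 1 - \<beta> * z = z ^ k \<beta> * exp (g3 z)"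
    using linear_factor_winding[OF off[of \<beta>]] unfolding k_def by blast
  have "continuous_on (cball 0 1) (\<lambda>z. cnj z + a + b * z + c * z\<^sup>2)" by (intro continuous_intros)
  from continuous_logarithm_on_cball[OF this] nz
  obtain L where L: "continuous_on (cball 0 1) L"
    "\<And>z. z \<in> cball 0 1 \<Longrightarrow> cnj z + a + b * z + c * z\<^sup>2 = exp (L z)" by (metis dist_0_norm mem_cball)
  have "1 = k \<zeta> + k \<alpha> + k \<beta>"
  proof (rule winding_exponent_unique)
    show "continuous_on (sphere 0 1) (\<lambda>z. g1 z + g2 z + g3 z - L z)"
      by (intro continuous_intros g1 g2 g3 continuous_on_subset[OF L(1)]) auto
    fix z :: complex assume z: "norm z = 1"
    have "z * exp (L z) = (z ^ k \<zeta> * exp (g1 z)) * (z ^ k \<alpha> * exp (g2 z)) * (z ^ k \<beta> * exp (g3 z))"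
      using q[OF z] L(2)[of z] z by (simp add: g1(2) g2(2) g3(2))
    also have "\<dots> = z ^ (k \<zeta> + k \<alpha> + k \<beta>) * exp (g1 z + g2 z + g3 z)"
      by (simp add: exp_add power_add mult_ac)
    finally show "z ^ 1 = z ^ (k \<zeta> + k \<alpha> + k \<beta>) * exp (g1 z + g2 z + g3 z - L z)"
      by (simp add: exp_diff field_simps)
  qed
  then consider "norm \<zeta> > 1" "norm \<alpha> < 1" "norm \<beta> < 1" | "norm \<alpha> > 1" "norm \<zeta> < 1" "norm \<beta> < 1"
    | "norm \<beta> > 1" "norm \<zeta> < 1" "norm \<alpha> < 1"
    using off by (auto simp: k_def not_less le_less split: if_splits)
  then show ?thesis
  proof cases
    case 1
    then show ?thesis by (rule invertible_toeplitz_one_zero[OF _ _ _ a b c])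
  next
    case 2
    then show ?thesis by (rule invertible_toeplitz_one_zero) (simp_all add: a b c algebra_simps)
  next
    case 3
    then show ?thesis by (rule invertible_toeplitz_one_zero) (simp_all add: a b c algebra_simps)
  qed
qed

text \<open>
  Subtracting \<open>\<mu>\<close> changes the constant term of the symbol only. The image of the closed disc lies in
  the closure of the image of the open disc, so for \<open>\<mu>\<close> outside this closure the shifted symbol has no zero
  in the closed disc.
\<close>

lemma spectrum_subset_closure_image:
  defines "\<phi> \<equiv> (\<lambda>a b c z. cnj z + a + b * z + c * z\<^sup>2)"
  shows "bergman_spectrum (toeplitz (\<phi> a b c)) \<subseteq> closure (\<phi> a b c ` ball 0 1)"
proof
  fix \<mu> assume "\<mu> \<in> bergman_spectrum (toeplitz (\<phi> a b c))"
  then have ni: "\<not> invertible_bergman_op (\<lambda>f z. toeplitz (\<phi> a b c) f z - \<mu> * f z)"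
    by (simp add: bergman_spectrum_def)
  have c: "continuous_on UNIV (\<phi> a b c)" for a b c unfolding \<phi>_def by (intro continuous_intros)
  show "\<mu> \<in> closure (\<phi> a b c ` ball 0 1)"
  proof (rule ccontr)
    assume \<mu>: "\<mu> \<notin> closure (\<phi> a b c ` ball 0 1)"
    have "\<phi> a b c ` closure (ball 0 1) \<subseteq> closure (\<phi> a b c ` ball 0 1)"
      by (rule continuous_image_closure_subset[OF c]) simp
    then have "\<phi> a b c z \<in> closure (\<phi> a b c ` ball 0 1)" if "norm z \<le> 1" for z
      using that by (auto simp: image_subset_iff)
    then have "\<phi> a b c z \<noteq> \<mu>" if "norm z \<le> 1" for z using that \<mu> by metis
    then have "\<phi> a b c z - \<mu> \<noteq> 0" if "norm z \<le> 1" for z using that by simp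
    moreover have "cnj z + (a - \<mu>) + b * z + c * z\<^sup>2 = \<phi> a b c z - \<mu>" for z
      by (simp add: \<phi>_def)
    ultimately have "cnj z + (a - \<mu>) + b * z + c * z\<^sup>2 \<noteq> 0" if "norm z \<le> 1" for z
      using that by metis
    then have inv: "invertible_bergman_op (toeplitz (\<phi> (a - \<mu>) b c))"
      unfolding \<phi>_def by (rule invertible_toeplitz_nonvanishing)
    have bs: "bounded_symbol (\<lambda>z. - \<mu>)" by (intro bounded_symbol_continuous continuous_intros)
    have eq: "(\<lambda>z. toeplitz (\<phi> a b c) f z - \<mu> * f z) = toeplitz (\<phi> (a - \<mu>) b c) f"
      if f: "f \<in> bergman_space" for f
    proof -
      have "toeplitz (\<phi> (a - \<mu>) b c) f = toeplitz (\<lambda>z. \<phi> a b c z + - \<mu>) f"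
        by (rule toeplitz_cong[OF f]) (simp add: \<phi>_def)
      also have "\<dots> = (\<lambda>z. toeplitz (\<phi> a b c) f z + - \<mu> * f z)"
        unfolding toeplitz_add[OF bounded_symbol_continuous[OF c] bs f]
        by (simp add: toeplitz_analytic(2)[OF bs _ f])
      finally show ?thesis by simp
    qed
    have "invertible_bergman_op (\<lambda>f z. toeplitz (\<phi> a b c) f z - \<mu> * f z)"
      using invertible_op_cong[of "\<lambda>f z. toeplitz (\<phi> a b c) f z - \<mu> * f z" "toeplitz (\<phi> (a - \<mu>) b c)", OF eq] inv
      by simp
    with ni show False by blast
  qed
qed

theorem corollary2p1:
  "(\<forall>(a::complex) (w::complex) (n::nat) (m::nat).
      w \<in> ball 0 1 - {0} \<longrightarrow> n \<ge> 1 \<longrightarrow> m \<ge> 1 \<longrightarrow>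
      (invertible_bergman_op
         (toeplitz (\<lambda>z. a * z ^ n * (z - w) ^ m + (cnj z - inverse w) ^ m))
       \<longleftrightarrow> norm a < norm w powi (- int m))) \<and>
   (\<forall>(a::complex) (b::complex) (c::complex).
      let \<phi> = (\<lambda>z. cnj z + a + b * z + c * z\<^sup>2)
      in bergman_spectrum (toeplitz \<phi>) \<subseteq> closure (\<phi> ` ball 0 1))"
  unfolding Let_def
  using invertible_toeplitz_iff spectrum_subset_closure_image by auto

end
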